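(* The following decision problem is in $\mathsf{NL}$ (nondeterministic logarithmic space). Input: the Cayley table of a finite group $G$ and elements $c_1,\ldots,c_k\in G$. Question: do there exist $z_1,\ldots,z_k\in G$ with $\prod_{i=1}^k z_i^{-1}c_iz_i=1$?
   Context: The Cayley table of a finite group $G$ is the square matrix with rows and columns indexed by the elements of $G$ whose entry in row $g$ and column $h$ is the product $gh$. Group elements are encoded as binary numbers $1,\ldots,|G|$. *)

theory Defs
  imports "HOL-Algebra.Group" "HOL-Algebra.Coset" "HOL-Library.Landau_Symbols"
begin

section \<open>Nondeterministic logarithmic space\<close>

text \<open>
  Machines have a read-only two-way input tape, delimited by end markers, and a fixed number of
  read-write work tapes that are infinite to the right.
\<close>

datatype dir = MoveL | Stay | MoveR

datatype 'a cell = LeftEnd | Letter 'a | RightEnd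

text \<open>
  A transition \<open>(q, a, gs, q', d, as)\<close> may be taken in state \<open>q\<close> when the input head reads \<open>a\<close> and
  the work heads read \<open>gs\<close>; the new state is \<open>q'\<close>, the input head moves in direction \<open>d\<close>, and \<open>as\<close>
  lists for each work tape the symbol written and the direction of its head.
\<close>

record ('q, 'a, 'g) ntm =
  work_tapes :: nat
  blank :: 'g
  start :: 'q
  accept :: 'q
  trans :: "('q \<times> 'a cell \<times> 'g list \<times> 'q \<times> dir \<times> ('g \<times> dir) list) set"

text \<open>Finiteness of the transition table makes the set of usable states and symbols finite.\<close>

definition wf_ntm :: "('q, 'a, 'g) ntm \<Rightarrow> bool" where
  "wf_ntm M \<longleftrightarrow> finite (trans M) \<and>
     (\<forall>(q, a, gs, q', d, as) \<in> trans M. length gs = work_tapes M \<and> length as = work_tapes M)"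

text \<open>State, input head position, and contents and head position of each work tape.\<close>

type_synonym ('q, 'g) config = "'q \<times> nat \<times> ((nat \<Rightarrow> 'g) \<times> nat) list"

definition input_cell :: "'a list \<Rightarrow> nat \<Rightarrow> 'a cell" where
  "input_cell w p =
     (if p = 0 then LeftEnd else if p \<le> length w then Letter (w ! (p - 1)) else RightEnd)"

text \<open>A head on the leftmost cell that is told to move left stays where it is.\<close>

fun move :: "dir \<Rightarrow> nat \<Rightarrow> nat" where
  "move MoveL p = p - 1"
| "move Stay p = p"
| "move MoveR p = Suc p"

text \<open>
  The minimum below keeps the input head on the marked input, so that its position cannot serve
  as an unbounded counter.
\<close>

inductive step :: "('q, 'a, 'g) ntm \<Rightarrow> 'a list \<Rightarrow> ('q, 'g) config \<Rightarrow> ('q, 'g) config \<Rightarrow> bool"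
  for M w where
  "(q, input_cell w p, map (\<lambda>(t, h). t h) ts, q', d, as) \<in> trans M \<Longrightarrow>
   step M w (q, p, ts)
     (q', min (Suc (length w)) (move d p),
      map2 (\<lambda>(t, h) (g, e). (t(h := g), move e h)) ts as)"

definition initial :: "('q, 'a, 'g) ntm \<Rightarrow> ('q, 'g) config" where
  "initial M = (start M, 0, replicate (work_tapes M) (\<lambda>_. blank M, 0))"

definition reachable :: "('q, 'a, 'g) ntm \<Rightarrow> 'a list \<Rightarrow> ('q, 'g) config \<Rightarrow> bool" where
  "reachable M w c \<longleftrightarrow> (step M w)\<^sup>*\<^sup>* (initial M) c"

definition accepts :: "('q, 'a, 'g) ntm \<Rightarrow> 'a list \<Rightarrow> bool" where
  "accepts M w \<longleftrightarrow> (\<exists>p ts. reachable M w (accept M, p, ts))"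

text \<open>
  On every input and along every computation, accepting or not, each work head stays within the
  first \<open>s n\<close> cells, where \<open>n\<close> is the input length. The input tape is not counted.
\<close>

definition runs_in_space :: "('q, 'a, 'g) ntm \<Rightarrow> (nat \<Rightarrow> nat) \<Rightarrow> bool" where
  "runs_in_space M s \<longleftrightarrow>
     (\<forall>w q p ts. reachable M w (q, p, ts) \<longrightarrow> (\<forall>(t, h) \<in> set ts. h < s (length w)))"

text \<open>
  Finite sets of states and of work symbols can be renamed, so taking both from the natural
  numbers is no restriction.
\<close>

definition NL :: "('a::finite) list set set" where
  "NL = {A. \<exists>(M :: (nat, 'a, nat) ntm) s. wf_ntm M \<and> runs_in_space M s \<and>
           (\<lambda>n. real (s n)) \<in> O(\<lambda>n. ln (real n)) \<and> A = {w. accepts M w}}"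


section \<open>Encoding of Cayley tables\<close>

datatype letter = Zero | One | Comma | Semicolon

instance letter :: finite
proof
  have "(UNIV :: letter set) = {Zero, One, Comma, Semicolon}"
    using letter.exhaust by blast
  then show "finite (UNIV :: letter set)"
    by (metis finite.emptyI finite.insertI)
qed

text \<open>Most significant digit first, without leading zeros.\<close>

fun binary :: "nat \<Rightarrow> letter list" where
  "binary n = (if n = 0 then [] else binary (n div 2) @ [if even n then Zero else One])"

declare binary.simps [simp del]

definition encode_list :: "nat list \<Rightarrow> letter list" where
  "encode_list xs = concat (map (\<lambda>x. binary x @ [Comma]) xs)"

definition cayley_table :: "nat monoid \<Rightarrow> nat list list" where
  "cayley_table G =
     map (\<lambda>g. map (\<lambda>h. g \<otimes>\<^bsub>G\<^esub> h) [1..<Suc (order G)]) [1..<Suc (order G)]"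

text \<open>Every row is closed by a semicolon, so what follows the last semicolon is the list \<open>cs\<close>.\<close>

definition encode_instance :: "nat monoid \<Rightarrow> nat list \<Rightarrow> letter list" where
  "encode_instance G cs =
     concat (map (\<lambda>row. encode_list row @ [Semicolon]) (cayley_table G)) @ encode_list cs"


section \<open>Products of conjugates\<close>

definition list_product :: "('a, 'b) monoid_scheme \<Rightarrow> 'a list \<Rightarrow> 'a" where
  "list_product G xs = foldr (\<lambda>x y. x \<otimes>\<^bsub>G\<^esub> y) xs \<one>\<^bsub>G\<^esub>"

definition solvable_instance :: "('a, 'b) monoid_scheme \<Rightarrow> 'a list \<Rightarrow> bool" where
  "solvable_instance G cs \<longleftrightarrow>
     (\<exists>zs. length zs = length cs \<and> set zs \<subseteq> carrier G \<and>
        list_product G (map2 (\<lambda>z c. inv\<^bsub>G\<^esub> z \<otimes>\<^bsub>G\<^esub> c \<otimes>\<^bsub>G\<^esub> z) zs cs) = \<one>\<^bsub>G\<^esub>)"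

text \<open>
  The elements of a finite group are the numbers from 1 to its order; 1 need not be the neutral
  element. Words that do not encode a group together with elements of it are not in the language.
\<close>

definition conjugate_product_problem :: "letter list set" where
  "conjugate_product_problem =
     {encode_instance G cs | G cs.
        group G \<and> carrier G = {1..order G} \<and> set cs \<subseteq> carrier G \<and> solvable_instance G cs}"

end

theory Submission imports Defs begin

text \<open>
  A program over finitely many counters that are bounded by a power of two above the input length
  runs in logarithmic space, the counters being held in binary on parallel tracks of one tape. Such
  programs decide every property of positions of the word that is built from its letters, the
  order, Boolean connectives, quantifiers over positions and counting, and they can guess paths in
  definable graphs on pairs of positions.

  Scanning a prefix of the word yields the row, the column and the value of a table entry, so that
  the group axioms become such a property. Conjugation by \<open>z\<close> can be chosen independently for every
  factor, so solvability is the existence of a path: from \<open>(j, q)\<close> there is an edge to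
  \<open>(j + 1, p)\<close> whenever \<open>q\<close> is the product of some conjugate of \<open>c\<^bsub>j+1\<^esub>\<close> with \<open>p\<close>, and the path
  must lead from \<open>(0, 1)\<close> to \<open>(k, 1)\<close>.
\<close>

section \<open>Regular programs as Turing machines\<close>

text \<open>A nondeterministic program that tests a property gives none for its negation. Every
  property that occurs inside a formula therefore carries two programs, one for each truth value.
  This survives quantifiers over positions, because a universal one can be checked in order within a
  single run, and it survives counting, because a deterministic loop ends in one value, whichever
  side is tested. General reachability keeps only one side; it occurs once, positively, beneath
  nothing but conjunctions and existential quantifiers.

  The other obstacle is the space bound, which covers every computation, also those that get stuck
  after a wrong guess. The machine obtains the logarithm by counting the input cells in binary, and
  later the blank behind the digits acts as a wall.

  Numbers up to the word length suffice: the encoding of a group has one semicolon per element and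
  at least one comma, so the order lies below the length. Numerals in a malformed word may be larger
  and are cut off at the length.\<close>

datatype 'a prog =
    Atom 'a
  | Seq "'a prog" "'a prog"
  | Choice "'a prog" "'a prog"
  | Star "'a prog"

fun exec :: "('a \<Rightarrow> 's rel) \<Rightarrow> 'a prog \<Rightarrow> 's rel" where
  "exec I (Atom a) = I a"
| "exec I (Seq P Q) = exec I P O exec I Q"
| "exec I (Choice P Q) = exec I P \<union> exec I Q"
| "exec I (Star P) = (exec I P)\<^sup>*"

lemma exec_invariant:
  assumes "\<And>a s s'. a \<in> set_prog P \<Longrightarrow> (s, s') \<in> I a \<Longrightarrow> S s \<Longrightarrow> S s'"
    and "(s, s') \<in> exec I P" and "S s"
  shows "S s'"
  using assms
proof (induction P arbitrary: s s')
  case (Seq P Q)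
  from Seq.prems(2) obtain s1 where "(s, s1) \<in> exec I P" "(s1, s') \<in> exec I Q" by auto
  with Seq.IH Seq.prems(1,3) show ?case by (metis UnCI prog.set(2))
next
  case (Choice P Q)
  then show ?case by (metis UnE UnI1 UnI2 exec.simps(3) prog.set(3))
next
  case (Star P)
  from Star.prems(2) have "(s, s') \<in> (exec I P)\<^sup>*" by simp
  then show ?case
    by (induction rule: rtrancl_induct) (use Star.IH Star.prems(1,3) in auto)
qed auto

type_synonym 'a action = "('a cell \<times> nat \<times> dir \<times> nat \<times> dir) set"

text \<open>Input head position, content of the work tape, position of its head.\<close>

type_synonym data = "nat \<times> (nat \<Rightarrow> nat) \<times> nat"

definition act_rel :: "'a list \<Rightarrow> 'a action \<Rightarrow> data rel" where
  "act_rel w A =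
     {((p, t, h), (min (Suc (length w)) (move d p), t(h := g'), move e h)) | p t h d g' e.
        (input_cell w p, t h, d, g', e) \<in> A}"

text \<open>An action is a finite table, so a silent step can be listed only for the symbols of
  \<open>\<Gamma>\<close>.\<close>

definition skip :: "nat set \<Rightarrow> 'a action" where
  "skip \<Gamma> = {(a, g, Stay, g, Stay) | a g. g \<in> \<Gamma>}"

definition proper_action :: "nat set \<Rightarrow> 'a action \<Rightarrow> bool" where
  "proper_action \<Gamma> A \<longleftrightarrow> finite A \<and> (\<forall>(a, g, d, g', e) \<in> A. g' \<in> \<Gamma>)"

text \<open>The two conditions under which \<open>skip\<close> is the identity: the symbol under the
  work head is listed in the table, and clamping the input head has no effect.\<close>

definition proper_data :: "nat set \<Rightarrow> 'a list \<Rightarrow> data set" where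
  "proper_data \<Gamma> w = {(p, t, h). p \<le> Suc (length w) \<and> range t \<subseteq> \<Gamma>}"

lemma act_rel_proper:
  assumes "(c, c') \<in> act_rel w A" "proper_action \<Gamma> A" "c \<in> proper_data \<Gamma> w"
  shows "c' \<in> proper_data \<Gamma> w"
  using assms unfolding act_rel_def proper_data_def proper_action_def
  by fastforce

lemma exec_proper:
  assumes "(c, c') \<in> exec (act_rel w) P" "\<forall>A \<in> set_prog P. proper_action \<Gamma> A"
    "c \<in> proper_data \<Gamma> w"
  shows "c' \<in> proper_data \<Gamma> w"
  by (rule exec_invariant[where S = "\<lambda>c. c \<in> proper_data \<Gamma> w", OF _ assms(1,3)])
     (use assms(2) act_rel_proper in blast)

lemma exec_proper_image:
  assumes "\<forall>A \<in> set_prog P. proper_action \<Gamma> A" "X \<subseteq> proper_data \<Gamma> w"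
  shows "exec (act_rel w) P `` X \<subseteq> proper_data \<Gamma> w"
  using exec_proper[OF _ assms(1)] assms(2) by blast

lemma skip_iff:
  assumes "c \<in> proper_data \<Gamma> w"
  shows "(c, c') \<in> act_rel w (skip \<Gamma>) \<longleftrightarrow> c' = c"
proof -
  obtain p t h where "c = (p, t, h)" by (metis prod.exhaust)
  moreover from this have "p \<le> Suc (length w)" "t h \<in> \<Gamma>"
    using assms by (auto simp: proper_data_def)
  ultimately show ?thesis unfolding act_rel_def skip_def by auto
qed

text \<open>Control states of the compiled program other than its entry \<open>s\<close> and its exit \<open>f\<close> are
  numbered consecutively from \<open>i\<close>.\<close>

fun inner :: "'a prog \<Rightarrow> nat" where
  "inner (Atom a) = 0"
| "inner (Seq P Q) = Suc (inner P + inner Q)"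
| "inner (Choice P Q) = inner P + inner Q"
| "inner (Star P) = Suc (inner P)"

text \<open>Thompson's construction. The branches of a \<open>Choice\<close> share entry and exit,
  hence \<open>Star\<close> loops at a state of its own: a loop at a shared entry could be iterated
  and then left through the other branch.\<close>

fun edges :: "nat set \<Rightarrow> 'a action prog \<Rightarrow> nat \<Rightarrow> nat \<Rightarrow> nat \<Rightarrow> (nat \<times> 'a action \<times> nat) set" where
  "edges \<Gamma> (Atom A) s f i = {(s, A, f)}"
| "edges \<Gamma> (Seq P Q) s f i = edges \<Gamma> P s i (Suc i) \<union> edges \<Gamma> Q i f (Suc i + inner P)"
| "edges \<Gamma> (Choice P Q) s f i = edges \<Gamma> P s f i \<union> edges \<Gamma> Q s f (i + inner P)"
| "edges \<Gamma> (Star P) s f i = {(s, skip \<Gamma>, i), (i, skip \<Gamma>, f)} \<union> edges \<Gamma> P i i (Suc i)"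

lemma finite_edges: "finite (edges \<Gamma> P s f i)"
  by (induction P arbitrary: s f i) auto

lemma edges_actions: "(q, A, q') \<in> edges \<Gamma> P s f i \<Longrightarrow> A = skip \<Gamma> \<or> A \<in> set_prog P"
  by (induction P arbitrary: s f i) fastforce+

definition graph_step :: "'a list \<Rightarrow> (nat \<times> 'a action \<times> nat) set \<Rightarrow> (nat \<times> data) rel" where
  "graph_step w E = {((q, c), (q', c')). \<exists>A. (q, A, q') \<in> E \<and> (c, c') \<in> act_rel w A}"

lemma edges_complete:
  assumes "(c, c') \<in> exec (act_rel w) P" "\<forall>A \<in> set_prog P. proper_action \<Gamma> A"
    "c \<in> proper_data \<Gamma> w" "edges \<Gamma> P s f i \<subseteq> E"
  shows "((s, c), (f, c')) \<in> (graph_step w E)\<^sup>*"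
  using assms
proof (induction P arbitrary: s f i c c')
  case (Atom A)
  then show ?case unfolding graph_step_def by auto
next
  case (Seq P Q)
  from Seq.prems(1) obtain c1 where c1: "(c, c1) \<in> exec (act_rel w) P" "(c1, c') \<in> exec (act_rel w) Q"
    by auto
  have "c1 \<in> proper_data \<Gamma> w" using exec_proper[OF c1(1)] Seq.prems by auto
  then have "((i, c1), (f, c')) \<in> (graph_step w E)\<^sup>*"
    using Seq.prems(2,4) by (intro Seq.IH(2)[OF c1(2), where i = "Suc i + inner P"]) simp_all
  moreover have "((s, c), (i, c1)) \<in> (graph_step w E)\<^sup>*"
    using Seq.prems(2-4) by (intro Seq.IH(1)[OF c1(1), where i = "Suc i"]) simp_all
  ultimately show ?case by (rule rtrancl_trans[rotated])
next
  case (Choice P Q)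
  from Choice.prems(1) consider "(c, c') \<in> exec (act_rel w) P" | "(c, c') \<in> exec (act_rel w) Q"
    by auto
  then show ?case
  proof cases
    case 1
    then show ?thesis using Choice.prems(2-4) by (intro Choice.IH(1)[where i = i]) simp_all
  next
    case 2
    then show ?thesis
      using Choice.prems(2-4) by (intro Choice.IH(2)[where i = "i + inner P"]) simp_all
  qed
next
  case (Star P)
  have loop: "((i, c), (i, c')) \<in> (graph_step w E)\<^sup>* \<and> c' \<in> proper_data \<Gamma> w"
    if "(c, c') \<in> (exec (act_rel w) P)\<^sup>*" for c'
    using that
  proof (induction rule: rtrancl_induct)
    case base
    then show ?case using Star.prems by simp
  next
    case (step y z)
    have "((i, y), (i, z)) \<in> (graph_step w E)\<^sup>*"
      using Star.prems(2,4) step by (intro Star.IH[where i = "Suc i"]) simp_all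
    moreover have "z \<in> proper_data \<Gamma> w"
      using exec_proper[OF step(2), of \<Gamma>] Star.prems(2) step.IH by simp
    ultimately show ?case
      using rtrancl_trans[OF conjunct1[OF step.IH]] by (simp only: simp_thms)
  qed
  have c': "(c, c') \<in> (exec (act_rel w) P)\<^sup>*" using Star.prems(1) by simp
  have E: "(s, skip \<Gamma>, i) \<in> E" "(i, skip \<Gamma>, f) \<in> E" using Star.prems(4) by auto
  have "((s, c), (i, c)) \<in> graph_step w E"
    unfolding graph_step_def using E skip_iff[OF Star.prems(3)] by blast
  moreover have "((i, c'), (f, c')) \<in> graph_step w E"
    unfolding graph_step_def using E skip_iff[of c' \<Gamma> w c'] loop[OF c'] by blast
  ultimately show ?case using loop[OF c']
    by (meson converse_rtrancl_into_rtrancl rtrancl.rtrancl_into_rtrancl)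
qed

text \<open>The data that can occur at each inner control state when the program is entered with data
  in \<open>X\<close>.\<close>

fun reach :: "'a list \<Rightarrow> 'a action prog \<Rightarrow> data set \<Rightarrow> nat \<Rightarrow> nat \<Rightarrow> data set" where
  "reach w (Atom A) X i q = {}"
| "reach w (Seq P Q) X i q =
     (if q = i then exec (act_rel w) P `` X
      else if q < Suc i + inner P then reach w P X (Suc i) q
      else reach w Q (exec (act_rel w) P `` X) (Suc i + inner P) q)"
| "reach w (Choice P Q) X i q =
     (if q < i + inner P then reach w P X i q else reach w Q X (i + inner P) q)"
| "reach w (Star P) X i q =
     (if q = i then (exec (act_rel w) P)\<^sup>* `` X
      else reach w P ((exec (act_rel w) P)\<^sup>* `` X) (Suc i) q)"

text \<open>An annotation of the control graph in the manner of Floyd: \<open>\<Phi>\<close> assigns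
  data to each state, and every edge respects it. At the exit there is only an inclusion, since
  other branches, or earlier turns of a surrounding loop, contribute to the same state.\<close>

lemma edges_sound:
  assumes "\<forall>A \<in> set_prog P. proper_action \<Gamma> A" "X \<subseteq> proper_data \<Gamma> w"
    and "\<Phi> s = X" "exec (act_rel w) P `` X \<subseteq> \<Phi> f"
    and "\<And>q. i \<le> q \<Longrightarrow> q < i + inner P \<Longrightarrow> \<Phi> q = reach w P X i q"
    and "(q, A, q') \<in> edges \<Gamma> P s f i"
  shows "act_rel w A `` \<Phi> q \<subseteq> \<Phi> q'"
  using assms
proof (induction P arbitrary: s f i X q q')
  case (Atom A)
  then show ?case by auto
next
  case (Seq P Q)
  let ?Y = "exec (act_rel w) P `` X"
  have Y: "\<Phi> i = ?Y" using Seq.prems(5)[of i] by simp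
  have Y': "?Y \<subseteq> proper_data \<Gamma> w" using Seq.prems(1,2) by (intro exec_proper_image) auto
  have 1: "\<Phi> q = reach w P X (Suc i) q" if "Suc i \<le> q" "q < Suc i + inner P" for q
    using Seq.prems(5)[of q] that by auto
  have 2: "\<Phi> q = reach w Q ?Y (Suc i + inner P) q"
    if "Suc i + inner P \<le> q" "q < Suc i + inner P + inner Q" for q
    using Seq.prems(5)[of q] that by auto
  from Seq.prems(6) consider "(q, A, q') \<in> edges \<Gamma> P s i (Suc i)"
    | "(q, A, q') \<in> edges \<Gamma> Q i f (Suc i + inner P)" by auto
  then show ?case
  proof cases
    case q: 1
    show ?thesis
      by (rule Seq.IH(1)[OF _ Seq.prems(2,3) _ 1 q]) (use Seq.prems(1) Y in simp_all)
  next
    case q: 2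
    show ?thesis
      by (rule Seq.IH(2)[OF _ Y' Y _ 2 q])
        (use Seq.prems(1,4) in \<open>simp_all add: relcomp_Image\<close>)
  qed
next
  case (Choice P Q)
  have 1: "\<Phi> q = reach w P X i q" if "i \<le> q" "q < i + inner P" for q
    using Choice.prems(5)[of q] that by auto
  have 2: "\<Phi> q = reach w Q X (i + inner P) q"
    if "i + inner P \<le> q" "q < i + inner P + inner Q" for q
    using Choice.prems(5)[of q] that by auto
  from Choice.prems(6) consider "(q, A, q') \<in> edges \<Gamma> P s f i"
    | "(q, A, q') \<in> edges \<Gamma> Q s f (i + inner P)" by auto
  then show ?case
  proof cases
    case q: 1
    show ?thesis
      by (rule Choice.IH(1)[OF _ Choice.prems(2,3) _ 1 q])
        (use Choice.prems(1,4) in \<open>simp_all add: Un_Image\<close>)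
  next
    case q: 2
    show ?thesis
      by (rule Choice.IH(2)[OF _ Choice.prems(2,3) _ 2 q])
        (use Choice.prems(1,4) in \<open>simp_all add: Un_Image\<close>)
  qed
next
  case (Star P)
  let ?Y = "(exec (act_rel w) P)\<^sup>* `` X"
  have Y: "\<Phi> i = ?Y" using Star.prems(5)[of i] by simp
  have sub: "?Y \<subseteq> proper_data \<Gamma> w"
    using exec_proper_image[of "Star P"] Star.prems(1,2) by simp
  have 1: "\<Phi> q = reach w P ?Y (Suc i) q" if "Suc i \<le> q" "q < Suc i + inner P" for q
    using Star.prems(5)[of q] that by auto
  from Star.prems(6) consider "q = s" "A = skip \<Gamma>" "q' = i" | "q = i" "A = skip \<Gamma>" "q' = f"
    | "(q, A, q') \<in> edges \<Gamma> P i i (Suc i)" by auto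
  then show ?case
  proof cases
    case 1
    have "c' \<in> ?Y" if "(c, c') \<in> act_rel w (skip \<Gamma>)" "c \<in> X" for c c'
      using that skip_iff[of c \<Gamma> w c'] Star.prems(2) by blast
    then show ?thesis using 1 Star.prems(3) Y by blast
  next
    case 2
    have "c' \<in> ?Y" if "(c, c') \<in> act_rel w (skip \<Gamma>)" "c \<in> ?Y" for c c'
      using that skip_iff[of c \<Gamma> w c'] sub by blast
    moreover have "?Y \<subseteq> \<Phi> f" using Star.prems(4) by simp
    ultimately show ?thesis unfolding 2 Y by blast
  next
    case q: 3
    show ?thesis
    proof (rule Star.IH[OF _ sub Y _ 1 q])
      show "exec (act_rel w) P `` ?Y \<subseteq> \<Phi> i"
        unfolding Y by (blast intro: rtrancl_into_rtrancl)
    qed (use Star.prems(1) in simp_all)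
  qed
qed

text \<open>Mirrors \<open>reach\<close>, but without control states. Only intermediate data is
  constrained; the data at entry and exit is left to the surrounding program.\<close>

fun safe :: "'a list \<Rightarrow> data set \<Rightarrow> 'a action prog \<Rightarrow> data set \<Rightarrow> bool" where
  "safe w S (Atom A) X \<longleftrightarrow> True"
| "safe w S (Seq P Q) X \<longleftrightarrow> safe w S P X \<and> exec (act_rel w) P `` X \<subseteq> S \<and>
     safe w S Q (exec (act_rel w) P `` X)"
| "safe w S (Choice P Q) X \<longleftrightarrow> safe w S P X \<and> safe w S Q X"
| "safe w S (Star P) X \<longleftrightarrow> (exec (act_rel w) P)\<^sup>* `` X \<subseteq> S \<and> safe w S P ((exec (act_rel w) P)\<^sup>* `` X)"

lemma safe_reach:
  "safe w S P X \<Longrightarrow> i \<le> q \<Longrightarrow> q < i + inner P \<Longrightarrow> reach w P X i q \<subseteq> S"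
  by (induction P arbitrary: X i q) auto

lemma safe_antimono: "safe w S P Y \<Longrightarrow> X \<subseteq> Y \<Longrightarrow> safe w S P X"
proof (induction P arbitrary: X Y)
  case (Seq P Q)
  have sub: "exec (act_rel w) P `` X \<subseteq> exec (act_rel w) P `` Y" using Seq.prems(2) by blast
  have "safe w S Q (exec (act_rel w) P `` X)"
    by (rule Seq.IH(2)[OF _ sub]) (use Seq.prems(1) in simp)
  moreover have "safe w S P X"
    by (rule Seq.IH(1)[OF _ Seq.prems(2)]) (use Seq.prems(1) in simp)
  ultimately show ?case using Seq.prems(1) subset_trans[OF sub, of S] by simp
next
  case (Star P)
  have sub: "(exec (act_rel w) P)\<^sup>* `` X \<subseteq> (exec (act_rel w) P)\<^sup>* `` Y"
    using Star.prems(2) by blast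
  have "safe w S P ((exec (act_rel w) P)\<^sup>* `` X)"
    by (rule Star.IH[OF _ sub]) (use Star.prems(1) in simp)
  then show ?case using Star.prems(1) subset_trans[OF sub, of S] by simp
qed auto

lemma safe_invariant:
  assumes "\<And>A. A \<in> set_prog P \<Longrightarrow> act_rel w A `` I \<subseteq> I" "X \<subseteq> I" "I \<subseteq> S"
  shows "safe w S P X"
  using assms
proof (induction P arbitrary: X)
  case (Seq P Q)
  have "s' \<in> I" if "(s, s') \<in> exec (act_rel w) P" "s \<in> X" for s s'
    by (rule exec_invariant[where S = "\<lambda>c. c \<in> I", OF _ that(1)])
      (use Seq.prems that(2) in \<open>auto simp del: split_paired_All split_paired_Ex\<close>)
  then have "exec (act_rel w) P `` X \<subseteq> I" by blast
  with Seq show ?case by auto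
next
  case (Star P)
  have "s' \<in> I" if "(s, s') \<in> exec (act_rel w) (Star P)" "s \<in> X" for s s'
    by (rule exec_invariant[where S = "\<lambda>c. c \<in> I", OF _ that(1)])
      (use Star.prems that(2) in \<open>auto simp del: split_paired_All split_paired_Ex\<close>)
  then have "(exec (act_rel w) P)\<^sup>* `` X \<subseteq> I" by auto
  with Star show ?case by auto
qed auto

section \<open>The machine of a program, its language and its space\<close>

definition initial_data :: data where
  "initial_data = (0, \<lambda>_. 0, 0)"

text \<open>The entry of the control graph is 0 and the exit is 1, so the inner states start at 2.
  Accepting means arriving at the exit, that is, completing a run of the program.\<close>

definition machine :: "nat set \<Rightarrow> 'a action prog \<Rightarrow> (nat, 'a, nat) ntm" where
  "machine \<Gamma> P = \<lparr>work_tapes = 1, blank = 0, start = 0, accept = 1,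
     trans = {(q, a, [g], q', d, [(g', e)]) | q A q' a g d g' e.
       (q, A, q') \<in> edges \<Gamma> P 0 1 2 \<and> (a, g, d, g', e) \<in> A}\<rparr>"

lemma machine_simps [simp]:
  "work_tapes (machine \<Gamma> P) = 1" "blank (machine \<Gamma> P) = 0" "start (machine \<Gamma> P) = 0"
  "accept (machine \<Gamma> P) = 1"
  by (simp_all add: machine_def)

lemma finite_cell: "finite (UNIV :: 'a::finite cell set)"
proof -
  have eq: "(UNIV :: 'a cell set) = {LeftEnd, RightEnd} \<union> range Letter"
  proof (rule Set.set_eqI)
    show "x \<in> UNIV \<longleftrightarrow> x \<in> {LeftEnd, RightEnd} \<union> range Letter" for x :: "'a cell"
      by (cases x) auto
  qed
  show ?thesis unfolding eq by simp
qed

lemma finite_skip: "finite \<Gamma> \<Longrightarrow> finite (skip \<Gamma> :: 'a::finite action)"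
proof -
  assume "finite \<Gamma>"
  have "(skip \<Gamma> :: 'a action) = (\<lambda>(a, g). (a, g, Stay, g, Stay)) ` (UNIV \<times> \<Gamma>)"
    unfolding skip_def by auto
  moreover have "finite ((UNIV :: 'a cell set) \<times> \<Gamma>)"
    using \<open>finite \<Gamma>\<close> finite_cell by blast
  ultimately show ?thesis by (simp only: finite_imageI)
qed

lemma wf_machine:
  fixes P :: "'a::finite action prog"
  assumes "\<forall>A \<in> set_prog P. proper_action \<Gamma> A" "finite \<Gamma>"
  shows "wf_ntm (machine \<Gamma> P)"
proof -
  have "trans (machine \<Gamma> P) = (\<Union>(q, A, q') \<in> edges \<Gamma> P 0 1 2.
      (\<lambda>(a, g, d, g', e). (q, a, [g], q', d, [(g', e)])) ` A)"
    unfolding machine_def by (auto simp: image_iff) force+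
  moreover have "finite A" if "(q, A, q') \<in> edges \<Gamma> P 0 1 2" for q A q'
    using edges_actions[OF that] assms finite_skip by (auto simp: proper_action_def)
  ultimately have "finite (trans (machine \<Gamma> P))"
    by (simp only:) (rule finite_UN_I[OF finite_edges], auto simp del: One_nat_def)
  then show ?thesis unfolding wf_ntm_def by (auto simp: machine_def)
qed

lemma step_machine:
  "step (machine \<Gamma> P) w (q, p, [(t, h)]) x \<longleftrightarrow>
     (\<exists>q' p' t' h'. x = (q', p', [(t', h')]) \<and>
        ((q, p, t, h), (q', p', t', h')) \<in> graph_step w (edges \<Gamma> P 0 1 2))"
proof
  assume "step (machine \<Gamma> P) w (q, p, [(t, h)]) x"
  then show "\<exists>q' p' t' h'. x = (q', p', [(t', h')]) \<and>
      ((q, p, t, h), (q', p', t', h')) \<in> graph_step w (edges \<Gamma> P 0 1 2)"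
  proof cases
    case (1 q' d as)
    then obtain A g' e where A: "(q, A, q') \<in> edges \<Gamma> P 0 1 2"
      "(input_cell w p, t h, d, g', e) \<in> A" "as = [(g', e)]"
      unfolding machine_def by auto
    then show ?thesis using 1(1) unfolding graph_step_def act_rel_def by auto
  qed
next
  assume "\<exists>q' p' t' h'. x = (q', p', [(t', h')]) \<and>
      ((q, p, t, h), (q', p', t', h')) \<in> graph_step w (edges \<Gamma> P 0 1 2)"
  then obtain q' A d g' e where A: "(q, A, q') \<in> edges \<Gamma> P 0 1 2"
      "(input_cell w p, t h, d, g', e) \<in> A"
      and x: "x = (q', min (Suc (length w)) (move d p), [(t(h := g'), move e h)])"
    unfolding graph_step_def act_rel_def by auto
  have "(q, input_cell w p, map (\<lambda>(t, h). t h) [(t, h)], q', d, [(g', e)]) \<in> trans (machine \<Gamma> P)"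
    using A unfolding machine_def by auto
  from step.intros[OF this] show "step (machine \<Gamma> P) w (q, p, [(t, h)]) x"
    using x by simp
qed

lemma reachable_machine:
  "reachable (machine \<Gamma> P) w x \<longleftrightarrow>
     (\<exists>q p t h. x = (q, p, [(t, h)]) \<and>
        ((0, initial_data), (q, p, t, h)) \<in> (graph_step w (edges \<Gamma> P 0 1 2))\<^sup>*)"
proof
  assume "reachable (machine \<Gamma> P) w x"
  then have "(step (machine \<Gamma> P) w)\<^sup>*\<^sup>* (initial (machine \<Gamma> P)) x" by (simp add: reachable_def)
  then show "\<exists>q p t h. x = (q, p, [(t, h)]) \<and>
        ((0, initial_data), (q, p, t, h)) \<in> (graph_step w (edges \<Gamma> P 0 1 2))\<^sup>*"
  proof (induction rule: rtranclp_induct)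
    case base
    then show ?case by (simp add: initial_def initial_data_def)
  next
    case (step y z)
    then obtain q p t h where y: "y = (q, p, [(t, h)])"
      and r: "((0, initial_data), (q, p, t, h)) \<in> (graph_step w (edges \<Gamma> P 0 1 2))\<^sup>*"
      by blast
    from step(2) obtain q' p' t' h' where z: "z = (q', p', [(t', h')])"
      and "((q, p, t, h), (q', p', t', h')) \<in> graph_step w (edges \<Gamma> P 0 1 2)"
      unfolding y step_machine by blast
    from rtrancl_into_rtrancl[OF r this(2)] z show ?case by blast
  qed
next
  have "reachable (machine \<Gamma> P) w (case y of (q, p, t, h) \<Rightarrow> (q, p, [(t, h)]))"
    if "((0, initial_data), y) \<in> (graph_step w (edges \<Gamma> P 0 1 2))\<^sup>*" for y
    using that
  proof (induction rule: rtrancl_induct)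
    case base
    then show ?case by (simp add: reachable_def initial_def initial_data_def)
  next
    case (step y z)
    obtain q p t h where y: "y = (q, p, t, h)" by (metis prod.exhaust)
    obtain q' p' t' h' where z: "z = (q', p', t', h')" by (metis prod.exhaust)
    have "step (machine \<Gamma> P) w (q, p, [(t, h)]) (q', p', [(t', h')])"
      using step(2) y z step_machine by blast
    then show ?case using step(3) y z
      by (simp add: reachable_def rtranclp.rtrancl_into_rtrancl)
  qed
  then show "\<exists>q p t h. x = (q, p, [(t, h)]) \<and>
        ((0, initial_data), (q, p, t, h)) \<in> (graph_step w (edges \<Gamma> P 0 1 2))\<^sup>* \<Longrightarrow>
      reachable (machine \<Gamma> P) w x" by fastforce
qed

lemma graph_sound:
  assumes proper: "\<forall>A \<in> set_prog P. proper_action \<Gamma> A" "0 \<in> \<Gamma>"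
    and "((0, initial_data), (q, c)) \<in> (graph_step w (edges \<Gamma> P 0 1 2))\<^sup>*"
  shows "(q = 0 \<and> c = initial_data) \<or>
    (q = 1 \<and> (initial_data, c) \<in> exec (act_rel w) P) \<or>
    (2 \<le> q \<and> q < 2 + inner P \<and> c \<in> reach w P {initial_data} 2 q)"
proof -
  \<comment> \<open>States outside the compiled program receive the empty set, which makes them
    unreachable.\<close>
  define \<Phi> where "\<Phi> q = (if q = 0 then {initial_data}
      else if q = 1 then exec (act_rel w) P `` {initial_data}
      else if q < 2 + inner P then reach w P {initial_data} 2 q else {})" for q :: nat
  have X: "{initial_data} \<subseteq> proper_data \<Gamma> w"
    using proper(2) by (auto simp: proper_data_def initial_data_def)
  have *: "act_rel w A `` \<Phi> q \<subseteq> \<Phi> q'" if "(q, A, q') \<in> edges \<Gamma> P 0 1 2" for q A q'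
    by (rule edges_sound[OF proper(1) X _ _ _ that]) (auto simp: \<Phi>_def)
  have "snd y \<in> \<Phi> (fst y)"
    if "((0, initial_data), y) \<in> (graph_step w (edges \<Gamma> P 0 1 2))\<^sup>*" for y
    using that
  proof (induction rule: rtrancl_induct)
    case base
    then show ?case by (simp add: \<Phi>_def)
  next
    case (step y z)
    then show ?case using * by (fastforce simp: graph_step_def)
  qed
  from this[OF assms(3)] show ?thesis by (auto simp: \<Phi>_def split: if_splits)
qed

theorem accepts_machine:
  assumes "\<forall>A \<in> set_prog P. proper_action \<Gamma> A" "0 \<in> \<Gamma>"
  shows "accepts (machine \<Gamma> P) w \<longleftrightarrow> (\<exists>c. (initial_data, c) \<in> exec (act_rel w) P)"
proof
  assume "accepts (machine \<Gamma> P) w"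
  then obtain p t h
    where "((0, initial_data), (1, p, t, h)) \<in> (graph_step w (edges \<Gamma> P 0 1 2))\<^sup>*"
    unfolding accepts_def reachable_machine by auto
  from graph_sound[OF assms this] show "\<exists>c. (initial_data, c) \<in> exec (act_rel w) P" by auto
next
  assume "\<exists>c. (initial_data, c) \<in> exec (act_rel w) P"
  then obtain c where "(initial_data, c) \<in> exec (act_rel w) P" ..
  moreover have "initial_data \<in> proper_data \<Gamma> w"
    using assms(2) by (auto simp: proper_data_def initial_data_def)
  ultimately have "((0, initial_data), (1, c)) \<in> (graph_step w (edges \<Gamma> P 0 1 2))\<^sup>*"
    using edges_complete assms(1) by blast
  then show "accepts (machine \<Gamma> P) w"
    unfolding accepts_def reachable_machine by (cases c) auto
qed

text \<open>The interface that hides Turing machines from the rest. The space bound is split by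
  control state: \<open>0 < s n\<close> serves the initial one, \<open>exit\<close> the accepting
  one, and \<open>safe\<close> all others.\<close>

theorem NL_by_program:
  fixes P :: "'a::finite action prog"
  assumes proper: "\<forall>A \<in> set_prog P. proper_action \<Gamma> A" and \<Gamma>: "0 \<in> \<Gamma>" "finite \<Gamma>"
    and lang: "\<And>w. w \<in> L \<longleftrightarrow> (\<exists>c. (initial_data, c) \<in> exec (act_rel w) P)"
    and s: "(\<lambda>n. real (s n)) \<in> O(\<lambda>n. ln (real n))" "\<And>n. 0 < s n"
    and safe: "\<And>w. safe w {(p, t, h). h < s (length w)} P {initial_data}"
    and exit: "\<And>w p t h. (initial_data, (p, t, h)) \<in> exec (act_rel w) P \<Longrightarrow> h < s (length w)"
  shows "L \<in> NL"
proof -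
  have "runs_in_space (machine \<Gamma> P) s"
    unfolding runs_in_space_def
  proof (intro allI impI)
    fix w q p ts
    assume "reachable (machine \<Gamma> P) w (q, p, ts)"
    then obtain t h where ts: "ts = [(t, h)]"
      and r: "((0, initial_data), (q, p, t, h)) \<in> (graph_step w (edges \<Gamma> P 0 1 2))\<^sup>*"
      unfolding reachable_machine by auto
    have "h < s (length w)"
      using graph_sound[OF proper \<Gamma>(1) r]
    proof (elim disjE conjE)
      assume "(p, t, h) = initial_data"
      then show ?thesis using s(2) by (simp add: initial_data_def)
    next
      assume "(initial_data, p, t, h) \<in> exec (act_rel w) P"
      then show ?thesis by (rule exit)
    next
      assume "2 \<le> q" "q < 2 + inner P" "(p, t, h) \<in> reach w P {initial_data} 2 q"
      with safe_reach[OF safe[of w], of 2 q] show ?thesis by blast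
    qed
    then show "\<forall>(t, h) \<in> set ts. h < s (length w)" using ts by simp
  qed
  moreover have "L = {w. accepts (machine \<Gamma> P) w}"
    using lang accepts_machine[OF proper \<Gamma>(1)] by auto
  ultimately show ?thesis
    unfolding NL_def using wf_machine[OF proper \<Gamma>(2)] s(1) by blast
qed

text \<open>The alphabet consists of the blank, the marker and \<open>2 ^ K\<close> vectors of
  \<open>K\<close> bits. Demanding the bound for \<open>f g\<close> as well makes the action proper
  for any \<open>f\<close>.\<close>

definition action :: "nat \<Rightarrow> ('a cell \<Rightarrow> nat \<Rightarrow> bool) \<Rightarrow> dir \<Rightarrow> (nat \<Rightarrow> nat) \<Rightarrow> dir \<Rightarrow> 'a action" where
  "action K C d f e = {(a, g, d, f g, e) | a g. g < 2 + 2 ^ K \<and> f g < 2 + 2 ^ K \<and> C a g}"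

lemma act_rel_action:
  "((p, t, h), c') \<in> act_rel w (action K C d f e) \<longleftrightarrow>
     t h < 2 + 2 ^ K \<and> f (t h) < 2 + 2 ^ K \<and> C (input_cell w p) (t h) \<and>
     c' = (min (Suc (length w)) (move d p), t(h := f (t h)), move e h)"
  unfolding act_rel_def action_def by auto

lemma proper_action_action: "proper_action {..<2 + 2 ^ K} (action K C d f e :: 'a::finite action)"
proof -
  have "finite ((UNIV :: 'a cell set) \<times> {..<2 + 2 ^ K :: nat})"
    using finite_cell by blast
  then have "finite ((\<lambda>(a, g). (a, g, d, f g, e)) ` ((UNIV :: 'a cell set) \<times> {..<2 + 2 ^ K}))"
    by (rule finite_imageI)
  moreover have "(action K C d f e :: 'a action) \<subseteq>
      (\<lambda>(a, g). (a, g, d, f g, e)) ` ((UNIV :: 'a cell set) \<times> {..<2 + 2 ^ K})"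
    unfolding action_def by auto
  ultimately have "finite (action K C d f e :: 'a action)" by (rule rev_finite_subset)
  then show ?thesis unfolding proper_action_def by (auto simp: action_def)
qed

section \<open>Binary counters on a tape\<close>

definition num :: "nat \<Rightarrow> (nat \<Rightarrow> bool) \<Rightarrow> nat" where
  "num m B = (\<Sum>x<m. of_bool (B x) * 2 ^ x)"

lemma num_simps [simp]: "num 0 B = 0" "num (Suc m) B = num m B + of_bool (B m) * 2 ^ m"
  by (simp_all add: num_def)

lemma num_cong: "(\<And>x. x < m \<Longrightarrow> B x = B' x) \<Longrightarrow> num m B = num m B'"
  by (simp add: num_def)

lemma num_less: "num m B < 2 ^ m"
  by (induction m) (auto simp: of_bool_def)

lemma num_ones: "(\<And>x. x < m \<Longrightarrow> B x) \<Longrightarrow> Suc (num m B) = 2 ^ m"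
  by (induction m) auto

lemma num_zeros: "(\<And>x. x < m \<Longrightarrow> \<not> B x) \<Longrightarrow> num m B = 0"
  by (simp add: num_def)

text \<open>The low ones are worth \<open>2 ^ j - 1\<close>, exactly one less than the bit that
  replaces them. Read from \<open>B\<close> to \<open>B'\<close> this is an increment, from
  \<open>B'\<close> to \<open>B\<close> a decrement, so one lemma serves both.\<close>

lemma num_carry:
  assumes "j < m" "\<And>x. x < j \<Longrightarrow> B x" "\<not> B j"
    and "\<And>x. x < m \<Longrightarrow> B' x = (if x \<le> j then \<not> B x else B x)"
  shows "num m B' = Suc (num m B)"
  using assms(1,4)
proof (induction m)
  case (Suc m)
  show ?case
  proof (cases "j = m")
    case True
    have "num m B' = 0" using Suc.prems assms(2) True by (intro num_zeros) auto
    moreover have "Suc (num m B) = 2 ^ m" using assms(2) True by (intro num_ones) auto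
    ultimately show ?thesis using Suc.prems(2)[of m] True assms(3) by simp
  next
    case False
    then show ?thesis using Suc.IH Suc.prems by auto
  qed
qed simp

text \<open>The digit at which a carry (\<open>b\<close> true) or a borrow (\<open>b\<close> false)
  stops. The hypothesis excludes the one pattern without such a digit: all ones, respectively all
  zeros.\<close>

lemma num_first:
  assumes "num m B \<noteq> 0 \<and> \<not> b \<or> Suc (num m B) < 2 ^ m \<and> b"
  obtains j where "j < m" "\<And>x. x < j \<Longrightarrow> B x = b" "B j \<noteq> b"
proof -
  have "\<exists>j. j < m \<and> B j \<noteq> b"
  proof (rule ccontr)
    assume "\<nexists>j. j < m \<and> B j \<noteq> b"
    then show False using assms num_ones[of m B] num_zeros[of m B] by auto
  qed
  then obtain j where "j < m \<and> B j \<noteq> b" "\<forall>x<j. \<not> (x < m \<and> B x \<noteq> b)"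
    using exists_least_iff[of "\<lambda>j. j < m \<and> B j \<noteq> b"] by blast
  with that show thesis by auto
qed

text \<open>Work symbol 0 is the blank, 1 marks the leftmost cell, and \<open>2 + v\<close> holds the bits of \<open>v\<close>, one
  for each counter. The cells to the right of the marker hold the counters, least significant bit
  first.\<close>

definition flip :: "nat \<Rightarrow> nat \<Rightarrow> nat" where
  "flip i g = 2 + flip_bit i (g - 2)"

definition tape :: "nat \<Rightarrow> nat \<Rightarrow> (nat \<Rightarrow> nat) \<Rightarrow> bool" where
  "tape K m t \<longleftrightarrow> t 0 = 1 \<and> (\<forall>x<m. 2 \<le> t (Suc x) \<and> t (Suc x) < 2 + 2 ^ K) \<and>
     (\<forall>x\<ge>m. t (Suc x) = 0)"

abbreviation digit :: "(nat \<Rightarrow> nat) \<Rightarrow> nat \<Rightarrow> nat \<Rightarrow> bool" where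
  "digit t i x \<equiv> bit (t (Suc x) - 2) i"

definition counter :: "nat \<Rightarrow> (nat \<Rightarrow> nat) \<Rightarrow> nat \<Rightarrow> nat" where
  "counter m t i = num m (digit t i)"

text \<open>The tape in the middle of a carry or borrow that has passed \<open>j\<close> digits of
  track \<open>i\<close>.\<close>

definition flips :: "nat \<Rightarrow> nat \<Rightarrow> (nat \<Rightarrow> nat) \<Rightarrow> nat \<Rightarrow> nat" where
  "flips j i t x = (if 0 < x \<and> x \<le> j then flip i (t x) else t x)"

lemma flip_ge: "2 \<le> flip i g"
  by (simp add: flip_def)

lemma flip_less: "i < K \<Longrightarrow> 2 \<le> g \<Longrightarrow> g < 2 + 2 ^ K \<Longrightarrow> flip i g < Suc (Suc (2 ^ K))"
proof -
  assume *: "i < K" "2 \<le> g" "g < 2 + 2 ^ K"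
  then have "take_bit K (g - 2) = g - 2" by (intro take_bit_nat_eq_self) linarith
  then have "flip_bit i (g - 2) = take_bit K (flip_bit i (g - 2))"
    using * by (simp add: take_bit_flip_bit_eq)
  then have "flip_bit i (g - 2) < 2 ^ K" by (metis take_bit_nat_less_exp)
  then show ?thesis by (simp add: flip_def)
qed

lemma bit_flip: "bit (flip i g - 2) i' \<longleftrightarrow> (if i' = i then \<not> bit (g - 2) i else bit (g - 2) i')"
  by (auto simp: flip_def bit_flip_bit_iff)

lemma flips_0 [simp]: "flips 0 i t = t"
  by (auto simp: flips_def)

lemma flips_Suc: "flips (Suc j) i t = (flips j i t)(Suc j := flip i (t (Suc j)))"
  by (auto simp: flips_def)

lemma flips_outside [simp]: "flips j i t (Suc j) = t (Suc j)"
  by (simp add: flips_def)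

lemma tape_flips: "tape K m t \<Longrightarrow> i < K \<Longrightarrow> j \<le> m \<Longrightarrow> tape K m (flips j i t)"
  using flip_less[of i K "t (Suc _)"] by (auto simp: tape_def flips_def flip_ge)

lemma digit_flips: "digit (flips j i t) i' x \<longleftrightarrow> (if i' = i \<and> x < j then \<not> digit t i' x else digit t i' x)"
  by (auto simp: flips_def bit_flip)

lemma counter_less: "counter m t i < 2 ^ m"
  by (simp add: counter_def num_less)

lemma counter_flips_other: "i' \<noteq> i \<Longrightarrow> counter m (flips j i t) i' = counter m t i'"
  unfolding counter_def by (rule num_cong) (simp add: digit_flips)

lemma counter_flips_up:
  assumes "j < m" "\<And>x. x < j \<Longrightarrow> digit t i x" "\<not> digit t i j"
  shows "counter m (flips (Suc j) i t) i = Suc (counter m t i)"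
  unfolding counter_def
  by (rule num_carry[where j = j]) (use assms in \<open>auto simp: digit_flips less_Suc_eq_le\<close>)

lemma counter_flips_down:
  assumes "j < m" "\<And>x. x < j \<Longrightarrow> \<not> digit t i x" "digit t i j"
  shows "counter m t i = Suc (counter m (flips (Suc j) i t) i)"
  unfolding counter_def
  by (rule num_carry[where j = j]) (use assms in \<open>auto simp: digit_flips less_Suc_eq_le\<close>)

section \<open>Incrementing, decrementing and testing a binary counter\<close>

definition go :: "nat \<Rightarrow> 'a action prog" where
  "go K = Atom (action K (\<lambda>a g. g = 1) Stay (\<lambda>g. g) MoveR)"

text \<open>A \<open>Star\<close> may stop at any time. The test for the marker discards all runs
  that stop before the leftmost cell; the later loops are forced to completion by a closing test in
  the same way.\<close>

definition rewind :: "nat \<Rightarrow> 'a action prog" where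
  "rewind K = Seq (Star (Atom (action K (\<lambda>a g. 2 \<le> g) Stay (\<lambda>g. g) MoveL)))
     (Atom (action K (\<lambda>a g. g = 1) Stay (\<lambda>g. g) Stay))"

definition carry :: "nat \<Rightarrow> bool \<Rightarrow> nat \<Rightarrow> 'a action prog" where
  "carry K b i = Star (Atom (action K (\<lambda>a g. 2 \<le> g \<and> bit (g - 2) i = b) Stay (flip i) MoveR))"

text \<open>A digit is required under the head, so a carry out of the highest digit, or a borrow
  from zero, has no continuation.\<close>

definition turn :: "nat \<Rightarrow> bool \<Rightarrow> nat \<Rightarrow> 'a action prog" where
  "turn K b i = Atom (action K (\<lambda>a g. 2 \<le> g \<and> bit (g - 2) i \<noteq> b) Stay (flip i) MoveL)"

text \<open>Adding 1 flips the trailing ones and the next digit; subtracting 1 flips the trailing zeros and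
  the next digit. The flag \<open>b\<close> selects between the two.\<close>

definition count_step :: "nat \<Rightarrow> bool \<Rightarrow> nat \<Rightarrow> 'a action prog" where
  "count_step K b i = Seq (go K) (Seq (carry K b i) (Seq (turn K b i) (rewind K)))"

definition zero_test :: "nat \<Rightarrow> nat \<Rightarrow> 'a action prog" where
  "zero_test K i = Seq (go K)
     (Seq (Star (Atom (action K (\<lambda>a g. 2 \<le> g \<and> \<not> bit (g - 2) i) Stay (\<lambda>g. g) MoveR)))
     (Seq (Atom (action K (\<lambda>a g. g = 0) Stay (\<lambda>g. g) MoveL)) (rewind K)))"

lemma tape_less: "tape K m t \<Longrightarrow> t x < 2 + 2 ^ K"
proof (cases x)
  case (Suc y)
  then show "tape K m t \<Longrightarrow> t x < 2 + 2 ^ K" by (cases "y < m") (simp_all add: tape_def)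
qed (simp add: tape_def)

lemma tape_0: "tape K m t \<Longrightarrow> t 0 = Suc 0"
  by (simp add: tape_def)

lemma tape_Suc:
  assumes "tape K m t"
  shows "2 \<le> t (Suc x) \<longleftrightarrow> x < m" "t (Suc x) = 0 \<longleftrightarrow> m \<le> x" "t (Suc x) \<noteq> Suc 0"
proof -
  have "x < m \<Longrightarrow> 2 \<le> t (Suc x)" "m \<le> x \<Longrightarrow> t (Suc x) = 0"
    using assms by (simp_all add: tape_def)
  then show "2 \<le> t (Suc x) \<longleftrightarrow> x < m" "t (Suc x) = 0 \<longleftrightarrow> m \<le> x" "t (Suc x) \<noteq> Suc 0"
    by (cases "x < m"; fastforce)+
qed

lemma exec_go:
  assumes "tape K m t" "p \<le> Suc (length w)"
  shows "((p, t, 0), c') \<in> exec (act_rel w) (go K) \<longleftrightarrow> c' = (p, t, 1)"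
  using assms tape_less[OF assms(1)] by (auto simp: go_def act_rel_action tape_0 min_def)

lemma exec_rewind:
  assumes "tape K m t" "p \<le> Suc (length w)" "h \<le> m"
  shows "((p, t, h), c') \<in> exec (act_rel w) (rewind K) \<longleftrightarrow> c' = (p, t, 0)"
proof -
  let ?A = "action K (\<lambda>a g. 2 \<le> g) Stay (\<lambda>g. g) MoveL :: 'a action"
  have star: "\<exists>h'\<le>h. c = (p, t, h')" if "((p, t, h), c) \<in> (act_rel w ?A)\<^sup>*" for c
    using that
  proof (induction rule: rtrancl_induct)
    case (step y z)
    then obtain h' where "h' \<le> h" "y = (p, t, h')" by blast
    with step(2) assms(2) show ?case by (auto simp: act_rel_action min_def)
  qed auto
  have "((p, t, h), (p, t, 0)) \<in> (act_rel w ?A)\<^sup>*"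
    using assms(3)
  proof (induction h)
    case (Suc h)
    have "((p, t, Suc h), (p, t, h)) \<in> act_rel w ?A"
      using Suc.prems assms(1,2) tape_less[OF assms(1)]
      by (simp add: act_rel_action tape_Suc min_def)
    with Suc show ?case by (simp add: converse_rtrancl_into_rtrancl)
  qed simp
  moreover have "((p, t, 0), (p, t, 0)) \<in>
      act_rel w (action K (\<lambda>a g. g = 1) Stay (\<lambda>g. g) Stay :: 'a action)"
    using assms tape_less[OF assms(1)] by (auto simp: act_rel_action tape_0 min_def)
  ultimately have "((p, t, h), (p, t, 0)) \<in> exec (act_rel w) (rewind K)"
    unfolding rewind_def by auto
  moreover have "c' = (p, t, 0)" if "((p, t, h), c') \<in> exec (act_rel w) (rewind K)"
  proof -
    from that obtain c where c: "((p, t, h), c) \<in> (act_rel w ?A)\<^sup>*"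
      "(c, c') \<in> act_rel w (action K (\<lambda>a g. g = 1) Stay (\<lambda>g. g) Stay)"
      unfolding rewind_def by auto
    from star[OF c(1)] obtain h' where h': "c = (p, t, h')" by blast
    have "t h' = 1" "c' = (p, t, h')"
      using c(2) assms(2) unfolding h' by (auto simp: act_rel_action min_def)
    moreover from this have "h' = 0" using tape_Suc(3)[OF assms(1)] by (cases h') auto
    ultimately show ?thesis by simp
  qed
  ultimately show ?thesis by blast
qed

lemma exec_carry:
  assumes "tape K m t" "p \<le> Suc (length w)" "i < K"
  shows "((p, t, 1), c') \<in> exec (act_rel w) (carry K b i) \<longleftrightarrow>
    (\<exists>j\<le>m. (\<forall>x<j. digit t i x = b) \<and> c' = (p, flips j i t, Suc j))"
proof -
  let ?A = "action K (\<lambda>a g. 2 \<le> g \<and> bit (g - 2) i = b) Stay (flip i) MoveR :: 'a action"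
  have "\<exists>j\<le>m. (\<forall>x<j. digit t i x = b) \<and> c = (p, flips j i t, Suc j)"
    if "((p, t, 1), c) \<in> (act_rel w ?A)\<^sup>*" for c
    using that
  proof (induction rule: rtrancl_induct)
    case base
    then show ?case by (intro exI[of _ 0]) simp
  next
    case (step y z)
    then obtain j where j: "j \<le> m" "\<forall>x<j. digit t i x = b" "y = (p, flips j i t, Suc j)" by blast
    with step(2) assms(2) have "2 \<le> t (Suc j)" "digit t i j = b" "z = (p, flips (Suc j) i t, Suc (Suc j))"
      by (auto simp: act_rel_action min_def flips_Suc)
    with j assms(1) show ?case
      by (intro exI[of _ "Suc j"]) (auto simp: tape_Suc less_Suc_eq)
  qed
  moreover have "((p, t, 1), (p, flips j i t, Suc j)) \<in> (act_rel w ?A)\<^sup>*"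
    if "j \<le> m" "\<forall>x<j. digit t i x = b" for j
    using that
  proof (induction j)
    case (Suc j)
    have "2 \<le> t (Suc j)" using Suc.prems assms(1) by (simp add: tape_Suc)
    then have "((p, flips j i t, Suc j), (p, flips (Suc j) i t, Suc (Suc j))) \<in> act_rel w ?A"
      using Suc.prems assms tape_less[OF assms(1)]
      by (auto simp: act_rel_action flips_Suc min_def flip_less)
    with Suc show ?case by (auto intro: rtrancl_into_rtrancl)
  qed simp
  ultimately show ?thesis unfolding carry_def exec.simps by blast
qed

lemma exec_turn:
  assumes "tape K m t" "p \<le> Suc (length w)" "i < K" "j \<le> m"
  shows "((p, flips j i t, Suc j), c') \<in> exec (act_rel w) (turn K b i) \<longleftrightarrow>
    j < m \<and> digit t i j \<noteq> b \<and> c' = (p, flips (Suc j) i t, j)"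
  using assms tape_less[OF assms(1)]
  by (auto simp: turn_def act_rel_action tape_Suc flips_Suc flip_less min_def)

lemma exec_count_step:
  assumes "tape K m t" "p \<le> Suc (length w)" "i < K"
  shows "((p, t, 0), c') \<in> exec (act_rel w) (count_step K b i) \<longleftrightarrow>
    (\<exists>j<m. (\<forall>x<j. digit t i x = b) \<and> digit t i j \<noteq> b \<and> c' = (p, flips (Suc j) i t, 0))"
    (is "?L \<longleftrightarrow> ?R")
proof
  assume ?L
  then obtain c1 c2 c3 where c: "((p, t, 0), c1) \<in> exec (act_rel w) (go K)"
    "(c1, c2) \<in> exec (act_rel w) (carry K b i)" "(c2, c3) \<in> exec (act_rel w) (turn K b i)"
    "(c3, c') \<in> exec (act_rel w) (rewind K)"
    unfolding count_step_def exec.simps by blast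
  from c(1) have "c1 = (p, t, 1)" using exec_go[OF assms(1,2)] by blast
  with c(2) obtain j where j: "j \<le> m" "\<forall>x<j. digit t i x = b" "c2 = (p, flips j i t, Suc j)"
    using exec_carry[OF assms] by blast
  with c(3) have j': "j < m" "digit t i j \<noteq> b" "c3 = (p, flips (Suc j) i t, j)"
    using exec_turn[OF assms j(1)] by blast+
  with c(4) have "c' = (p, flips (Suc j) i t, 0)"
    using exec_rewind[OF tape_flips[OF assms(1,3), of "Suc j"] assms(2), of j] by auto
  with j j' show ?R by blast
next
  assume ?R
  then obtain j where j: "j < m" "\<forall>x<j. digit t i x = b" "digit t i j \<noteq> b"
    "c' = (p, flips (Suc j) i t, 0)" by blast
  have "((p, t, 0), (p, t, 1)) \<in> exec (act_rel w) (go K)"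
    using exec_go[OF assms(1,2)] by blast
  moreover have "((p, t, 1), (p, flips j i t, Suc j)) \<in> exec (act_rel w) (carry K b i)"
    using exec_carry[OF assms] j by auto
  moreover have "((p, flips j i t, Suc j), (p, flips (Suc j) i t, j)) \<in> exec (act_rel w) (turn K b i)"
    using exec_turn[OF assms, of j] j by auto
  moreover have "((p, flips (Suc j) i t, j), c') \<in> exec (act_rel w) (rewind K)"
    using exec_rewind[OF tape_flips[OF assms(1,3), of "Suc j"] assms(2), of j] j by auto
  ultimately show ?L unfolding count_step_def exec.simps by blast
qed

lemma exec_zero_test:
  assumes "tape K m t" "p \<le> Suc (length w)"
  shows "((p, t, 0), c') \<in> exec (act_rel w) (zero_test K i) \<longleftrightarrow>
    (\<forall>x<m. \<not> digit t i x) \<and> c' = (p, t, 0)" (is "?L \<longleftrightarrow> ?R")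
proof -
  let ?A = "action K (\<lambda>a g. 2 \<le> g \<and> \<not> bit (g - 2) i) Stay (\<lambda>g. g) MoveR :: 'a action"
  let ?E = "Atom (action K (\<lambda>a g. g = 0) Stay (\<lambda>g. g) MoveL) :: 'a action prog"
  have 1: "\<exists>j\<le>m. (\<forall>x<j. \<not> digit t i x) \<and> c = (p, t, Suc j)"
    if "((p, t, 1), c) \<in> (act_rel w ?A)\<^sup>*" for c
    using that
  proof (induction rule: rtrancl_induct)
    case base
    then show ?case by (intro exI[of _ 0]) simp
  next
    case (step y z)
    then obtain j where j: "j \<le> m" "\<forall>x<j. \<not> digit t i x" "y = (p, t, Suc j)" by blast
    with step(2) assms(2) have "2 \<le> t (Suc j)" "\<not> digit t i j" "z = (p, t, Suc (Suc j))"
      by (auto simp: act_rel_action min_def)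
    with j assms(1) show ?case
      by (intro exI[of _ "Suc j"]) (auto simp: tape_Suc less_Suc_eq)
  qed
  have 2: "((p, t, 1), (p, t, Suc j)) \<in> (act_rel w ?A)\<^sup>*"
    if "j \<le> m" "\<forall>x<j. \<not> digit t i x" for j
    using that
  proof (induction j)
    case (Suc j)
    have "2 \<le> t (Suc j)" using Suc.prems assms(1) by (simp add: tape_Suc)
    then have "((p, t, Suc j), (p, t, Suc (Suc j))) \<in> act_rel w ?A"
      using Suc.prems assms tape_less[OF assms(1)]
      by (auto simp: act_rel_action min_def)
    with Suc show ?case by (auto intro: rtrancl_into_rtrancl)
  qed simp
  have 3: "((p, t, Suc j), c) \<in> exec (act_rel w) ?E \<longleftrightarrow> m \<le> j \<and> c = (p, t, j)" for j c
    using assms tape_less[OF assms(1)] by (auto simp: act_rel_action tape_Suc min_def)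
  show ?thesis
  proof
    assume ?L
    then obtain c1 c2 c3 where c: "((p, t, 0), c1) \<in> exec (act_rel w) (go K)"
      "(c1, c2) \<in> (act_rel w ?A)\<^sup>*" "(c2, c3) \<in> exec (act_rel w) ?E"
      "(c3, c') \<in> exec (act_rel w) (rewind K)"
      unfolding zero_test_def exec.simps by blast
    from c(1) have "c1 = (p, t, 1)" using exec_go[OF assms] by blast
    with c(2) 1 obtain j where j: "j \<le> m" "\<forall>x<j. \<not> digit t i x" "c2 = (p, t, Suc j)"
      by blast
    with c(3) 3 have "m \<le> j" "c3 = (p, t, j)" by blast+
    with c(4) j exec_rewind[OF assms, of j c'] show ?R by auto
  next
    assume R: ?R
    have "((p, t, 0), (p, t, 1)) \<in> exec (act_rel w) (go K)"
      using exec_go[OF assms] by blast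
    moreover have "((p, t, 1), (p, t, Suc m)) \<in> (act_rel w ?A)\<^sup>*" using 2 R by blast
    moreover have "((p, t, Suc m), (p, t, m)) \<in> exec (act_rel w) ?E" using 3 by blast
    moreover have "((p, t, m), c') \<in> exec (act_rel w) (rewind K)"
      using exec_rewind[OF assms, of m c'] R by blast
    ultimately show ?L unfolding zero_test_def exec.simps by blast
  qed
qed

section \<open>Programs with counters\<close>

datatype 'a catom = Inc nat | Dec nat | IsZero nat | Go dir | Read "'a cell"

text \<open>A state consists of the counters and the position of the input head.\<close>

type_synonym cstate = "(nat \<Rightarrow> nat) \<times> nat"

text \<open>The cap stands for \<open>2 ^ m\<close>, where \<open>m\<close> is the number of digits,
  which depends on the input. \<open>Inc\<close> has no successor at the cap, which reflects the
  overflow of the binary counter.\<close>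

fun crel :: "'a list \<Rightarrow> nat \<Rightarrow> 'a catom \<Rightarrow> cstate rel" where
  "crel w cap (Inc i) = {((\<sigma>, p), (\<sigma>(i := Suc (\<sigma> i)), p)) | \<sigma> p. Suc (\<sigma> i) < cap}"
| "crel w cap (Dec i) = {((\<sigma>, p), (\<sigma>(i := \<sigma> i - 1), p)) | \<sigma> p. 0 < \<sigma> i}"
| "crel w cap (IsZero i) = {((\<sigma>, p), (\<sigma>, p)) | \<sigma> p. \<sigma> i = 0}"
| "crel w cap (Go d) = {((\<sigma>, p), (\<sigma>, min (Suc (length w)) (move d p))) | \<sigma> p. True}"
| "crel w cap (Read a) = {((\<sigma>, p), (\<sigma>, p)) | \<sigma> p. input_cell w p = a}"

fun counters_below :: "nat \<Rightarrow> 'a catom \<Rightarrow> bool" where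
  "counters_below K (Inc i) \<longleftrightarrow> i < K"
| "counters_below K (Dec i) \<longleftrightarrow> i < K"
| "counters_below K (IsZero i) \<longleftrightarrow> i < K"
| "counters_below K _ \<longleftrightarrow> True"

fun impl_atom :: "nat \<Rightarrow> 'a catom \<Rightarrow> 'a action prog" where
  "impl_atom K (Inc i) = count_step K True i"
| "impl_atom K (Dec i) = count_step K False i"
| "impl_atom K (IsZero i) = zero_test K i"
| "impl_atom K (Go d) = Atom (action K (\<lambda>a g. True) d (\<lambda>g. g) Stay)"
| "impl_atom K (Read a) = Atom (action K (\<lambda>a' g. a' = a) Stay (\<lambda>g. g) Stay)"

fun impl :: "nat \<Rightarrow> 'a catom prog \<Rightarrow> 'a action prog" where
  "impl K (Atom a) = impl_atom K a"
| "impl K (Seq P Q) = Seq (impl K P) (impl K Q)"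
| "impl K (Choice P Q) = Choice (impl K P) (impl K Q)"
| "impl K (Star P) = Star (impl K P)"

definition resting :: "nat \<Rightarrow> nat \<Rightarrow> 'a list \<Rightarrow> data \<Rightarrow> bool" where
  "resting K m w c \<longleftrightarrow> (\<exists>p t. c = (p, t, 0) \<and> tape K m t \<and> p \<le> Suc (length w))"

definition counters :: "nat \<Rightarrow> data \<Rightarrow> cstate" where
  "counters m c = (case c of (p, t, h) \<Rightarrow> (\<lambda>i. counter m t i, p))"

lemma resting_flips:
  "tape K m t \<Longrightarrow> p \<le> Suc (length w) \<Longrightarrow> i < K \<Longrightarrow> j < m \<Longrightarrow> resting K m w (p, flips (Suc j) i t, 0)"
  by (simp add: resting_def tape_flips)

lemma counters_flips:
  "counters m (p, flips j i t, 0) = ((\<lambda>i. counter m t i)(i := counter m (flips j i t) i), p)"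
  by (auto simp: counters_def counter_flips_other)

lemma impl_atom_correct:
  assumes "resting K m w c" "counters_below K a"
  shows impl_atom_sound: "(c, c') \<in> exec (act_rel w) (impl_atom K a) \<Longrightarrow>
      resting K m w c' \<and> (counters m c, counters m c') \<in> crel w (2 ^ m) a"
    and impl_atom_complete: "(counters m c, s) \<in> crel w (2 ^ m) a \<Longrightarrow>
      \<exists>c'. (c, c') \<in> exec (act_rel w) (impl_atom K a) \<and> resting K m w c' \<and> counters m c' = s"
proof -
  from assms(1) obtain p t where c: "c = (p, t, 0)" and t: "tape K m t" and p: "p \<le> Suc (length w)"
    unfolding resting_def by blast
  note step = exec_count_step[OF t p]
  have less: "t 0 < 2 + 2 ^ K" using tape_less[OF t] .
  show "resting K m w c' \<and> (counters m c, counters m c') \<in> crel w (2 ^ m) a"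
    if "(c, c') \<in> exec (act_rel w) (impl_atom K a)"
  proof (cases a)
    case (Inc i)
    with that assms(2) c step obtain j where j: "j < m" "\<forall>x<j. digit t i x" "\<not> digit t i j"
      "c' = (p, flips (Suc j) i t, 0)" and i: "i < K" by auto
    have "counter m (flips (Suc j) i t) i = Suc (counter m t i)"
      using counter_flips_up j by blast
    moreover from this have "Suc (counter m t i) < 2 ^ m" by (metis counter_less)
    ultimately show ?thesis
      unfolding Inc j(4) c counters_flips using resting_flips[OF t p i j(1)] by (simp add: counters_def)
  next
    case (Dec i)
    with that assms(2) c step obtain j where j: "j < m" "\<forall>x<j. \<not> digit t i x" "digit t i j"
      "c' = (p, flips (Suc j) i t, 0)" and i: "i < K" by auto
    have "counter m t i = Suc (counter m (flips (Suc j) i t) i)"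
      using counter_flips_down j by blast
    then show ?thesis
      unfolding Dec j(4) c counters_flips using resting_flips[OF t p i j(1)] by (simp add: counters_def)
  next
    case (IsZero i)
    with that c exec_zero_test[OF t p] have "\<forall>x<m. \<not> digit t i x" "c' = (p, t, 0)" by auto
    moreover from this(1) have "counter m t i = 0" unfolding counter_def by (intro num_zeros) simp
    ultimately show ?thesis using assms(1) IsZero c by (simp add: counters_def)
  next
    case (Go d)
    with that c have "c' = (min (Suc (length w)) (move d p), t, 0)" by (auto simp: act_rel_action)
    then show ?thesis using t Go c by (auto simp: resting_def counters_def)
  next
    case (Read b)
    with that c p have "c' = (p, t, 0)" "input_cell w p = b" by (auto simp: act_rel_action min_def)
    then show ?thesis using assms(1) Read c by (simp add: counters_def)
  qed
  show "\<exists>c'. (c, c') \<in> exec (act_rel w) (impl_atom K a) \<and> resting K m w c' \<and> counters m c' = s"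
    if s: "(counters m c, s) \<in> crel w (2 ^ m) a"
  proof (cases a)
    case (Inc i)
    with s c have *: "Suc (counter m t i) < 2 ^ m"
      "s = ((\<lambda>i. counter m t i)(i := Suc (counter m t i)), p)" by (auto simp: counters_def)
    have i: "i < K" using Inc assms(2) by simp
    from *(1) obtain j where j: "j < m" "\<And>x. x < j \<Longrightarrow> digit t i x = True" "digit t i j \<noteq> True"
      using num_first[of m "digit t i" True] unfolding counter_def by blast
    moreover have "counter m (flips (Suc j) i t) i = Suc (counter m t i)"
      using counter_flips_up j by blast
    ultimately show ?thesis
      unfolding Inc c using step[OF i, of "(p, flips (Suc j) i t, 0)" True] resting_flips[OF t p i j(1)] *(2)
      by (intro exI[of _ "(p, flips (Suc j) i t, 0)"]) (auto simp: counters_flips)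
  next
    case (Dec i)
    with s c have *: "counter m t i \<noteq> 0"
      "s = ((\<lambda>i. counter m t i)(i := counter m t i - 1), p)" by (auto simp: counters_def)
    have i: "i < K" using Dec assms(2) by simp
    from *(1) obtain j where j: "j < m" "\<And>x. x < j \<Longrightarrow> digit t i x = False" "digit t i j \<noteq> False"
      using num_first[of m "digit t i" False] unfolding counter_def by blast
    moreover have "counter m t i = Suc (counter m (flips (Suc j) i t) i)"
      using counter_flips_down j by blast
    ultimately show ?thesis
      unfolding Dec c using step[OF i, of "(p, flips (Suc j) i t, 0)" False] resting_flips[OF t p i j(1)] *(2)
      by (intro exI[of _ "(p, flips (Suc j) i t, 0)"]) (auto simp: counters_flips)
  next
    case (IsZero i)
    with s c have *: "counter m t i = 0" "s = counters m c" by (auto simp: counters_def)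
    have "\<not> digit t i x" if "x < m" for x
      using *(1) that unfolding counter_def num_def by simp
    then show ?thesis unfolding IsZero c using exec_zero_test[OF t p, of "(p, t, 0)" i] assms(1) *(2) c
      by (intro exI[of _ "(p, t, 0)"]) simp
  next
    case (Go d)
    with s c have "s = (\<lambda>i. counter m t i, min (Suc (length w)) (move d p))"
      by (auto simp: counters_def)
    then show ?thesis unfolding Go c using less t
      by (intro exI[of _ "(min (Suc (length w)) (move d p), t, 0)"])
        (auto simp: act_rel_action resting_def counters_def)
  next
    case (Read b)
    with s c have "s = counters m c" "input_cell w p = b" by (auto simp: counters_def)
    then show ?thesis unfolding Read c using less t p assms(1) c
      by (intro exI[of _ "(p, t, 0)"]) (auto simp: act_rel_action min_def)
  qed
qed

lemma impl_sound:
  assumes "\<forall>a \<in> set_prog P. counters_below K a" "resting K m w c"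
    and "(c, c') \<in> exec (act_rel w) (impl K P)"
  shows "resting K m w c' \<and> (counters m c, counters m c') \<in> exec (crel w (2 ^ m)) P"
  using assms
proof (induction P arbitrary: c c')
  case (Atom a)
  have "(c, c') \<in> exec (act_rel w) (impl_atom K a)" using Atom.prems(3) by simp
  from impl_atom_sound[OF Atom.prems(2) _ this] Atom.prems(1) show ?case by simp
next
  case (Seq P Q)
  from Seq.prems(3) obtain d where d: "(c, d) \<in> exec (act_rel w) (impl K P)"
    "(d, c') \<in> exec (act_rel w) (impl K Q)" by auto
  have "resting K m w d \<and> (counters m c, counters m d) \<in> exec (crel w (2 ^ m)) P"
    by (rule Seq.IH(1)[OF _ Seq.prems(2) d(1)]) (use Seq.prems(1) in simp)
  moreover from this have
    "resting K m w c' \<and> (counters m d, counters m c') \<in> exec (crel w (2 ^ m)) Q"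
    by (intro Seq.IH(2)[OF _ _ d(2)]) (use Seq.prems(1) in simp_all)
  ultimately show ?case by (simp only: exec.simps) blast
next
  case (Choice P Q)
  from Choice.prems(3) consider "(c, c') \<in> exec (act_rel w) (impl K P)"
    | "(c, c') \<in> exec (act_rel w) (impl K Q)" by auto
  then show ?case
  proof cases
    case 1
    with Choice.IH(1)[OF _ Choice.prems(2) 1] Choice.prems(1) show ?thesis by simp
  next
    case 2
    with Choice.IH(2)[OF _ Choice.prems(2) 2] Choice.prems(1) show ?thesis by simp
  qed
next
  case (Star P)
  from Star.prems(3) have "(c, c') \<in> (exec (act_rel w) (impl K P))\<^sup>*" by simp
  then show ?case
  proof (induction rule: rtrancl_induct)
    case base
    then show ?case using Star.prems(2) by simp
  next
    case (step y z)
    have "resting K m w z \<and> (counters m y, counters m z) \<in> exec (crel w (2 ^ m)) P"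
      by (rule Star.IH[OF _ conjunct1[OF step.IH] step(2)]) (use Star.prems(1) in simp)
    with step.IH show ?case by (simp only: exec.simps) (blast intro: rtrancl_into_rtrancl)
  qed
qed

lemma impl_complete:
  assumes "\<forall>a \<in> set_prog P. counters_below K a" "resting K m w c"
    and "(counters m c, s) \<in> exec (crel w (2 ^ m)) P"
  shows "\<exists>c'. (c, c') \<in> exec (act_rel w) (impl K P) \<and> resting K m w c' \<and> counters m c' = s"
  using assms
proof (induction P arbitrary: c s)
  case (Atom a)
  then have "(counters m c, s) \<in> crel w (2 ^ m) a" "counters_below K a" by simp_all
  from impl_atom_complete[OF Atom.prems(2) this(2,1)] show ?case by simp
next
  case (Seq P Q)
  from Seq.prems(3) obtain s1 where s1: "(counters m c, s1) \<in> exec (crel w (2 ^ m)) P"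
    "(s1, s) \<in> exec (crel w (2 ^ m)) Q" by auto
  have "\<forall>a \<in> set_prog P. counters_below K a" "\<forall>a \<in> set_prog Q. counters_below K a"
    using Seq.prems(1) by simp_all
  with Seq.IH(1)[OF _ Seq.prems(2) s1(1)] obtain d where d: "(c, d) \<in> exec (act_rel w) (impl K P)"
    "resting K m w d" "counters m d = s1" by blast
  with Seq.IH(2)[OF _ d(2), of s] s1(2) \<open>\<forall>a \<in> set_prog Q. _\<close> obtain c'
    where "(d, c') \<in> exec (act_rel w) (impl K Q)" "resting K m w c'" "counters m c' = s" by blast
  with d(1) show ?case by (simp only: impl.simps exec.simps) blast
next
  case (Choice P Q)
  from Choice.prems(3) consider "(counters m c, s) \<in> exec (crel w (2 ^ m)) P"
    | "(counters m c, s) \<in> exec (crel w (2 ^ m)) Q" by auto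
  then show ?case
  proof cases
    case 1
    with Choice.IH(1)[OF _ Choice.prems(2) 1] Choice.prems(1) show ?thesis
      by (simp only: impl.simps exec.simps prog.set) blast
  next
    case 2
    with Choice.IH(2)[OF _ Choice.prems(2) 2] Choice.prems(1) show ?thesis
      by (simp only: impl.simps exec.simps prog.set) blast
  qed
next
  case (Star P)
  have P: "\<forall>a \<in> set_prog P. counters_below K a" using Star.prems(1) by simp
  from Star.prems(3) have "(counters m c, s) \<in> (exec (crel w (2 ^ m)) P)\<^sup>*" by simp
  then have "\<exists>c'. (c, c') \<in> (exec (act_rel w) (impl K P))\<^sup>* \<and> resting K m w c' \<and> counters m c' = s"
  proof (induction rule: rtrancl_induct)
    case base
    then show ?case using Star.prems(2) by blast
  next
    case (step y z)
    then obtain d where d: "(c, d) \<in> (exec (act_rel w) (impl K P))\<^sup>*" "resting K m w d"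
      "counters m d = y" by blast
    with Star.IH[OF P d(2), of z] step(2) obtain c' where
      "(d, c') \<in> exec (act_rel w) (impl K P)" "resting K m w c'" "counters m c' = z" by blast
    with d(1) show ?case by (blast intro: rtrancl_into_rtrancl)
  qed
  then show ?case by simp
qed

lemma impl_proper:
  "\<forall>A \<in> set_prog (impl K P). proper_action {..<2 + 2 ^ K} (A :: 'a::finite action)"
proof (induction P)
  case (Atom a)
  show ?case
    by (cases a) (simp_all add: proper_action_action count_step_def go_def carry_def turn_def
      rewind_def zero_test_def del: add_2_eq_Suc add_2_eq_Suc')
qed auto

text \<open>The first blank to the right of the counters is never overwritten and never crossed.\<close>

definition stops_at_blank :: "'a action \<Rightarrow> bool" where
  "stops_at_blank A \<longleftrightarrow> (\<forall>(a, g, d, g', e) \<in> A. g = 0 \<longrightarrow> g' = 0 \<and> e \<noteq> MoveR)"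

lemma impl_stops: "\<forall>A \<in> set_prog (impl K P). stops_at_blank A"
proof (induction P)
  case (Atom a)
  show ?case
    by (cases a) (auto simp: stops_at_blank_def action_def count_step_def go_def carry_def turn_def
      rewind_def zero_test_def)
qed auto

text \<open>The blank in cell \<open>Suc m\<close> is a wall: a head standing on it can neither
  overwrite it nor move right. This holds for each single action whatever the counters contain, so
  runs that get stuck are covered too.\<close>

lemma impl_safe:
  assumes "X \<subseteq> {(p, t, h). t (Suc m) = 0 \<and> h \<le> Suc m}" "{(p, t, h). h \<le> Suc m} \<subseteq> S"
  shows "safe w S (impl K P) X"
proof (rule safe_invariant[OF _ assms(1)])
  show "act_rel w A `` {(p, t, h). t (Suc m) = 0 \<and> h \<le> Suc m} \<subseteq>
      {(p, t, h). t (Suc m) = 0 \<and> h \<le> Suc m}" if "A \<in> set_prog (impl K P)" for A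
  proof -
    have stop: "g' = 0 \<and> e \<noteq> MoveR" if "(a, 0, d, g', e) \<in> A" for a d g' e
      using impl_stops[of K P] \<open>A \<in> _\<close> that by (fastforce simp: stops_at_blank_def)
    have "(if h = Suc m then g' else t (Suc m)) = 0 \<and> move e h \<le> Suc m"
      if "(input_cell w p, t h, d, g', e) \<in> A" "t (Suc m) = 0" "h \<le> Suc m" for p t h d g' e
      using that stop[of _ d g' e] by (cases "h = Suc m"; cases e) auto
    then show ?thesis unfolding act_rel_def by fastforce
  qed
qed (use assms(2) in blast)

text \<open>The number \<open>m\<close> of digits is obtained separately for each possible outcome
  of \<open>allot\<close>, so safety of the main program is established for one starting point at a
  time.\<close>

lemma safe_pointwise:
  "(\<And>c. c \<in> X \<Longrightarrow> safe w S P {c}) \<Longrightarrow> safe w S P X"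
proof (induction P arbitrary: X)
  case (Seq P Q)
  have 1: "safe w S P {c}" "exec (act_rel w) P `` {c} \<subseteq> S" "safe w S Q (exec (act_rel w) P `` {c})"
    if "c \<in> X" for c
    using Seq.prems[OF that] by simp_all
  have "safe w S Q (exec (act_rel w) P `` X)"
  proof (rule Seq.IH(2))
    fix d assume "d \<in> exec (act_rel w) P `` X"
    then obtain c where c: "c \<in> X" "{d} \<subseteq> exec (act_rel w) P `` {c}" by blast
    show "safe w S Q {d}" by (rule safe_antimono[OF 1(3)[OF c(1)] c(2)])
  qed
  moreover have "safe w S P X" using 1(1) by (rule Seq.IH(1))
  moreover have "exec (act_rel w) P `` X \<subseteq> S" using 1(2) by blast
  ultimately show ?case by simp
next
  case (Choice P Q)
  then show ?case by simp
next
  case (Star P)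
  have 1: "(exec (act_rel w) P)\<^sup>* `` {c} \<subseteq> S" "safe w S P ((exec (act_rel w) P)\<^sup>* `` {c})"
    if "c \<in> X" for c
    using Star.prems[OF that] by simp_all
  have "safe w S P ((exec (act_rel w) P)\<^sup>* `` X)"
  proof (rule Star.IH)
    fix d assume "d \<in> (exec (act_rel w) P)\<^sup>* `` X"
    then obtain c where c: "c \<in> X" "{d} \<subseteq> (exec (act_rel w) P)\<^sup>* `` {c}" by blast
    show "safe w S P {d}" by (rule safe_antimono[OF 1(2)[OF c(1)] c(2)])
  qed
  moreover have "(exec (act_rel w) P)\<^sup>* `` X \<subseteq> S" using 1(1) by blast
  ultimately show ?case by simp
qed simp

text \<open>Counting the cells of the input in counter 0 allots the number of work cells that the main
  program uses.\<close>

definition grow :: "nat \<Rightarrow> 'a action prog" where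
  "grow K = Atom (action K (\<lambda>a g. g = 0 \<or> 2 \<le> g \<and> \<not> bit (g - 2) 0) Stay
     (\<lambda>g. if g = 0 then 3 else flip 0 g) MoveL)"

text \<open>Moving on from every cell but the right end makes exactly \<open>length w + 1\<close>
  ticks, the left end included, and this is the final value of counter 0.\<close>

definition advance :: "nat \<Rightarrow> 'a action prog" where
  "advance K = Atom (action K (\<lambda>a g. a \<noteq> RightEnd \<and> g = 1) MoveR (\<lambda>g. g) MoveR)"

definition tick :: "nat \<Rightarrow> 'a action prog" where
  "tick K = Seq (advance K) (Seq (carry K True 0) (Seq (grow K) (rewind K)))"

definition allot :: "nat \<Rightarrow> 'a action prog" where
  "allot K = Seq (Atom (action K (\<lambda>a g. g = 0) Stay (\<lambda>g. 1) Stay))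
     (Seq (Star (tick K)) (Atom (action K (\<lambda>a g. a = RightEnd) Stay (\<lambda>g. g) Stay)))"

definition marked_data :: data where
  "marked_data = (0, (\<lambda>_. 0)(0 := 1), 0)"

text \<open>The last conjunct is the one that bounds the space: \<open>m\<close> digits are present
  only if the count has needed that many.\<close>

definition allotted :: "nat \<Rightarrow> 'a list \<Rightarrow> nat \<Rightarrow> data \<Rightarrow> bool" where
  "allotted K w m c \<longleftrightarrow> (\<exists>p t. c = (p, t, 0) \<and> tape K m t \<and> counter m t 0 = p \<and>
     p \<le> Suc (length w) \<and> (0 < m \<longrightarrow> 2 ^ (m - 1) \<le> p))"

text \<open>A carry that passes all digits writes 3 into a new cell. As \<open>3 = 2 + 1\<close>,
  the new digit is 1 for counter 0 and 0 for all other counters.\<close>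

definition grown :: "nat \<Rightarrow> nat \<Rightarrow> (nat \<Rightarrow> nat) \<Rightarrow> nat \<Rightarrow> nat" where
  "grown m j t = (if j < m then flips (Suc j) 0 t else (flips m 0 t)(Suc m := 3))"

lemma input_cell_RightEnd: "input_cell w p = RightEnd \<longleftrightarrow> length w < p"
  by (simp add: input_cell_def)

lemma tape_grown:
  "tape K m t \<Longrightarrow> 0 < K \<Longrightarrow> j \<le> m \<Longrightarrow> tape K (if j < m then m else Suc m) (grown m j t)"
proof (cases "j < m")
  case False
  assume "tape K m t" "0 < K"
  then have "tape K m (flips m 0 t)" by (intro tape_flips) simp_all
  moreover have "(3 :: nat) < 2 + 2 ^ K"
    using \<open>0 < K\<close> one_less_power[of "2 :: nat" K] by simp
  ultimately show ?thesis using False by (auto simp: grown_def tape_def less_Suc_eq)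
qed (simp add: grown_def tape_flips)

lemma counter_grown:
  assumes "j \<le> m" "\<And>x. x < j \<Longrightarrow> digit t 0 x" "j < m \<Longrightarrow> \<not> digit t 0 j"
  shows "counter (if j < m then m else Suc m) (grown m j t) 0 = Suc (counter m t 0)"
proof (cases "j < m")
  case True
  then show ?thesis using assms counter_flips_up[of j m t 0] by (simp add: grown_def)
next
  case False
  have "num m (digit (grown m j t) 0) = 0"
    using False assms by (intro num_zeros) (auto simp: grown_def digit_flips)
  moreover have "Suc (num m (digit t 0)) = 2 ^ m"
    using False assms by (intro num_ones) auto
  moreover have "digit (grown m j t) 0 m" using False by (simp add: grown_def bit_0)
  ultimately show ?thesis using False by (simp add: counter_def)
qed

lemma exec_advance:
  assumes "tape K m t"
  shows "((p, t, 0), c') \<in> exec (act_rel w) (advance K) \<longleftrightarrow> p \<le> length w \<and> c' = (Suc p, t, 1)"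
  using assms tape_less[OF assms]
  by (auto simp: advance_def act_rel_action tape_0 input_cell_RightEnd min_def)

lemma exec_grow:
  assumes "tape K m t" "p \<le> Suc (length w)" "0 < K" "j \<le> m"
  shows "((p, flips j 0 t, Suc j), c') \<in> exec (act_rel w) (grow K) \<longleftrightarrow>
    (j < m \<longrightarrow> \<not> digit t 0 j) \<and> c' = (p, grown m j t, j)"
proof -
  have 3: "(3 :: nat) < 2 + 2 ^ K"
    using \<open>0 < K\<close> one_less_power[of "2 :: nat" K] by simp
  show ?thesis
  proof (cases "j < m")
    case True
    then have "t (Suc j) \<noteq> 0" "2 \<le> t (Suc j)" using tape_Suc[OF assms(1)] by auto
    then show ?thesis using True assms tape_less[OF assms(1)]
      by (auto simp: grow_def act_rel_action flips_Suc flip_less min_def grown_def)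
  next
    case False
    then have "t (Suc j) = 0" "j = m" using tape_Suc[OF assms(1)] assms(4) by auto
    then show ?thesis using False assms 3
      by (auto simp: grow_def act_rel_action min_def grown_def)
  qed
qed

lemma exec_tick:
  assumes "tape K m t" "p \<le> Suc (length w)" "0 < K"
  shows "((p, t, 0), c') \<in> exec (act_rel w) (tick K) \<longleftrightarrow>
    p \<le> length w \<and> (\<exists>j\<le>m. (\<forall>x<j. digit t 0 x) \<and> (j < m \<longrightarrow> \<not> digit t 0 j) \<and>
      c' = (Suc p, grown m j t, 0))"
    (is "?L \<longleftrightarrow> ?R")
proof
  assume ?L
  then obtain c1 c2 c3 where c: "((p, t, 0), c1) \<in> exec (act_rel w) (advance K)"
    "(c1, c2) \<in> exec (act_rel w) (carry K True 0)" "(c2, c3) \<in> exec (act_rel w) (grow K)"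
    "(c3, c') \<in> exec (act_rel w) (rewind K)"
    unfolding tick_def exec.simps by blast
  from c(1) have p: "p \<le> length w" "Suc p \<le> Suc (length w)" and "c1 = (Suc p, t, 1)"
    unfolding exec_advance[OF assms(1)] by simp_all
  with c(2) obtain j where j: "j \<le> m" "\<forall>x<j. digit t 0 x = True" "c2 = (Suc p, flips j 0 t, Suc j)"
    using exec_carry[OF assms(1) p(2) assms(3)] by blast
  with c(3) have j': "j < m \<longrightarrow> \<not> digit t 0 j" "c3 = (Suc p, grown m j t, j)"
    using exec_grow[OF assms(1) p(2) assms(3) j(1)] by blast+
  with c(4) have "c' = (Suc p, grown m j t, 0)"
    using exec_rewind[OF tape_grown[OF assms(1,3) j(1)] p(2), of j] j(1) by auto
  with j j' p show ?R by auto
next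
  assume ?R
  then obtain j where p: "p \<le> length w" and j: "j \<le> m" "\<forall>x<j. digit t 0 x"
    "j < m \<longrightarrow> \<not> digit t 0 j" "c' = (Suc p, grown m j t, 0)" by blast
  then have p': "Suc p \<le> Suc (length w)" by simp
  have "((p, t, 0), (Suc p, t, 1)) \<in> exec (act_rel w) (advance K)"
    using exec_advance[OF assms(1)] p by blast
  moreover have "((Suc p, t, 1), (Suc p, flips j 0 t, Suc j)) \<in> exec (act_rel w) (carry K True 0)"
    using exec_carry[OF assms(1) p' assms(3)] j by auto
  moreover have "((Suc p, flips j 0 t, Suc j), (Suc p, grown m j t, j)) \<in> exec (act_rel w) (grow K)"
    using exec_grow[OF assms(1) p' assms(3)] j by blast
  moreover have "((Suc p, grown m j t, j), c') \<in> exec (act_rel w) (rewind K)"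
    using exec_rewind[OF tape_grown[OF assms(1,3) j(1)] p', of j] j by auto
  ultimately show ?L unfolding tick_def exec.simps by blast
qed

lemma tick_allotted:
  assumes "allotted K w m c" "0 < K" "(c, c') \<in> exec (act_rel w) (tick K)"
  shows "\<exists>m'. allotted K w m' c'"
proof -
  from assms(1) obtain p t where c: "c = (p, t, 0)" and t: "tape K m t" and p: "counter m t 0 = p"
    "p \<le> Suc (length w)" "0 < m \<longrightarrow> 2 ^ (m - 1) \<le> p" unfolding allotted_def by blast
  from assms(3) obtain j where j: "p \<le> length w" "j \<le> m" "\<forall>x<j. digit t 0 x"
    "j < m \<longrightarrow> \<not> digit t 0 j" "c' = (Suc p, grown m j t, 0)"
    unfolding c exec_tick[OF t p(2) assms(2)] by blast
  \<comment> \<open>A cell is added only when all \<open>m\<close> digits are ones, hence when the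
    new count is \<open>2 ^ m\<close>.\<close>
  have "2 ^ m \<le> Suc p" if "\<not> j < m"
  proof -
    have "Suc (num m (digit t 0)) = 2 ^ m" using that j by (intro num_ones) auto
    then show ?thesis using p(1) by (simp add: counter_def)
  qed
  then have "allotted K w (if j < m then m else Suc m) c'"
    unfolding allotted_def
    using j p tape_grown[OF t assms(2) j(2)] counter_grown[of j m t] by auto
  then show ?thesis by blast
qed

text \<open>Counting never gets stuck: the lowest clear digit stops the carry, and if there is none,
  \<open>j = m\<close> leads to a new cell.\<close>

lemma tick_progress:
  assumes "allotted K w m (p, t, h)" "0 < K" "p \<le> length w"
  shows "\<exists>t'. ((p, t, h), (Suc p, t', 0)) \<in> exec (act_rel w) (tick K)"
proof -
  from assms(1) have h: "h = 0" and t: "tape K m t" and p: "p \<le> Suc (length w)"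
    unfolding allotted_def by auto
  have "\<exists>j\<le>m. (\<forall>x<j. digit t 0 x) \<and> (j < m \<longrightarrow> \<not> digit t 0 j)"
  proof (cases "\<exists>j<m. \<not> digit t 0 j")
    case True
    then obtain j where "j < m \<and> \<not> digit t 0 j" "\<forall>x<j. \<not> (x < m \<and> \<not> digit t 0 x)"
      using exists_least_iff[of "\<lambda>j. j < m \<and> \<not> digit t 0 j"] by blast
    then show ?thesis by (intro exI[of _ j]) auto
  qed auto
  then show ?thesis unfolding h exec_tick[OF t p assms(2)] using assms(3) by blast
qed

lemma exec_mark:
  assumes "0 < K"
  shows "(initial_data, c) \<in> act_rel w (action K (\<lambda>a g. g = 0) Stay (\<lambda>g. 1) Stay) \<longleftrightarrow>
    c = marked_data"
  by (auto simp: initial_data_def marked_data_def act_rel_action)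

lemma allotted_initially: "allotted K w 0 marked_data"
  by (simp add: allotted_def marked_data_def tape_def counter_def)

lemma ticks_allotted:
  assumes "(c, c') \<in> (exec (act_rel w) (tick K))\<^sup>*" "allotted K w m c" "0 < K"
  shows "\<exists>m'. allotted K w m' c'"
  using assms(1)
proof (induction rule: rtrancl_induct)
  case (step y z)
  then show ?case using tick_allotted assms(3) by blast
qed (use assms(2) in blast)

lemma allot_sound:
  assumes "(initial_data, c) \<in> exec (act_rel w) (allot K)" "0 < K"
  shows "\<exists>m. allotted K w m c \<and> fst c = Suc (length w)"
proof -
  from assms(1) obtain b d where
    b: "(initial_data, b) \<in> act_rel w (action K (\<lambda>a g. g = 0) Stay (\<lambda>g. 1) Stay)"
    and "(b, d) \<in> (exec (act_rel w) (tick K))\<^sup>*"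
    and "(d, c) \<in> act_rel w (action K (\<lambda>a g. a = RightEnd) Stay (\<lambda>g. g) Stay)"
    unfolding allot_def exec.simps by blast
  moreover have "b = marked_data" using b unfolding exec_mark[OF assms(2)] .
  ultimately have d: "(marked_data, d) \<in> (exec (act_rel w) (tick K))\<^sup>*"
    "(d, c) \<in> act_rel w (action K (\<lambda>a g. a = RightEnd) Stay (\<lambda>g. g) Stay)"
    by simp_all
  from ticks_allotted[OF d(1) allotted_initially assms(2)] obtain m where m: "allotted K w m d" by blast
  then obtain p t where "d = (p, t, 0)" "p \<le> Suc (length w)" unfolding allotted_def by blast
  with d(2) have "c = d \<and> fst c = Suc (length w)"
    by (auto simp: act_rel_action input_cell_RightEnd min_def)
  with m show ?thesis by blast
qed

lemma allot_complete:
  assumes "0 < K"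
  shows "\<exists>c. (initial_data, c) \<in> exec (act_rel w) (allot K)"
proof -
  have "\<exists>t. (marked_data, (p, t, 0)) \<in> (exec (act_rel w) (tick K))\<^sup>*" if "p \<le> Suc (length w)" for p
    using that
  proof (induction p)
    case (Suc p)
    then obtain t where t: "(marked_data, (p, t, 0)) \<in> (exec (act_rel w) (tick K))\<^sup>*" by auto
    from ticks_allotted[OF t allotted_initially assms] obtain m where "allotted K w m (p, t, 0)" by blast
    from tick_progress[OF this assms] Suc.prems t show ?case by (auto intro: rtrancl_into_rtrancl)
  qed (auto simp: marked_data_def)
  then obtain t where t: "(marked_data, (Suc (length w), t, 0)) \<in> (exec (act_rel w) (tick K))\<^sup>*" by blast
  from ticks_allotted[OF t allotted_initially assms] obtain m
    where "tape K m t" unfolding allotted_def by blast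
  then have "((Suc (length w), t, 0), (Suc (length w), t, 0)) \<in>
      act_rel w (action K (\<lambda>a g. a = RightEnd) Stay (\<lambda>g. g) Stay)"
    using tape_less by (auto simp: act_rel_action input_cell_RightEnd)
  moreover have "(initial_data, marked_data) \<in>
      act_rel w (action K (\<lambda>a g. g = 0) Stay (\<lambda>g. 1) Stay)"
    unfolding exec_mark[OF assms] ..
  ultimately show ?thesis using t unfolding allot_def exec.simps by blast
qed

section \<open>The logarithmic bound for the allotted cells\<close>

definition work_cells :: "nat \<Rightarrow> nat" where
  "work_cells n = nat \<lfloor>log 2 (real (Suc n))\<rfloor> + 1"

text \<open>\<open>work_cells n\<close> is the binary length of \<open>n + 1\<close>, the final
  count.\<close>

lemma allotted_le: "allotted K w m c \<Longrightarrow> m \<le> work_cells (length w)"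
proof (cases "m = 0")
  case False
  assume "allotted K w m c"
  then have "2 ^ (m - 1) \<le> Suc (length w)" using False unfolding allotted_def by auto
  then have "2 powr real (m - 1) \<le> real (Suc (length w))"
    unfolding powr_realpow[OF zero_less_numeral] by (metis of_nat_le_iff of_nat_numeral of_nat_power)
  then have "real (m - 1) \<le> log 2 (real (Suc (length w)))"
    by (subst le_log_iff) simp_all
  then have "int (m - 1) \<le> \<lfloor>log 2 (real (Suc (length w)))\<rfloor>" by (simp add: le_floor_iff)
  then show ?thesis using False unfolding work_cells_def by linarith
qed simp

text \<open>The summand 2 accounts for the marker and for the blank behind the digits. For
  \<open>n \<ge> 2\<close>, \<open>n + 1 \<le> n * n\<close> yields \<open>2 * ln n / ln 2\<close>
  for the logarithm, and the remaining constant 3 is at most \<open>3 * ln n / ln 2\<close>; hence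
  the factor 5.\<close>

lemma work_cells_bigo: "(\<lambda>n. real (work_cells n + 2)) \<in> O(\<lambda>n. ln (real n))"
proof (rule bigoI)
  show "\<forall>\<^sub>F n in sequentially. norm (real (work_cells n + 2)) \<le> (5 / ln 2) * norm (ln (real n))"
    using eventually_ge_at_top[of 2]
  proof eventually_elim
    case (elim n)
    have "real (nat \<lfloor>log 2 (real (Suc n))\<rfloor>) \<le> log 2 (real (Suc n))"
      by (subst of_nat_nat) simp_all
    also have "\<dots> \<le> log 2 (real n * real n)"
    proof (subst log_le_cancel_iff)
      have "Suc n \<le> n * n" using elim mult_le_mono1[OF elim, of n] by linarith
      then show "real (Suc n) \<le> real n * real n" by (metis of_nat_le_iff of_nat_mult)
    qed (use elim in auto)
    also have "\<dots> = 2 * ln (real n) / ln 2" using elim by (simp add: log_def ln_mult)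
    finally have "real (work_cells n + 2) \<le> 2 * ln (real n) / ln 2 + 3"
      by (simp add: work_cells_def)
    also have "\<dots> \<le> 5 * ln (real n) / ln 2"
    proof -
      have "ln 2 \<le> ln (real n)" using elim by simp
      then have "3 \<le> 3 * ln (real n) / ln 2" by (simp add: field_simps)
      then show ?thesis by (simp add: field_simps)
    qed
    finally show ?case using elim by simp
  qed
qed

lemma rewind_safe:
  assumes "X \<subseteq> {(p, t, h). h < s}"
  shows "safe w {(p, t, h). h < s} (rewind K) X"
proof (rule safe_invariant[OF _ assms order_refl])
  show "act_rel w A `` {(p, t, h). h < s} \<subseteq> {(p, t, h). h < s}"
    if "A \<in> set_prog (rewind K)" for A
    using that by (auto simp: rewind_def act_rel_action)
qed

text \<open>Abandoned runs count as well, such as a carry that stops too early. So the sets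
  \<open>Y\<close>, \<open>Z\<close> and \<open>V\<close> of all intermediate results are followed,
  not only those that lead to a complete tick.\<close>

lemma tick_safe:
  assumes "0 < K" "\<And>c. c \<in> X \<Longrightarrow> \<exists>m. allotted K w m c"
  shows "safe w {(p, t, h). h < work_cells (length w) + 2} (tick K) X"
proof -
  let ?S = "{(p, t, h). h < work_cells (length w) + 2} :: data set"
  define Y where "Y = exec (act_rel w) (advance K) `` X"
  have Y: "\<exists>p t m. c = (p, t, 1) \<and> tape K m t \<and> p \<le> Suc (length w) \<and> m \<le> work_cells (length w)"
    if "c \<in> Y" for c
  proof -
    from that obtain b where b: "b \<in> X" "(b, c) \<in> exec (act_rel w) (advance K)"
      unfolding Y_def by blast
    from assms(2)[OF b(1)] obtain m where m: "allotted K w m b" by blast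
    then obtain p t where "b = (p, t, 0)" "tape K m t" unfolding allotted_def by blast
    with b(2) exec_advance[of K m t p c w] allotted_le[OF m] show ?thesis by auto
  qed
  define Z where "Z = exec (act_rel w) (carry K True 0) `` Y"
  have Z: "\<exists>p t m j. c = (p, flips j 0 t, Suc j) \<and> tape K m t \<and> p \<le> Suc (length w) \<and>
      j \<le> m \<and> m \<le> work_cells (length w)" if "c \<in> Z" for c
  proof -
    from that obtain b where b: "b \<in> Y" "(b, c) \<in> exec (act_rel w) (carry K True 0)"
      unfolding Z_def by blast
    from Y[OF b(1)] obtain p t m where m: "b = (p, t, 1)" "tape K m t" "p \<le> Suc (length w)"
      "m \<le> work_cells (length w)" by blast
    with b(2) exec_carry[OF m(2,3) assms(1), of c True] show ?thesis by blast
  qed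
  define V where "V = exec (act_rel w) (grow K) `` Z"
  have V: "\<exists>p t j. c = (p, t, j) \<and> j \<le> work_cells (length w)" if "c \<in> V" for c
  proof -
    from that obtain b where b: "b \<in> Z" "(b, c) \<in> exec (act_rel w) (grow K)"
      unfolding V_def by blast
    from Z[OF b(1)] obtain p t m j where m: "b = (p, flips j 0 t, Suc j)" "tape K m t"
      "p \<le> Suc (length w)" "j \<le> m" "m \<le> work_cells (length w)" by blast
    with b(2) exec_grow[OF m(2,3) assms(1) m(4), of c] show ?thesis by auto
  qed
  have "Y \<subseteq> ?S" using Y by fastforce
  moreover have "Z \<subseteq> ?S" using Z by fastforce
  moreover have "V \<subseteq> ?S" using V by fastforce
  moreover have "safe w ?S (carry K True 0) Y"
    using \<open>Z \<subseteq> ?S\<close> by (simp add: carry_def Z_def)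
  moreover have "safe w ?S (rewind K) V" using \<open>V \<subseteq> ?S\<close> by (rule rewind_safe)
  ultimately show ?thesis
    unfolding tick_def safe.simps(2) Y_def[symmetric] Z_def[symmetric] V_def[symmetric]
    by (simp add: advance_def grow_def)
qed

lemma allot_safe:
  assumes "0 < K"
  shows "safe w {(p, t, h). h < work_cells (length w) + 2} (allot K) {initial_data}"
proof -
  let ?S = "{(p, t, h). h < work_cells (length w) + 2} :: data set"
  define X where "X = (exec (act_rel w) (tick K))\<^sup>* `` {marked_data}"
  have X: "\<exists>m. allotted K w m c" if "c \<in> X" for c
    using that ticks_allotted[OF _ allotted_initially assms] unfolding X_def by blast
  have "X \<subseteq> ?S" using X by (fastforce simp: allotted_def)
  moreover have "exec (act_rel w) (Atom (action K (\<lambda>a g. g = 0) Stay (\<lambda>g. 1) Stay)) ``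
      {initial_data} = {marked_data}"
    using exec_mark[OF assms] by auto
  moreover have "safe w ?S (tick K) X" by (rule tick_safe[OF assms X])
  moreover have "marked_data \<in> ?S" by (simp add: marked_data_def)
  ultimately show ?thesis
    unfolding allot_def safe.simps exec.simps(4) by (simp add: X_def)
qed

lemma allot_proper:
  assumes "0 < K"
  shows "\<forall>A \<in> set_prog (allot K). proper_action {..<2 + 2 ^ K} (A :: 'a::finite action)"
  by (simp add: allot_def tick_def advance_def carry_def grow_def rewind_def proper_action_action
    del: add_2_eq_Suc add_2_eq_Suc')

lemma counters_bounded_ex: "\<exists>K>0. \<forall>a \<in> set_prog P. counters_below K a"
proof (induction P)
  case (Atom a)
  show ?case by (cases a) (auto intro: exI[of _ "Suc _"])
next
  case (Seq P Q)
  then obtain K K' where "K > 0" "\<forall>a \<in> set_prog P. counters_below K a"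
    "\<forall>a \<in> set_prog Q. counters_below K' a" by blast
  moreover have "counters_below K a \<Longrightarrow> K \<le> K' \<Longrightarrow> counters_below K' a" for K K' and a :: "'a catom"
    by (cases a) auto
  ultimately show ?case by (intro exI[of _ "max K K'"]) auto
next
  case (Choice P Q)
  then obtain K K' where "K > 0" "\<forall>a \<in> set_prog P. counters_below K a"
    "\<forall>a \<in> set_prog Q. counters_below K' a" by blast
  moreover have "counters_below K a \<Longrightarrow> K \<le> K' \<Longrightarrow> counters_below K' a" for K K' and a :: "'a catom"
    by (cases a) auto
  ultimately show ?case by (intro exI[of _ "max K K'"]) auto
qed auto

text \<open>\<open>allot\<close> leaves counter 0 at \<open>length w + 1\<close> and the input head
  at the right end, and of the cap it is known only that it is large enough. Hence the program has
  to answer correctly from every start and under every admissible cap.\<close>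

theorem NL_by_counters:
  fixes P :: "'a::finite catom prog"
  assumes lang: "\<And>w cap \<sigma> p. length w + 2 \<le> cap \<Longrightarrow> (\<And>i. \<sigma> i < cap) \<Longrightarrow> p \<le> Suc (length w) \<Longrightarrow>
    (\<exists>s. ((\<sigma>, p), s) \<in> exec (crel w cap) P) \<longleftrightarrow> w \<in> L"
  shows "L \<in> NL"
proof -
  obtain K where K: "K > 0" "\<forall>a \<in> set_prog P. counters_below K a"
    using counters_bounded_ex by blast
  let ?s = "\<lambda>n. work_cells n + 2"
  have ready: "\<exists>m\<le>work_cells (length w). resting K m w c \<and> c \<in> {(p, t, h). t (Suc m) = 0 \<and> h \<le> Suc m} \<and>
      ((\<exists>s. (counters m c, s) \<in> exec (crel w (2 ^ m)) P) \<longleftrightarrow> w \<in> L)"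
    if c: "(initial_data, c) \<in> exec (act_rel w) (allot K)" for w :: "'a list" and c
  proof -
    obtain m where m: "allotted K w m c" "fst c = Suc (length w)" using allot_sound[OF c K(1)] by blast
    then obtain t where t: "c = (Suc (length w), t, 0)" "tape K m t" "counter m t 0 = Suc (length w)"
      unfolding allotted_def by auto
    \<comment> \<open>Counter 0 holds \<open>length w + 1\<close>, and the value of a counter is
      below \<open>2 ^ m\<close>.\<close>
    have "length w + 2 \<le> 2 ^ m" using counter_less[of m t 0] t(3) by simp
    then have "(\<exists>s. (counters m c, s) \<in> exec (crel w (2 ^ m)) P) \<longleftrightarrow> w \<in> L"
      unfolding t(1) counters_def prod.case by (intro lang) (simp_all add: counter_less)
    moreover have "t (Suc m) = 0" using t(2) by (simp add: tape_Suc)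
    ultimately show ?thesis using t allotted_le[OF m(1)] by (auto simp: resting_def)
  qed
  show ?thesis
  proof (rule NL_by_program[where P = "Seq (allot K) (impl K P)" and s = ?s and \<Gamma> = "{..<2 + 2 ^ K}"])
    show "w \<in> L \<longleftrightarrow> (\<exists>c. (initial_data, c) \<in> exec (act_rel w) (Seq (allot K) (impl K P)))"
      for w :: "'a list"
    proof
      assume "w \<in> L"
      obtain c where c: "(initial_data, c) \<in> exec (act_rel w) (allot K)"
        using allot_complete[OF K(1)] by blast
      from ready[OF c] \<open>w \<in> L\<close> obtain m s where "resting K m w c"
        "(counters m c, s) \<in> exec (crel w (2 ^ m)) P" by blast
      from impl_complete[OF K(2) this] c
      show "\<exists>c. (initial_data, c) \<in> exec (act_rel w) (Seq (allot K) (impl K P))"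
        unfolding exec.simps by blast
    next
      assume "\<exists>c. (initial_data, c) \<in> exec (act_rel w) (Seq (allot K) (impl K P))"
      then obtain c d where c: "(initial_data, c) \<in> exec (act_rel w) (allot K)"
        "(c, d) \<in> exec (act_rel w) (impl K P)" unfolding exec.simps by blast
      from ready[OF c(1)] obtain m where m: "resting K m w c"
        "(\<exists>s. (counters m c, s) \<in> exec (crel w (2 ^ m)) P) \<longleftrightarrow> w \<in> L" by blast
      with impl_sound[OF K(2) m(1) c(2)] show "w \<in> L" by blast
    qed
    show "safe w {(p, t, h). h < ?s (length w)} (Seq (allot K) (impl K P)) {initial_data}"
      for w :: "'a list"
    proof -
      let ?S = "{(p, t, h). h < ?s (length w)} :: data set"
      let ?X = "exec (act_rel w) (allot K) `` {initial_data}"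
      have "?X \<subseteq> ?S" using allot_sound[OF _ K(1), of _ w] by (fastforce simp: allotted_def)
      moreover have "safe w ?S (impl K P) ?X"
      proof (rule safe_pointwise)
        fix c assume "c \<in> ?X"
        with ready obtain m where "m \<le> work_cells (length w)"
          "c \<in> {(p, t, h). t (Suc m) = 0 \<and> h \<le> Suc m}" by blast
        then show "safe w ?S (impl K P) {c}" by (intro impl_safe[where m = m]) auto
      qed
      ultimately show ?thesis using allot_safe[OF K(1)] by simp
    qed
    show "h < ?s (length w)"
      if "(initial_data, (p, t, h)) \<in> exec (act_rel w) (Seq (allot K) (impl K P))"
      for w :: "'a list" and p t h
    proof -
      from that obtain c where c: "(initial_data, c) \<in> exec (act_rel w) (allot K)"
        "(c, (p, t, h)) \<in> exec (act_rel w) (impl K P)" unfolding exec.simps by blast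
      from ready[OF c(1)] obtain m where "resting K m w c" by blast
      from impl_sound[OF K(2) this c(2)] show ?thesis by (auto simp: resting_def)
    qed
  qed (use impl_proper allot_proper[OF K(1)] work_cells_bigo in auto)
qed

section \<open>Decidable properties of positions\<close>

definition agree :: "nat \<Rightarrow> (nat \<Rightarrow> nat) \<Rightarrow> (nat \<Rightarrow> nat) \<Rightarrow> bool" where
  "agree k \<sigma> \<tau> \<longleftrightarrow> (\<forall>i<k. \<sigma> i = \<tau> i)"

lemma agree_refl [simp]: "agree k \<sigma> \<sigma>"
  by (simp add: agree_def)

lemma agree_trans: "agree k \<sigma> \<tau> \<Longrightarrow> agree k \<tau> \<rho> \<Longrightarrow> agree k \<sigma> \<rho>"
  by (simp add: agree_def)

lemma agree_mono: "agree k \<sigma> \<tau> \<Longrightarrow> j \<le> k \<Longrightarrow> agree j \<sigma> \<tau>"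
  by (simp add: agree_def)

lemma agree_upd [simp]: "k \<le> i \<Longrightarrow> agree k (\<sigma>(i := v)) \<tau> \<longleftrightarrow> agree k \<sigma> \<tau>"
    "k \<le> i \<Longrightarrow> agree k \<sigma> (\<tau>(i := v)) \<longleftrightarrow> agree k \<sigma> \<tau>"
  by (auto simp: agree_def)

lemma crel_iff [simp]:
  "((\<sigma>, p), s) \<in> crel w cap (Inc i) \<longleftrightarrow> Suc (\<sigma> i) < cap \<and> s = (\<sigma>(i := Suc (\<sigma> i)), p)"
  "((\<sigma>, p), s) \<in> crel w cap (Dec i) \<longleftrightarrow> 0 < \<sigma> i \<and> s = (\<sigma>(i := \<sigma> i - 1), p)"
  "((\<sigma>, p), s) \<in> crel w cap (IsZero i) \<longleftrightarrow> \<sigma> i = 0 \<and> s = (\<sigma>, p)"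
  "((\<sigma>, p), s) \<in> crel w cap (Go d) \<longleftrightarrow> s = (\<sigma>, min (Suc (length w)) (move d p))"
  "((\<sigma>, p), s) \<in> crel w cap (Read a) \<longleftrightarrow> input_cell w p = a \<and> s = (\<sigma>, p)"
  by auto

lemma crel_comp [simp]:
  "((\<sigma>, p), s) \<in> crel w cap (Inc i) O R \<longleftrightarrow> Suc (\<sigma> i) < cap \<and> ((\<sigma>(i := Suc (\<sigma> i)), p), s) \<in> R"
  "((\<sigma>, p), s) \<in> crel w cap (Dec i) O R \<longleftrightarrow> 0 < \<sigma> i \<and> ((\<sigma>(i := \<sigma> i - 1), p), s) \<in> R"
  "((\<sigma>, p), s) \<in> crel w cap (IsZero i) O R \<longleftrightarrow> \<sigma> i = 0 \<and> ((\<sigma>, p), s) \<in> R"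
  "((\<sigma>, p), s) \<in> crel w cap (Go d) O R \<longleftrightarrow> ((\<sigma>, min (Suc (length w)) (move d p)), s) \<in> R"
  "((\<sigma>, p), s) \<in> crel w cap (Read a) O R \<longleftrightarrow> input_cell w p = a \<and> ((\<sigma>, p), s) \<in> R"
  by (simp_all only: relcomp_unfold mem_Collect_eq prod.case crel_iff) blast+

declare crel.simps [simp del]

fun valid :: "'a list \<Rightarrow> nat \<Rightarrow> cstate \<Rightarrow> bool" where
  "valid w cap (\<sigma>, p) \<longleftrightarrow> length w + 2 \<le> cap \<and> (\<forall>i. \<sigma> i < cap) \<and> p \<le> Suc (length w)"

lemma exec_valid:
  assumes "(s, s') \<in> exec (crel w cap) P" "valid w cap s"
  shows "valid w cap s'"
proof (rule exec_invariant[where S = "valid w cap", OF _ assms])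
  fix a s s' assume "(s, s') \<in> crel w cap a" "valid w cap s"
  then show "valid w cap s'"
    by (cases s; cases a) (auto intro: less_imp_diff_less)
qed

text \<open>The program tests \<open>T\<close>, a property of the counters below \<open>k\<close>, without changing these; the other
  counters are scratch space.\<close>

definition tests :: "nat \<Rightarrow> 'a catom prog \<Rightarrow> ('a list \<Rightarrow> (nat \<Rightarrow> nat) \<Rightarrow> bool) \<Rightarrow> bool" where
  "tests k P T \<longleftrightarrow> (\<forall>w cap \<sigma> p. valid w cap (\<sigma>, p) \<longrightarrow>
     (\<forall>\<tau> q. ((\<sigma>, p), (\<tau>, q)) \<in> exec (crel w cap) P \<longrightarrow> T w \<sigma> \<and> agree k \<sigma> \<tau>) \<and>
     (T w \<sigma> \<longrightarrow> (\<exists>\<tau> q. ((\<sigma>, p), (\<tau>, q)) \<in> exec (crel w cap) P)))"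

text \<open>The first conjunct is what allows tests to be run one after another: a test may ruin all
  counters from \<open>k\<close> on, and the next one must not notice.\<close>

definition ntest :: "nat \<Rightarrow> ('a list \<Rightarrow> (nat \<Rightarrow> nat) \<Rightarrow> bool) \<Rightarrow> bool" where
  "ntest k T \<longleftrightarrow> (\<forall>w \<sigma> \<tau>. agree k \<sigma> \<tau> \<longrightarrow> T w \<sigma> = T w \<tau>) \<and> (\<exists>P. tests k P T)"

lemma testsI:
  assumes "\<And>w cap \<sigma> p \<tau> q. valid w cap (\<sigma>, p) \<Longrightarrow> ((\<sigma>, p), (\<tau>, q)) \<in> exec (crel w cap) P \<Longrightarrow>
      T w \<sigma> \<and> agree k \<sigma> \<tau>"
    and "\<And>w cap \<sigma> p. valid w cap (\<sigma>, p) \<Longrightarrow> T w \<sigma> \<Longrightarrow>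
      \<exists>\<tau> q. ((\<sigma>, p), (\<tau>, q)) \<in> exec (crel w cap) P"
  shows "tests k P T"
  unfolding tests_def using assms by blast

lemma testsD1:
  "tests k P T \<Longrightarrow> valid w cap (\<sigma>, p) \<Longrightarrow> ((\<sigma>, p), (\<tau>, q)) \<in> exec (crel w cap) P \<Longrightarrow>
    T w \<sigma> \<and> agree k \<sigma> \<tau> \<and> valid w cap (\<tau>, q)"
  unfolding tests_def using exec_valid by blast

lemma testsD2:
  assumes "tests k P T" "valid w cap (\<sigma>, p)" "T w \<sigma>"
  obtains \<tau> q where "((\<sigma>, p), (\<tau>, q)) \<in> exec (crel w cap) P" "agree k \<sigma> \<tau>" "valid w cap (\<tau>, q)"
  using assms exec_valid unfolding tests_def by blast

lemma ntest_agree: "ntest k T \<Longrightarrow> agree k \<sigma> \<tau> \<Longrightarrow> T w \<sigma> \<longleftrightarrow> T w \<tau>"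
  unfolding ntest_def by blast

lemma ntest_cong: "ntest k T \<Longrightarrow> (\<And>w \<sigma>. T w \<sigma> = T' w \<sigma>) \<Longrightarrow> ntest k T'"
proof -
  assume "\<And>w \<sigma>. T w \<sigma> = T' w \<sigma>"
  then have "T = T'" by blast
  then show "ntest k T \<Longrightarrow> ntest k T'" by simp
qed

section \<open>Conjunction, disjunction and guessed values\<close>

lemma ntest_conj:
  assumes "ntest k T" "ntest k U"
  shows "ntest k (\<lambda>w \<sigma>. T w \<sigma> \<and> U w \<sigma>)"
proof -
  obtain P Q where P: "tests k P T" and Q: "tests k Q U"
    using assms unfolding ntest_def by blast
  have "tests k (Seq P Q) (\<lambda>w \<sigma>. T w \<sigma> \<and> U w \<sigma>)"
  proof (rule testsI)
    fix w :: "'a list" and cap \<sigma> p \<tau> q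
    assume v: "valid w cap (\<sigma>, p)" and "((\<sigma>, p), (\<tau>, q)) \<in> exec (crel w cap) (Seq P Q)"
    then obtain \<rho> r where 1: "((\<sigma>, p), (\<rho>, r)) \<in> exec (crel w cap) P"
      and 2: "((\<rho>, r), (\<tau>, q)) \<in> exec (crel w cap) Q" by auto
    from testsD1[OF P v 1] have \<rho>: "T w \<sigma>" "agree k \<sigma> \<rho>" "valid w cap (\<rho>, r)" by auto
    from testsD1[OF Q \<rho>(3) 2] have "U w \<rho>" "agree k \<rho> \<tau>" by auto
    then show "(T w \<sigma> \<and> U w \<sigma>) \<and> agree k \<sigma> \<tau>"
      using \<rho> ntest_agree[OF assms(2) \<rho>(2)] agree_trans by blast
  next
    fix w :: "'a list" and cap \<sigma> p
    assume v: "valid w cap (\<sigma>, p)" and "T w \<sigma> \<and> U w \<sigma>"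
    then obtain \<rho> r where 1: "((\<sigma>, p), (\<rho>, r)) \<in> exec (crel w cap) P" "agree k \<sigma> \<rho>"
      "valid w cap (\<rho>, r)" using testsD2[OF P v] by blast
    moreover have "U w \<rho>" using ntest_agree[OF assms(2) 1(2)] \<open>T w \<sigma> \<and> U w \<sigma>\<close> by blast
    ultimately obtain \<tau> q where "((\<rho>, r), (\<tau>, q)) \<in> exec (crel w cap) Q"
      using testsD2[OF Q 1(3)] by blast
    with 1(1) show "\<exists>\<tau> q. ((\<sigma>, p), (\<tau>, q)) \<in> exec (crel w cap) (Seq P Q)"
      unfolding exec.simps by blast
  qed
  then show ?thesis
    unfolding ntest_def using ntest_agree[OF assms(1)] ntest_agree[OF assms(2)] by blast
qed

lemma ntest_disj:
  assumes "ntest k T" "ntest k U"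
  shows "ntest k (\<lambda>w \<sigma>. T w \<sigma> \<or> U w \<sigma>)"
proof -
  obtain P Q where P: "tests k P T" and Q: "tests k Q U"
    using assms unfolding ntest_def by blast
  have "tests k (Choice P Q) (\<lambda>w \<sigma>. T w \<sigma> \<or> U w \<sigma>)"
    using P Q unfolding tests_def exec.simps by blast
  then show ?thesis
    unfolding ntest_def using ntest_agree[OF assms(1)] ntest_agree[OF assms(2)] by blast
qed

definition guess :: "nat \<Rightarrow> 'a catom prog" where
  "guess i = Star (Choice (Atom (Inc i)) (Atom (Dec i)))"

lemma exec_guess:
  assumes "valid w cap (\<sigma>, p)"
  shows "((\<sigma>, p), s) \<in> exec (crel w cap) (guess i) \<longleftrightarrow> (\<exists>v<cap. s = (\<sigma>(i := v), p))"
proof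
  let ?B = "exec (crel w cap) (Choice (Atom (Inc i)) (Atom (Dec i)))"
  assume "((\<sigma>, p), s) \<in> exec (crel w cap) (guess i)"
  then have "((\<sigma>, p), s) \<in> ?B\<^sup>*" by (simp add: guess_def)
  then show "\<exists>v<cap. s = (\<sigma>(i := v), p)"
  proof (induction rule: rtrancl_induct)
    case base
    then show ?case using assms by (intro exI[of _ "\<sigma> i"]) auto
  next
    case (step y z)
    then obtain v where "v < cap" "y = (\<sigma>(i := v), p)" by blast
    with step(2) have "z = (\<sigma>(i := Suc v), p) \<and> Suc v < cap \<or> z = (\<sigma>(i := v - 1), p)" by auto
    with \<open>v < cap\<close> show ?case using less_imp_diff_less by blast
  qed
next
  let ?B = "exec (crel w cap) (Choice (Atom (Inc i)) (Atom (Dec i)))"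
  have down: "((\<sigma>, p), (\<sigma>(i := \<sigma> i - x), p)) \<in> ?B\<^sup>*" if "x \<le> \<sigma> i" for x
    using that
  proof (induction x)
    case (Suc x)
    then have "((\<sigma>(i := \<sigma> i - x), p), (\<sigma>(i := \<sigma> i - Suc x), p)) \<in> ?B" by auto
    with Suc show ?case by (meson Suc_leD rtrancl.rtrancl_into_rtrancl)
  qed simp
  have up: "((\<sigma>(i := 0), p), (\<sigma>(i := v), p)) \<in> ?B\<^sup>*" if "v < cap" for v
    using that
  proof (induction v)
    case (Suc v)
    then have "((\<sigma>(i := v), p), (\<sigma>(i := Suc v), p)) \<in> ?B" by auto
    with Suc show ?case by (meson Suc_lessD rtrancl.rtrancl_into_rtrancl)
  qed simp
  assume "\<exists>v<cap. s = (\<sigma>(i := v), p)"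
  then show "((\<sigma>, p), s) \<in> exec (crel w cap) (guess i)"
    using down[of "\<sigma> i"] up by (auto simp: guess_def intro: rtrancl_trans)
qed

lemma valid_upd: "valid w cap (\<sigma>, p) \<Longrightarrow> v < cap \<Longrightarrow> valid w cap (\<sigma>(i := v), p)"
  by simp

text \<open>The quantified value becomes counter \<open>k\<close>, which the inner test must
  preserve and the outer one may overwrite. By \<open>bound\<close>, a witness fits below every
  admissible cap and so can be guessed.\<close>

lemma ntest_project:
  assumes "ntest (Suc k) (\<lambda>w \<sigma>. Q w \<sigma> (\<sigma> k))"
    and dep: "\<And>w \<sigma> \<tau> v. agree k \<sigma> \<tau> \<Longrightarrow> Q w \<sigma> v = Q w \<tau> v"
    and bound: "\<And>w \<sigma> v. Q w \<sigma> v \<Longrightarrow> v < length w + 2"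
  shows "ntest k (\<lambda>w \<sigma>. \<exists>v. Q w \<sigma> v)"
proof -
  obtain P where P: "tests (Suc k) P (\<lambda>w \<sigma>. Q w \<sigma> (\<sigma> k))"
    using assms unfolding ntest_def by blast
  have "tests k (Seq (guess k) P) (\<lambda>w \<sigma>. \<exists>v. Q w \<sigma> v)"
  proof (rule testsI)
    fix w :: "'a list" and cap \<sigma> p \<tau> q
    assume v: "valid w cap (\<sigma>, p)" and "((\<sigma>, p), (\<tau>, q)) \<in> exec (crel w cap) (Seq (guess k) P)"
    then obtain x where x: "x < cap" "((\<sigma>(k := x), p), (\<tau>, q)) \<in> exec (crel w cap) P"
      using exec_guess[OF v] by auto
    from testsD1[OF P valid_upd[OF v x(1)] x(2)]
    have "Q w (\<sigma>(k := x)) x" "agree (Suc k) (\<sigma>(k := x)) \<tau>" by auto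
    then show "(\<exists>v. Q w \<sigma> v) \<and> agree k \<sigma> \<tau>"
      using dep[of "\<sigma>(k := x)" \<sigma>] agree_mono[of "Suc k" "\<sigma>(k := x)" \<tau> k] by auto
  next
    fix w :: "'a list" and cap \<sigma> p
    assume v: "valid w cap (\<sigma>, p)" and "\<exists>v. Q w \<sigma> v"
    then obtain x where x: "Q w \<sigma> x" by blast
    then have "x < cap" using bound[OF x] v by simp
    moreover have "Q w (\<sigma>(k := x)) x" using dep[of "\<sigma>(k := x)" \<sigma>] x by simp
    ultimately obtain \<tau> q where "((\<sigma>(k := x), p), (\<tau>, q)) \<in> exec (crel w cap) P"
      using testsD2[OF P valid_upd[OF v]] by (metis fun_upd_same)
    then show "\<exists>\<tau> q. ((\<sigma>, p), (\<tau>, q)) \<in> exec (crel w cap) (Seq (guess k) P)"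
      using exec_guess[OF v] \<open>x < cap\<close> unfolding exec.simps by blast
  qed
  then show ?thesis unfolding ntest_def using dep by blast
qed

section \<open>Comparing counters and reading input cells\<close>

definition clear :: "nat \<Rightarrow> 'a catom prog" where
  "clear i = Seq (guess i) (Atom (IsZero i))"

lemma exec_clear:
  assumes "valid w cap (\<sigma>, p)"
  shows "((\<sigma>, p), s) \<in> exec (crel w cap) (clear i) \<longleftrightarrow> s = (\<sigma>(i := 0), p)"
proof -
  have "((\<sigma>, p), s) \<in> exec (crel w cap) (clear i) \<longleftrightarrow>
      (\<exists>v<cap. ((\<sigma>(i := v), p), s) \<in> crel w cap (IsZero i))"
    unfolding clear_def exec.simps relcomp_unfold mem_Collect_eq prod.case exec_guess[OF assms]
    by blast
  then show ?thesis using assms by (auto intro: exI[of _ 0])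
qed

lemma exec_clear_comp:
  assumes "valid w cap (\<sigma>, p)"
  shows "((\<sigma>, p), s) \<in> exec (crel w cap) (clear i) O R \<longleftrightarrow> ((\<sigma>(i := 0), p), s) \<in> R"
  unfolding relcomp_unfold mem_Collect_eq prod.case exec_clear[OF assms] by blast

lemma exec_zip_out:
  fixes i j k :: nat
  defines "\<rho> \<equiv> \<lambda>\<sigma> x. \<sigma>(i := \<sigma> i - x, j := \<sigma> j - x, k := x) :: nat \<Rightarrow> nat"
  assumes "valid w cap (\<sigma>, p)" "i \<noteq> k" "j \<noteq> k" "i \<noteq> j" "\<sigma> k = 0"
  shows "((\<sigma>, p), s) \<in> exec (crel w cap) (Star (Seq (Atom (Dec i)) (Seq (Atom (Dec j)) (Atom (Inc k))))) \<longleftrightarrow>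
    (\<exists>x. x \<le> \<sigma> i \<and> x \<le> \<sigma> j \<and> s = (\<rho> \<sigma> x, p))"
proof -
  let ?B = "exec (crel w cap) (Seq (Atom (Dec i)) (Seq (Atom (Dec j)) (Atom (Inc k))))"
  have 0: "\<rho> \<sigma> 0 = \<sigma>" using assms by (auto simp: \<rho>_def)
  have body: "((\<rho> \<sigma> x, p), s) \<in> ?B \<longleftrightarrow> x < \<sigma> i \<and> x < \<sigma> j \<and> Suc x < cap \<and> s = (\<rho> \<sigma> (Suc x), p)" for x s
  proof -
    have "(\<rho> \<sigma> x)(i := \<sigma> i - x - 1, j := \<sigma> j - x - 1, k := Suc x) = \<rho> \<sigma> (Suc x)"
      using assms(3-5) by (auto simp: \<rho>_def)
    moreover have "\<rho> \<sigma> x i = \<sigma> i - x" "\<rho> \<sigma> x j = \<sigma> j - x" "\<rho> \<sigma> x k = x"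
      using assms(3-5) by (auto simp: \<rho>_def)
    ultimately show ?thesis using assms(3-5) by auto
  qed
  have "\<exists>x. x \<le> \<sigma> i \<and> x \<le> \<sigma> j \<and> s = (\<rho> \<sigma> x, p)" if "((\<sigma>, p), s) \<in> ?B\<^sup>*" for s
    using that
  proof (induction rule: rtrancl_induct)
    case base
    then show ?case using 0 by (intro exI[of _ 0]) simp
  next
    case (step y z)
    then obtain x where "x \<le> \<sigma> i" "x \<le> \<sigma> j" "y = (\<rho> \<sigma> x, p)" by blast
    with step(2) have "x < \<sigma> i" "x < \<sigma> j" "z = (\<rho> \<sigma> (Suc x), p)" using body by blast+
    then show ?case using Suc_leI by blast
  qed
  moreover have "((\<sigma>, p), (\<rho> \<sigma> x, p)) \<in> ?B\<^sup>*" if "x \<le> \<sigma> i" "x \<le> \<sigma> j" for x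
    using that
  proof (induction x)
    case (Suc x)
    have "\<sigma> i < cap" using assms(2) by simp
    then have "((\<rho> \<sigma> x, p), (\<rho> \<sigma> (Suc x), p)) \<in> ?B" using Suc.prems unfolding body by simp
    with Suc show ?case by (meson Suc_leD rtrancl.rtrancl_into_rtrancl)
  qed (simp add: 0)
  ultimately show ?thesis by (simp only: exec.simps(4)) blast
qed

text \<open>The increments cannot fail: \<open>i\<close> and \<open>j\<close> only return towards
  their original values, which were below the cap.\<close>

lemma exec_zip_back:
  fixes i j k :: nat
  defines "\<rho> \<equiv> \<lambda>\<sigma> x. \<sigma>(i := \<sigma> i - x, j := \<sigma> j - x, k := x) :: nat \<Rightarrow> nat"
  assumes "valid w cap (\<sigma>, p)" "i \<noteq> k" "j \<noteq> k" "i \<noteq> j" "x \<le> \<sigma> i" "x \<le> \<sigma> j"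
  shows "((\<rho> \<sigma> x, p), s) \<in> exec (crel w cap) (Star (Seq (Atom (Dec k)) (Seq (Atom (Inc i)) (Atom (Inc j))))) \<longleftrightarrow>
    (\<exists>y\<le>x. s = (\<rho> \<sigma> y, p))"
proof -
  let ?B = "exec (crel w cap) (Seq (Atom (Dec k)) (Seq (Atom (Inc i)) (Atom (Inc j))))"
  have lt: "\<sigma> i < cap" "\<sigma> j < cap" using assms(2) by simp_all
  have body: "((\<rho> \<sigma> y, p), s) \<in> ?B \<longleftrightarrow> 0 < y \<and> s = (\<rho> \<sigma> (y - 1), p)" if "y \<le> x" for y s
  proof -
    have less: "Suc (\<sigma> i - y) < cap" "Suc (\<sigma> j - y) < cap"
      and eq: "\<sigma> i - (y - 1) = Suc (\<sigma> i - y)" "\<sigma> j - (y - 1) = Suc (\<sigma> j - y)" if "0 < y"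
      using \<open>y \<le> x\<close> assms(6,7) lt that by linarith+
    have "(\<rho> \<sigma> y)(k := y - 1, i := Suc (\<sigma> i - y), j := Suc (\<sigma> j - y)) = \<rho> \<sigma> (y - 1)" if "0 < y"
      unfolding \<rho>_def eq[OF that] using assms(3-5) by auto
    moreover have "\<rho> \<sigma> y i = \<sigma> i - y" "\<rho> \<sigma> y j = \<sigma> j - y" "\<rho> \<sigma> y k = y"
      using assms(3-5) by (auto simp: \<rho>_def)
    ultimately show ?thesis using assms(3-5) less by auto
  qed
  have "\<exists>y\<le>x. s = (\<rho> \<sigma> y, p)" if "((\<rho> \<sigma> x, p), s) \<in> ?B\<^sup>*" for s
    using that
  proof (induction rule: rtrancl_induct)
    case base
    then show ?case by blast
  next
    case (step y z)
    then obtain y' where "y' \<le> x" "y = (\<rho> \<sigma> y', p)" by blast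
    with step(2) body[of y' z] have "z = (\<rho> \<sigma> (y' - 1), p)" by simp
    with \<open>y' \<le> x\<close> show ?case using diff_le_self le_trans by blast
  qed
  moreover have "((\<rho> \<sigma> x, p), (\<rho> \<sigma> (x - y), p)) \<in> ?B\<^sup>*" if "y \<le> x" for y
    using that
  proof (induction y)
    case (Suc y)
    have "((\<rho> \<sigma> (x - y), p), (\<rho> \<sigma> (x - Suc y), p)) \<in> ?B" using Suc.prems unfolding body[OF diff_le_self] by simp
    with Suc show ?case by (meson Suc_leD rtrancl.rtrancl_into_rtrancl)
  qed simp
  ultimately show ?thesis
    by (simp only: exec.simps(4)) (metis diff_diff_cancel diff_le_self)
qed

text \<open>Counters \<open>i\<close> and \<open>j\<close> are decreased together while
  \<open>k\<close> remembers the number of rounds, so that both can be restored. Testing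
  \<open>i\<close> for zero enforces exactly \<open>\<sigma> i\<close> rounds, and testing
  \<open>k\<close> at the end enforces a full restoration. In the strict case, \<open>Dec j\<close>
  followed by \<open>Inc j\<close> checks that something is left of \<open>j\<close>;
  \<open>Go Stay\<close> changes nothing.\<close>

definition compare :: "bool \<Rightarrow> nat \<Rightarrow> nat \<Rightarrow> nat \<Rightarrow> 'a catom prog" where
  "compare strict i j k = Seq (clear k)
     (Seq (Star (Seq (Atom (Dec i)) (Seq (Atom (Dec j)) (Atom (Inc k)))))
     (Seq (Atom (IsZero i))
     (Seq (if strict then Seq (Atom (Dec j)) (Atom (Inc j)) else Atom (Go Stay))
     (Seq (Star (Seq (Atom (Dec k)) (Seq (Atom (Inc i)) (Atom (Inc j)))))
     (Atom (IsZero k))))))"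

lemma compare_tests:
  assumes "i < k" "j < k" "i \<noteq> j"
  shows "tests k (compare strict i j k) (\<lambda>w \<sigma>. if strict then \<sigma> i < \<sigma> j else \<sigma> i \<le> \<sigma> j)"
proof -
  define \<rho> where "\<rho> \<sigma> x = \<sigma>(i := \<sigma> i - x, j := \<sigma> j - x, k := x)" for \<sigma> :: "nat \<Rightarrow> nat" and x
  have \<rho>_simps: "\<rho> \<sigma> x i = \<sigma> i - x" "\<rho> \<sigma> x j = \<sigma> j - x" "\<rho> \<sigma> x k = x" for \<sigma> x
    using assms by (simp_all add: \<rho>_def)
  let ?out = "Star (Seq (Atom (Dec i)) (Seq (Atom (Dec j)) (Atom (Inc k)))) :: 'a catom prog"
  let ?back = "Star (Seq (Atom (Dec k)) (Seq (Atom (Inc i)) (Atom (Inc j)))) :: 'a catom prog"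
  let ?mid = "if strict then Seq (Atom (Dec j)) (Atom (Inc j)) else Atom (Go Stay) :: 'a catom prog"
  have out: "((\<sigma>(k := 0), p), s) \<in> exec (crel w cap) ?out \<longleftrightarrow>
      (\<exists>x. x \<le> \<sigma> i \<and> x \<le> \<sigma> j \<and> s = (\<rho> \<sigma> x, p))"
    if "valid w cap (\<sigma>, p)" for w cap \<sigma> p s
    using exec_zip_out[of w cap "\<sigma>(k := 0)" p i k j s] that assms
    by (auto simp: \<rho>_def fun_upd_twist)
  have rest: "((\<rho> \<sigma> x, p), s) \<in> exec (crel w cap) ?back \<longleftrightarrow> (\<exists>y\<le>x. s = (\<rho> \<sigma> y, p))"
    if "valid w cap (\<sigma>, p)" "x \<le> \<sigma> i" "x \<le> \<sigma> j" for w cap \<sigma> p s x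
    using exec_zip_back[of w cap \<sigma> p i k j x s] that assms by (simp add: \<rho>_def)
  have mid: "((\<tau>, p), s) \<in> exec (crel w cap) ?mid \<longleftrightarrow> (strict \<longrightarrow> 0 < \<tau> j) \<and> s = (\<tau>, p)"
    if "valid w cap (\<tau>, p)" for w cap \<tau> p s
  proof -
    have "\<tau> j < cap" using that by simp
    then show ?thesis using that by (cases "\<tau> j") (auto simp: min_def)
  qed
  have iff: "((\<sigma>, p), s) \<in> exec (crel w cap) (compare strict i j k) \<longleftrightarrow>
      (if strict then \<sigma> i < \<sigma> j else \<sigma> i \<le> \<sigma> j) \<and> s = (\<sigma>(k := 0), p)"
    (is "?L \<longleftrightarrow> ?R") if v: "valid w cap (\<sigma>, p)" for w :: "'a list" and cap \<sigma> p s
  proof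
    assume ?L
    then obtain s1 s2 s3 s4 where s:
      "((\<sigma>(k := 0), p), s1) \<in> exec (crel w cap) ?out" "(s1, s2) \<in> crel w cap (IsZero i)"
      "(s2, s3) \<in> exec (crel w cap) ?mid" "(s3, s4) \<in> exec (crel w cap) ?back"
      "(s4, s) \<in> crel w cap (IsZero k)"
      unfolding compare_def exec.simps(1,2) exec_clear_comp[OF v] by blast
    from s(1) out[OF v] obtain x where x: "x \<le> \<sigma> i" "x \<le> \<sigma> j" "s1 = (\<rho> \<sigma> x, p)" by blast
    with s(2) have "\<sigma> i = x" and s2: "s2 = (\<rho> \<sigma> x, p)" using \<rho>_simps by auto
    have "valid w cap s1"
      using exec_valid[OF s(1)] v valid_upd[OF v, of 0 k] by auto
    with s(3) mid s2 x have 3: "strict \<longrightarrow> 0 < \<sigma> j - x" "s3 = (\<rho> \<sigma> x, p)" using \<rho>_simps by auto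
    with s(4) rest[OF v x(1,2)] obtain y where "y \<le> x" "s4 = (\<rho> \<sigma> y, p)" by blast
    with s(5) have "s = (\<rho> \<sigma> 0, p)" using \<rho>_simps by auto
    then show ?R using 3 x \<open>\<sigma> i = x\<close> by (auto simp: \<rho>_def)
  next
    assume R: ?R
    then have le: "\<sigma> i \<le> \<sigma> j" by (auto split: if_splits)
    have o: "((\<sigma>(k := 0), p), (\<rho> \<sigma> (\<sigma> i), p)) \<in> exec (crel w cap) ?out"
      unfolding out[OF v] using le by blast
    moreover have "((\<rho> \<sigma> (\<sigma> i), p), (\<rho> \<sigma> (\<sigma> i), p)) \<in> crel w cap (IsZero i)"
      using \<rho>_simps by simp
    moreover have "valid w cap (\<rho> \<sigma> (\<sigma> i), p)"
      using exec_valid[OF o] valid_upd[OF v, of 0 k] v by auto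
    then have "((\<rho> \<sigma> (\<sigma> i), p), (\<rho> \<sigma> (\<sigma> i), p)) \<in> exec (crel w cap) ?mid"
      unfolding mid[OF \<open>valid w cap (\<rho> \<sigma> (\<sigma> i), p)\<close>] using R \<rho>_simps by (auto split: if_splits)
    moreover have "((\<rho> \<sigma> (\<sigma> i), p), (\<rho> \<sigma> 0, p)) \<in> exec (crel w cap) ?back"
      unfolding rest[OF v order_refl le] by blast
    moreover have "((\<rho> \<sigma> 0, p), s) \<in> crel w cap (IsZero k)"
      using R \<rho>_simps by (auto simp: \<rho>_def)
    ultimately show ?L unfolding compare_def exec.simps(1,2) exec_clear_comp[OF v] by blast
  qed
  show ?thesis
    by (rule testsI) (use iff in \<open>auto split: if_splits\<close>)
qed

lemma exec_guess_comp:
  assumes "valid w cap (\<sigma>, p)"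
  shows "((\<sigma>, p), s) \<in> exec (crel w cap) (guess i) O R \<longleftrightarrow> (\<exists>v<cap. ((\<sigma>(i := v), p), s) \<in> R)"
  unfolding relcomp_unfold mem_Collect_eq prod.case exec_guess[OF assms] by blast

text \<open>Tests leave the input head anywhere, so it is first sent to the left end and then moved
  by \<open>\<sigma> i\<close> cells while \<open>k\<close> keeps the count. With
  \<open>d = MoveR\<close> the cell after position \<open>\<sigma> i\<close> is read without storing
  \<open>\<sigma> i + 1\<close>, which may reach the cap.\<close>

definition read :: "nat \<Rightarrow> nat \<Rightarrow> dir \<Rightarrow> 'a cell \<Rightarrow> 'a catom prog" where
  "read i k d a = Seq (clear k) (Seq (Star (Atom (Go MoveL))) (Seq (Atom (Read LeftEnd))
     (Seq (Star (Seq (Atom (Dec i)) (Seq (Atom (Inc k)) (Atom (Go MoveR)))))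
     (Seq (Atom (IsZero i)) (Seq (Atom (Go d)) (Seq (Atom (Read a))
     (Seq (Star (Seq (Atom (Dec k)) (Atom (Inc i)))) (Atom (IsZero k)))))))))"

lemma exec_rewind_head:
  assumes "valid w cap (\<sigma>, p)"
  shows "((\<sigma>, p), s) \<in> exec (crel w cap) (Star (Atom (Go MoveL))) \<longleftrightarrow> (\<exists>q\<le>p. s = (\<sigma>, q))"
proof -
  let ?B = "crel w cap (Go MoveL)"
  have p: "p \<le> Suc (length w)" using assms by simp
  have "\<exists>q\<le>p. s = (\<sigma>, q)" if "((\<sigma>, p), s) \<in> ?B\<^sup>*" for s
    using that
  proof (induction rule: rtrancl_induct)
    case base
    then show ?case by blast
  next
    case (step y z)
    then obtain q where "q \<le> p" "y = (\<sigma>, q)" by blast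
    with step(2) show ?case by (simp add: le_diff_conv min.coboundedI2)
  qed
  moreover have "((\<sigma>, p), (\<sigma>, p - x)) \<in> ?B\<^sup>*" for x
  proof (induction x)
    case (Suc x)
    have "((\<sigma>, p - x), (\<sigma>, p - Suc x)) \<in> ?B" using p by (simp add: min_def)
    with Suc show ?case by (meson rtrancl.rtrancl_into_rtrancl)
  qed simp
  ultimately show ?thesis by (simp only: exec.simps) (metis diff_diff_cancel)
qed

lemma exec_walk:
  fixes i k :: nat
  defines "\<rho> \<equiv> \<lambda>\<sigma> x. \<sigma>(i := \<sigma> i - x, k := x) :: nat \<Rightarrow> nat"
  assumes "valid w cap (\<sigma>, 0)" "i \<noteq> k" "\<sigma> k = 0"
  shows "((\<sigma>, 0), s) \<in> exec (crel w cap) (Star (Seq (Atom (Dec i)) (Seq (Atom (Inc k)) (Atom (Go MoveR))))) \<longleftrightarrow>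
    (\<exists>x\<le>\<sigma> i. s = (\<rho> \<sigma> x, min (Suc (length w)) x))"
proof -
  let ?B = "exec (crel w cap) (Seq (Atom (Dec i)) (Seq (Atom (Inc k)) (Atom (Go MoveR))))"
  have 0: "\<rho> \<sigma> 0 = \<sigma>" using assms by (auto simp: \<rho>_def)
  have body: "((\<rho> \<sigma> x, p), s) \<in> ?B \<longleftrightarrow>
      x < \<sigma> i \<and> Suc x < cap \<and> s = (\<rho> \<sigma> (Suc x), min (Suc (length w)) (Suc p))" for x s p
  proof -
    have "(\<rho> \<sigma> x)(i := \<sigma> i - x - 1, k := Suc x) = \<rho> \<sigma> (Suc x)"
      using assms(3) by (auto simp: \<rho>_def)
    moreover have "\<rho> \<sigma> x i = \<sigma> i - x" "\<rho> \<sigma> x k = x"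
      using assms(3) by (auto simp: \<rho>_def)
    ultimately show ?thesis using assms(3) by auto
  qed
  have min: "min (Suc (length w)) (Suc (min (Suc (length w)) x)) = min (Suc (length w)) (Suc x)" for x
    by simp
  have "\<exists>x\<le>\<sigma> i. s = (\<rho> \<sigma> x, min (Suc (length w)) x)" if "((\<sigma>, 0), s) \<in> ?B\<^sup>*" for s
    using that
  proof (induction rule: rtrancl_induct)
    case base
    then show ?case using 0 by (intro exI[of _ 0]) simp
  next
    case (step y z)
    then obtain x where "y = (\<rho> \<sigma> x, min (Suc (length w)) x)" by blast
    with step(2) have "x < \<sigma> i" "z = (\<rho> \<sigma> (Suc x), min (Suc (length w)) (Suc x))"
      unfolding \<open>y = _\<close> body min by blast+
    then show ?case using Suc_leI by blast
  qed
  moreover have "((\<sigma>, 0), (\<rho> \<sigma> x, min (Suc (length w)) x)) \<in> ?B\<^sup>*" if "x \<le> \<sigma> i" for x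
    using that
  proof (induction x)
    case (Suc x)
    have "\<sigma> i < cap" using assms(2) by simp
    then have "((\<rho> \<sigma> x, min (Suc (length w)) x), (\<rho> \<sigma> (Suc x), min (Suc (length w)) (Suc x))) \<in> ?B"
      using Suc.prems unfolding body min by simp
    with Suc show ?case by (meson Suc_leD rtrancl.rtrancl_into_rtrancl)
  qed (simp add: 0)
  ultimately show ?thesis by (simp only: exec.simps(4)) blast
qed

lemma exec_restore:
  fixes i k :: nat
  defines "\<rho> \<equiv> \<lambda>\<sigma> x. \<sigma>(i := \<sigma> i - x, k := x) :: nat \<Rightarrow> nat"
  assumes "\<sigma> i < cap" "i \<noteq> k" "x \<le> \<sigma> i"
  shows "((\<rho> \<sigma> x, p), s) \<in> exec (crel w cap) (Star (Seq (Atom (Dec k)) (Atom (Inc i)))) \<longleftrightarrow>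
    (\<exists>y\<le>x. s = (\<rho> \<sigma> y, p))"
proof -
  let ?B = "exec (crel w cap) (Seq (Atom (Dec k)) (Atom (Inc i)))"
  have body: "((\<rho> \<sigma> y, p), s) \<in> ?B \<longleftrightarrow> 0 < y \<and> s = (\<rho> \<sigma> (y - 1), p)" if "y \<le> x" for y s
  proof -
    have less: "Suc (\<sigma> i - y) < cap" and eq: "\<sigma> i - (y - 1) = Suc (\<sigma> i - y)" if "0 < y"
      using \<open>y \<le> x\<close> assms(2,4) that by linarith+
    have "(\<rho> \<sigma> y)(k := y - 1, i := Suc (\<sigma> i - y)) = \<rho> \<sigma> (y - 1)" if "0 < y"
      unfolding \<rho>_def eq[OF that] using assms(3) by auto
    moreover have "\<rho> \<sigma> y i = \<sigma> i - y" "\<rho> \<sigma> y k = y"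
      using assms(3) by (auto simp: \<rho>_def)
    ultimately show ?thesis using assms(3) less by auto
  qed
  have "\<exists>y\<le>x. s = (\<rho> \<sigma> y, p)" if "((\<rho> \<sigma> x, p), s) \<in> ?B\<^sup>*" for s
    using that
  proof (induction rule: rtrancl_induct)
    case base
    then show ?case by blast
  next
    case (step y z)
    then obtain y' where "y' \<le> x" "y = (\<rho> \<sigma> y', p)" by blast
    with step(2) body[of y' z] have "z = (\<rho> \<sigma> (y' - 1), p)" by simp
    with \<open>y' \<le> x\<close> show ?case using diff_le_self le_trans by blast
  qed
  moreover have "((\<rho> \<sigma> x, p), (\<rho> \<sigma> (x - y), p)) \<in> ?B\<^sup>*" if "y \<le> x" for y
    using that
  proof (induction y)
    case (Suc y)
    have "((\<rho> \<sigma> (x - y), p), (\<rho> \<sigma> (x - Suc y), p)) \<in> ?B"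
      using Suc.prems unfolding body[OF diff_le_self] by simp
    with Suc show ?case by (meson Suc_leD rtrancl.rtrancl_into_rtrancl)
  qed simp
  ultimately show ?thesis
    by (simp only: exec.simps(4)) (metis diff_diff_cancel diff_le_self)
qed

lemma input_cell_min [simp]: "input_cell w (min (Suc (length w)) p) = input_cell w p"
  by (auto simp: input_cell_def min_def)

text \<open>This fails for \<open>MoveL\<close>: from the right end marker, to which the head is
  clamped, one step to the left leaves the marker, whereas the position before clamping may still
  lie beyond the word.\<close>

lemma move_min: "d \<noteq> MoveL \<Longrightarrow> input_cell w (move d (min (Suc (length w)) p)) = input_cell w (move d p)"
  by (cases d) (auto simp: input_cell_def min_def)

lemma read_tests:
  assumes "i < k" "d \<noteq> MoveL"
  shows "tests k (read i k d a) (\<lambda>w \<sigma>. input_cell w (move d (\<sigma> i)) = a)"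
proof -
  define \<rho> where "\<rho> \<sigma> x = \<sigma>(i := \<sigma> i - x, k := x)" for \<sigma> :: "nat \<Rightarrow> nat" and x
  have ik: "i \<noteq> k" using assms(1) by simp
  have \<rho>_simps: "\<rho> \<sigma> x i = \<sigma> i - x" "\<rho> \<sigma> x k = x" for \<sigma> x
    using ik by (simp_all add: \<rho>_def)
  let ?walk = "Star (Seq (Atom (Dec i)) (Seq (Atom (Inc k)) (Atom (Go MoveR)))) :: 'a catom prog"
  let ?restore = "Star (Seq (Atom (Dec k)) (Atom (Inc i))) :: 'a catom prog"
  have walk: "((\<sigma>(k := 0), 0), s) \<in> exec (crel w cap) ?walk \<longleftrightarrow>
      (\<exists>x\<le>\<sigma> i. s = (\<rho> \<sigma> x, min (Suc (length w)) x))" if "valid w cap (\<sigma>, p)" for w cap \<sigma> p s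
    using exec_walk[of w cap "\<sigma>(k := 0)" i k s] that ik by (auto simp: \<rho>_def fun_upd_twist)
  have iff: "((\<sigma>, p), (\<tau>, r)) \<in> exec (crel w cap) (read i k d a) \<longleftrightarrow>
      input_cell w (move d (\<sigma> i)) = a \<and> \<tau> = \<sigma>(k := 0) \<and>
      r = min (Suc (length w)) (move d (min (Suc (length w)) (\<sigma> i)))"
    (is "?L \<longleftrightarrow> ?R") if v: "valid w cap (\<sigma>, p)" for w :: "'a list" and cap \<sigma> p \<tau> r
  proof -
    have lt: "\<sigma> i < cap" and v0: "valid w cap (\<sigma>(k := 0), p)" using v by auto
    note restore = exec_restore[of \<sigma> i cap k, OF lt ik, folded \<rho>_def]
    have LeftEnd: "input_cell w q = LeftEnd \<longleftrightarrow> q = 0" for q by (simp add: input_cell_def)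
    show ?thesis
    proof
      assume ?L
      then obtain q s1 s2 where s: "q \<le> p" "input_cell w q = LeftEnd"
        "((\<sigma>(k := 0), q), s1) \<in> exec (crel w cap) ?walk"
        "(s1, s2) \<in> crel w cap (IsZero i) O crel w cap (Go d) O crel w cap (Read a)"
        "(s2, (\<tau>, r)) \<in> exec (crel w cap) ?restore O crel w cap (IsZero k)"
        unfolding read_def exec.simps(1,2) exec_clear_comp[OF v]
        using exec_rewind_head[OF v0] by (elim relcompE) (force simp del: split_paired_Ex)
      from s(2,3) walk[OF v] obtain x where x: "x \<le> \<sigma> i" "s1 = (\<rho> \<sigma> x, min (Suc (length w)) x)"
        unfolding LeftEnd by blast
      with s(4) have "x = \<sigma> i" and a: "input_cell w (move d (min (Suc (length w)) x)) = a"
        and s2: "s2 = (\<rho> \<sigma> x, min (Suc (length w)) (move d (min (Suc (length w)) x)))"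
        using \<rho>_simps by auto
      from s(5) obtain s3 where s3: "(s2, s3) \<in> exec (crel w cap) ?restore"
        "(s3, (\<tau>, r)) \<in> crel w cap (IsZero k)" by blast
      from s3(1) obtain y where "y \<le> x" "s3 = (\<rho> \<sigma> y, snd s2)"
        unfolding s2 restore[OF x(1)] snd_conv by blast
      with s3(2) have "\<tau> = \<rho> \<sigma> 0" "r = snd s2" using \<rho>_simps by auto
      moreover have "input_cell w (move d (\<sigma> i)) = a"
        using a unfolding move_min[OF assms(2)] \<open>x = \<sigma> i\<close> .
      ultimately show ?R using \<open>x = \<sigma> i\<close> s2 by (simp add: \<rho>_def)
    next
      assume R: ?R
      let ?q = "min (Suc (length w)) (move d (min (Suc (length w)) (\<sigma> i)))"
      have "((\<sigma>(k := 0), p), (\<sigma>(k := 0), 0)) \<in> exec (crel w cap) (Star (Atom (Go MoveL)))"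
        unfolding exec_rewind_head[OF v0] by blast
      moreover have "((\<sigma>(k := 0), 0), (\<sigma>(k := 0), 0)) \<in> crel w cap (Read LeftEnd)"
        using LeftEnd by simp
      moreover have "((\<sigma>(k := 0), 0), (\<rho> \<sigma> (\<sigma> i), min (Suc (length w)) (\<sigma> i))) \<in> exec (crel w cap) ?walk"
        unfolding walk[OF v] by blast
      moreover have "((\<rho> \<sigma> (\<sigma> i), min (Suc (length w)) (\<sigma> i)), (\<tau>, r)) \<in>
          crel w cap (IsZero i) O crel w cap (Go d) O crel w cap (Read a) O
          exec (crel w cap) ?restore O crel w cap (IsZero k)"
      proof -
        have "((\<rho> \<sigma> (\<sigma> i), ?q), (\<rho> \<sigma> 0, ?q)) \<in> exec (crel w cap) ?restore"
          unfolding restore[OF order_refl] by blast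
        moreover have "((\<rho> \<sigma> 0, ?q), (\<tau>, r)) \<in> crel w cap (IsZero k)"
          using R \<rho>_simps by (simp add: \<rho>_def)
        moreover have "input_cell w ?q = a"
          unfolding input_cell_min move_min[OF assms(2)] using R by blast
        ultimately show ?thesis using \<rho>_simps by auto
      qed
      ultimately show ?L unfolding read_def exec.simps(1,2) exec_clear_comp[OF v] by blast
    qed
  qed
  show ?thesis by (rule testsI) (use iff in auto)
qed

section \<open>Atomic tests and bounded quantifiers\<close>

lemma ntest_True: "ntest k (\<lambda>w \<sigma>. True)"
proof -
  have "tests k (Atom (Go Stay)) (\<lambda>w \<sigma>. True)" by (rule testsI) auto
  then show ?thesis unfolding ntest_def by blast
qed

lemma ntest_False: "ntest k (\<lambda>w \<sigma>. False)"
proof -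
  have "tests k (Seq (Atom (Read LeftEnd)) (Atom (Read RightEnd))) (\<lambda>w \<sigma>. False)"
    by (rule testsI) auto
  then show ?thesis unfolding ntest_def by blast
qed

lemma ntest_Bex:
  "finite B \<Longrightarrow> (\<And>b. b \<in> B \<Longrightarrow> ntest k (T b)) \<Longrightarrow> ntest k (\<lambda>w \<sigma>. \<exists>b\<in>B. T b w \<sigma>)"
  by (induction B rule: finite_induct) (simp_all add: ntest_False ntest_disj)

lemma ntest_cell: "i < k \<Longrightarrow> ntest k (\<lambda>w \<sigma>. input_cell w (\<sigma> i) = a)"
  using read_tests[of i k Stay a] unfolding ntest_def by (auto simp: agree_def)

lemma ntest_cell_Suc: "i < k \<Longrightarrow> ntest k (\<lambda>w \<sigma>. input_cell w (Suc (\<sigma> i)) = a)"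
  using read_tests[of i k MoveR a] unfolding ntest_def by (auto simp: agree_def)

lemma ntest_less: "i < k \<Longrightarrow> j < k \<Longrightarrow> ntest k (\<lambda>w \<sigma>. \<sigma> i < \<sigma> j)"
  using compare_tests[of i k j True] ntest_False
  by (cases "i = j") (auto simp: ntest_def agree_def)

lemma ntest_le: "i < k \<Longrightarrow> j < k \<Longrightarrow> ntest k (\<lambda>w \<sigma>. \<sigma> i \<le> \<sigma> j)"
  using compare_tests[of i k j False] ntest_True
  by (cases "i = j") (auto simp: ntest_def agree_def)

lemma ntest_zero: "i < k \<Longrightarrow> ntest k (\<lambda>w \<sigma>. \<sigma> i = 0)"
proof -
  assume "i < k"
  have "tests k (Atom (IsZero i)) (\<lambda>w \<sigma>. \<sigma> i = 0)" by (rule testsI) auto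
  then show ?thesis using \<open>i < k\<close> unfolding ntest_def by (auto simp: agree_def)
qed

text \<open>Successors are tested by decreasing the larger number, because increasing the smaller
  one might hit the cap. The closing \<open>Inc\<close> only undoes the \<open>Dec\<close>.\<close>

lemma ntest_pred:
  assumes "ntest k T" "i < k"
  shows "ntest k (\<lambda>w \<sigma>. 0 < \<sigma> i \<and> T w (\<sigma>(i := \<sigma> i - 1)))"
proof -
  obtain P where P: "tests k P T" using assms(1) unfolding ntest_def by blast
  have "tests k (Seq (Atom (Dec i)) (Seq P (Atom (Inc i)))) (\<lambda>w \<sigma>. 0 < \<sigma> i \<and> T w (\<sigma>(i := \<sigma> i - 1)))"
  proof (rule testsI)
    fix w :: "'a list" and cap \<sigma> p \<tau> q
    assume v: "valid w cap (\<sigma>, p)"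
      and "((\<sigma>, p), (\<tau>, q)) \<in> exec (crel w cap) (Seq (Atom (Dec i)) (Seq P (Atom (Inc i))))"
    then obtain \<rho> r where 1: "0 < \<sigma> i" "((\<sigma>(i := \<sigma> i - 1), p), (\<rho>, r)) \<in> exec (crel w cap) P"
      "((\<rho>, r), (\<tau>, q)) \<in> crel w cap (Inc i)" by auto
    have "valid w cap (\<sigma>(i := \<sigma> i - 1), p)" using v by (auto intro: less_imp_diff_less)
    from testsD1[OF P this 1(2)] have "T w (\<sigma>(i := \<sigma> i - 1))" "agree k (\<sigma>(i := \<sigma> i - 1)) \<rho>" by auto
    with 1(1,3) assms(2) show "(0 < \<sigma> i \<and> T w (\<sigma>(i := \<sigma> i - 1))) \<and> agree k \<sigma> \<tau>"
      by (auto simp: agree_def split: if_splits)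
  next
    fix w :: "'a list" and cap \<sigma> p
    assume v: "valid w cap (\<sigma>, p)" and T: "0 < \<sigma> i \<and> T w (\<sigma>(i := \<sigma> i - 1))"
    have "valid w cap (\<sigma>(i := \<sigma> i - 1), p)" using v by (auto intro: less_imp_diff_less)
    from testsD2[OF P this] T obtain \<tau> q where
      1: "((\<sigma>(i := \<sigma> i - 1), p), (\<tau>, q)) \<in> exec (crel w cap) P" "agree k (\<sigma>(i := \<sigma> i - 1)) \<tau>" by blast
    have "\<tau> i = \<sigma> i - 1" using 1(2) assms(2) by (auto simp: agree_def)
    then have "((\<tau>, q), (\<tau>(i := Suc (\<tau> i)), q)) \<in> crel w cap (Inc i)" using T v by simp
    with 1(1) T show "\<exists>\<tau> q. ((\<sigma>, p), (\<tau>, q)) \<in> exec (crel w cap) (Seq (Atom (Dec i)) (Seq P (Atom (Inc i))))"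
      by (simp only: exec.simps crel_comp) blast
  qed
  moreover have "(0 < \<sigma> i \<and> T w (\<sigma>(i := \<sigma> i - 1))) = (0 < \<tau> i \<and> T w (\<tau>(i := \<tau> i - 1)))"
    if "agree k \<sigma> \<tau>" for w \<sigma> \<tau>
  proof -
    have "agree k (\<sigma>(i := \<sigma> i - 1)) (\<tau>(i := \<tau> i - 1))" using that by (simp add: agree_def)
    then have "T w (\<sigma>(i := \<sigma> i - 1)) = T w (\<tau>(i := \<tau> i - 1))" by (rule ntest_agree[OF assms(1)])
    moreover have "\<sigma> i = \<tau> i" using that assms(2) by (simp add: agree_def)
    ultimately show ?thesis by simp
  qed
  ultimately show ?thesis unfolding ntest_def by blast
qed

text \<open>A single run checks all positions in order, with counter \<open>k\<close> as the loop
  variable; since the test preserves it, nondeterminism inside the test does no harm. The loop ends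
  when \<open>k\<close> is \<open>length w + 1\<close>, a value below the cap because the cap is at
  least \<open>length w + 2\<close>.\<close>

lemma ntest_all:
  fixes Q :: "'a list \<Rightarrow> (nat \<Rightarrow> nat) \<Rightarrow> nat \<Rightarrow> bool"
  assumes "ntest (Suc k) (\<lambda>w \<sigma>. Q w \<sigma> (\<sigma> k))"
    and dep: "\<And>w \<sigma> \<tau> v. agree k \<sigma> \<tau> \<Longrightarrow> Q w \<sigma> v = Q w \<tau> v"
  shows "ntest k (\<lambda>w \<sigma>. \<forall>v\<le>length w. Q w \<sigma> v)"
proof -
  obtain P where P: "tests (Suc k) P (\<lambda>w \<sigma>. Q w \<sigma> (\<sigma> k))"
    using assms(1) unfolding ntest_def by blast
  obtain E where E: "tests (Suc k) E (\<lambda>(w :: 'a list) \<sigma>. input_cell w (\<sigma> k) = RightEnd)"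
    using ntest_cell[of k "Suc k" "RightEnd :: 'a cell"] unfolding ntest_def by blast
  let ?B = "Seq P (Atom (Inc k))"
  have sound: "agree k \<sigma> (fst s) \<and> valid w cap s \<and> (\<forall>u<fst s k. Q w \<sigma> u)"
    if "((\<sigma>(k := 0), p), s) \<in> (exec (crel w cap) ?B)\<^sup>*" "valid w cap (\<sigma>, p)" for w cap \<sigma> p s
    using that(1)
  proof (induction rule: rtrancl_induct)
    case base
    then show ?case using that(2) by (auto simp: agree_def)
  next
    case (step y z)
    obtain \<tau> q where y: "y = (\<tau>, q)" by (cases y)
    from step(2) obtain \<rho> r where 1: "((\<tau>, q), (\<rho>, r)) \<in> exec (crel w cap) P"
      "((\<rho>, r), z) \<in> crel w cap (Inc k)" unfolding y by auto
    from step.IH have IH: "agree k \<sigma> \<tau>" "valid w cap (\<tau>, q)" "\<forall>u<\<tau> k. Q w \<sigma> u" unfolding y by auto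
    from testsD1[OF P IH(2) 1(1)] have "Q w \<tau> (\<tau> k)" "agree (Suc k) \<tau> \<rho>" "valid w cap (\<rho>, r)" by auto
    moreover have "valid w cap z" using exec_valid[of "(\<rho>, r)" z w cap "Atom (Inc k)"] 1(2) calculation by simp
    moreover have "agree k \<sigma> \<rho>"
      using IH(1) \<open>agree (Suc k) \<tau> \<rho>\<close> by (simp add: agree_def)
    moreover have "\<rho> k = \<tau> k" using \<open>agree (Suc k) \<tau> \<rho>\<close> by (simp add: agree_def)
    ultimately show ?case using 1(2) IH dep[OF IH(1)] by (auto simp: less_Suc_eq agree_def)
  qed
  have "tests k (Seq (clear k) (Seq (Star ?B) E)) (\<lambda>w \<sigma>. \<forall>v\<le>length w. Q w \<sigma> v)"
  proof (rule testsI)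
    fix w :: "'a list" and cap \<sigma> p \<tau> q
    assume v: "valid w cap (\<sigma>, p)"
      and "((\<sigma>, p), (\<tau>, q)) \<in> exec (crel w cap) (Seq (clear k) (Seq (Star ?B) E))"
    then obtain s where s: "((\<sigma>(k := 0), p), s) \<in> (exec (crel w cap) ?B)\<^sup>*"
      "(s, (\<tau>, q)) \<in> exec (crel w cap) E"
      unfolding exec.simps(2,4) exec_clear_comp[OF v] by blast
    obtain \<rho> r where s': "s = (\<rho>, r)" by (cases s)
    from sound[OF s(1) v] have 1: "agree k \<sigma> \<rho>" "valid w cap (\<rho>, r)" "\<forall>u<\<rho> k. Q w \<sigma> u"
      unfolding s' by auto
    from testsD1[OF E 1(2) s(2)[unfolded s']] have "length w < \<rho> k" "agree (Suc k) \<rho> \<tau>"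
      by (auto simp: input_cell_RightEnd)
    with 1 show "(\<forall>v\<le>length w. Q w \<sigma> v) \<and> agree k \<sigma> \<tau>"
      by (simp add: agree_def)
  next
    fix w :: "'a list" and cap \<sigma> p
    assume v: "valid w cap (\<sigma>, p)" and all: "\<forall>v\<le>length w. Q w \<sigma> v"
    have "\<exists>\<tau> q. ((\<sigma>(k := 0), p), (\<tau>, q)) \<in> (exec (crel w cap) ?B)\<^sup>* \<and> \<tau> k = x" if "x \<le> Suc (length w)" for x
      using that
    proof (induction x)
      case (Suc x)
      have "x \<le> Suc (length w)" using Suc.prems by simp
      with Suc.IH obtain \<tau> q where
        1: "((\<sigma>(k := 0), p), (\<tau>, q)) \<in> (exec (crel w cap) ?B)\<^sup>*" "\<tau> k = x" by blast
      from sound[OF 1(1) v] have 2: "agree k \<sigma> \<tau>" "valid w cap (\<tau>, q)" by auto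
      have "Q w \<tau> (\<tau> k)" using all Suc.prems 1(2) dep[OF 2(1)] by simp
      from testsD2[OF P 2(2), OF this] obtain \<rho> r where 3: "((\<tau>, q), (\<rho>, r)) \<in> exec (crel w cap) P"
        "agree (Suc k) \<tau> \<rho>" by blast
      have "\<rho> k = x" using 3(2) 1(2) by (simp add: agree_def)
      then have "((\<rho>, r), (\<rho>(k := Suc x), r)) \<in> crel w cap (Inc k)" using Suc.prems v by simp
      with 3(1) have "((\<tau>, q), (\<rho>(k := Suc x), r)) \<in> exec (crel w cap) ?B" by auto
      with 1(1) show ?case by (meson fun_upd_same rtrancl.rtrancl_into_rtrancl)
    qed (intro exI[of _ "\<sigma>(k := 0)"] exI[of _ p], simp)
    then obtain \<tau> q where 1: "((\<sigma>(k := 0), p), (\<tau>, q)) \<in> (exec (crel w cap) ?B)\<^sup>*" "\<tau> k = Suc (length w)"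
      by blast
    from sound[OF 1(1) v] have "valid w cap (\<tau>, q)" by auto
    moreover have "input_cell w (\<tau> k) = RightEnd" using 1(2) by (simp add: input_cell_RightEnd)
    ultimately obtain \<rho> r where "((\<tau>, q), (\<rho>, r)) \<in> exec (crel w cap) E" using testsD2[OF E] by blast
    with 1(1) show "\<exists>\<tau> q. ((\<sigma>, p), (\<tau>, q)) \<in> exec (crel w cap) (Seq (clear k) (Seq (Star ?B) E))"
      unfolding exec.simps(2,4) exec_clear_comp[OF v] by blast
  qed
  then show ?thesis unfolding ntest_def using dep by blast
qed

section \<open>Paths in definable graphs\<close>

lemma guess_in:
  "valid w cap (\<sigma>, p) \<Longrightarrow> v < cap \<Longrightarrow> ((\<sigma>, p), (\<sigma>(i := v), p)) \<in> exec (crel w cap) (guess i)"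
  using exec_guess by blast

abbreviation path :: "('b \<Rightarrow> 'c \<Rightarrow> 'b \<Rightarrow> 'c \<Rightarrow> bool) \<Rightarrow> 'b \<Rightarrow> 'c \<Rightarrow> 'b \<Rightarrow> 'c \<Rightarrow> bool" where
  "path R a b c d \<equiv> (\<lambda>(a, b) (c, d). R a b c d)\<^sup>*\<^sup>* (a, b) (c, d)"

text \<open>Only the current pair is kept, in counters \<open>k\<close> and \<open>k + 1\<close>.
  The next pair is guessed in \<open>k + 2\<close> and \<open>k + 3\<close>, checked against
  \<open>R\<close>, and copied down. \<open>boundS\<close> and \<open>boundR\<close> keep all
  vertices of the path below the cap.\<close>

lemma ntest_path:
  fixes S E :: "'a list \<Rightarrow> (nat \<Rightarrow> nat) \<Rightarrow> nat \<Rightarrow> nat \<Rightarrow> bool"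
  assumes S: "ntest (k + 2) (\<lambda>w \<sigma>. S w \<sigma> (\<sigma> k) (\<sigma> (k + 1)))"
    and R: "ntest (k + 4) (\<lambda>w \<sigma>. R w \<sigma> (\<sigma> k) (\<sigma> (k + 1)) (\<sigma> (k + 2)) (\<sigma> (k + 3)))"
    and E: "ntest (k + 2) (\<lambda>w \<sigma>. E w \<sigma> (\<sigma> k) (\<sigma> (k + 1)))"
    and depS: "\<And>w \<sigma> \<tau> a b. agree k \<sigma> \<tau> \<Longrightarrow> S w \<sigma> a b = S w \<tau> a b"
    and depR: "\<And>w \<sigma> \<tau> a b c d. agree k \<sigma> \<tau> \<Longrightarrow> R w \<sigma> a b c d = R w \<tau> a b c d"
    and depE: "\<And>w \<sigma> \<tau> a b. agree k \<sigma> \<tau> \<Longrightarrow> E w \<sigma> a b = E w \<tau> a b"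
    and boundS: "\<And>w \<sigma> a b. S w \<sigma> a b \<Longrightarrow> a \<le> length w \<and> b \<le> length w"
    and boundR: "\<And>w \<sigma> a b c d. R w \<sigma> a b c d \<Longrightarrow> c \<le> length w \<and> d \<le> length w"
  shows "ntest k (\<lambda>w \<sigma>. \<exists>a b c d. S w \<sigma> a b \<and> path (R w \<sigma>) a b c d \<and> E w \<sigma> c d)"
proof -
  obtain PS where PS: "tests (k + 2) PS (\<lambda>w \<sigma>. S w \<sigma> (\<sigma> k) (\<sigma> (k + 1)))"
    using S unfolding ntest_def by blast
  obtain PR where PR: "tests (k + 4) PR (\<lambda>w \<sigma>. R w \<sigma> (\<sigma> k) (\<sigma> (k + 1)) (\<sigma> (k + 2)) (\<sigma> (k + 3)))"
    using R unfolding ntest_def by blast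
  obtain PE where PE: "tests (k + 2) PE (\<lambda>w \<sigma>. E w \<sigma> (\<sigma> k) (\<sigma> (k + 1)))"
    using E unfolding ntest_def by blast
  \<comment> \<open>There is no assignment between counters: to copy one, the target is guessed anew
    and compared with the source.\<close>
  define C where "C w \<sigma> \<longleftrightarrow> \<sigma> k = \<sigma> (k + 2) \<and> \<sigma> (k + 1) = \<sigma> (k + 3)"
    for w :: "'a list" and \<sigma> :: "nat \<Rightarrow> nat"
  have "ntest (k + 4) (\<lambda>(w :: 'a list) \<sigma>. (\<sigma> k \<le> \<sigma> (k + 2) \<and> \<sigma> (k + 2) \<le> \<sigma> k) \<and>
      (\<sigma> (k + 1) \<le> \<sigma> (k + 3) \<and> \<sigma> (k + 3) \<le> \<sigma> (k + 1)))"
    by (intro ntest_conj ntest_le) simp_all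
  then have "ntest (k + 4) C" by (rule ntest_cong) (auto simp: C_def)
  then obtain PC where PC: "tests (k + 4) PC C" unfolding ntest_def by blast
  let ?B = "Seq (guess (k + 2)) (Seq (guess (k + 3)) (Seq PR (Seq (guess k) (Seq (guess (k + 1)) PC))))"
  have body_sound: "agree k \<sigma> \<tau> \<and> R w \<sigma> (\<sigma> k) (\<sigma> (k + 1)) (\<tau> k) (\<tau> (k + 1)) \<and> valid w cap (\<tau>, q)"
    if v: "valid w cap (\<sigma>, p)" and B: "((\<sigma>, p), (\<tau>, q)) \<in> exec (crel w cap) ?B" for w cap \<sigma> p \<tau> q
  proof -
    from B obtain c where c: "c < cap" "((\<sigma>(k + 2 := c), p), (\<tau>, q)) \<in>
        exec (crel w cap) (Seq (guess (k + 3)) (Seq PR (Seq (guess k) (Seq (guess (k + 1)) PC))))"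
      by (subst (asm) exec.simps(2)) (auto simp only: exec_guess_comp[OF v])
    note v1 = valid_upd[OF v c(1), of "k + 2"]
    from c(2) obtain d where d: "d < cap" "((\<sigma>(k + 2 := c, k + 3 := d), p), (\<tau>, q)) \<in>
        exec (crel w cap) (Seq PR (Seq (guess k) (Seq (guess (k + 1)) PC)))"
      by (subst (asm) exec.simps(2)) (auto simp only: exec_guess_comp[OF v1])
    note v2 = valid_upd[OF v1 d(1), of "k + 3"]
    from d(2) obtain \<rho> r where r: "((\<sigma>(k + 2 := c, k + 3 := d), p), (\<rho>, r)) \<in> exec (crel w cap) PR"
      "((\<rho>, r), (\<tau>, q)) \<in> exec (crel w cap) (Seq (guess k) (Seq (guess (k + 1)) PC))"
      by (subst (asm) exec.simps(2)) auto
    from testsD1[OF PR v2 r(1)] have R: "R w (\<sigma>(k + 2 := c, k + 3 := d)) (\<sigma> k) (\<sigma> (k + 1)) c d"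
      and \<rho>: "agree (k + 4) (\<sigma>(k + 2 := c, k + 3 := d)) \<rho>" and v3: "valid w cap (\<rho>, r)" by simp_all
    from r(2) obtain a where a: "a < cap" "((\<rho>(k := a), r), (\<tau>, q)) \<in>
        exec (crel w cap) (Seq (guess (k + 1)) PC)"
      by (subst (asm) exec.simps(2)) (auto simp only: exec_guess_comp[OF v3])
    note v4 = valid_upd[OF v3 a(1), of k]
    from a(2) obtain b where b: "b < cap" "((\<rho>(k := a, k + 1 := b), r), (\<tau>, q)) \<in> exec (crel w cap) PC"
      by (subst (asm) exec.simps(2)) (auto simp only: exec_guess_comp[OF v4])
    note v5 = valid_upd[OF v4 b(1), of "k + 1"]
    from testsD1[OF PC v5 b(2)] have ab: "a = \<rho> (k + 2)" "b = \<rho> (k + 3)"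
      and \<tau>: "agree (k + 4) (\<rho>(k := a, k + 1 := b)) \<tau>" and v6: "valid w cap (\<tau>, q)"
      by (auto simp: C_def)
    have \<rho>_eq: "\<rho> i = (\<sigma>(k + 2 := c, k + 3 := d)) i" if "i < k + 4" for i
      using \<rho> that by (simp add: agree_def)
    have \<tau>_eq: "\<tau> i = (\<rho>(k := a, k + 1 := b)) i" if "i < k + 4" for i
      using \<tau> that by (simp add: agree_def)
    have "a = c" "b = d" using ab \<rho>_eq[of "k + 2"] \<rho>_eq[of "k + 3"] by simp_all
    moreover have "\<tau> k = a" "\<tau> (k + 1) = b" using \<tau>_eq[of k] \<tau>_eq[of "k + 1"] by simp_all
    moreover have "agree k \<sigma> \<tau>" using \<rho>_eq \<tau>_eq by (simp add: agree_def)
    moreover have "R w \<sigma> (\<sigma> k) (\<sigma> (k + 1)) c d"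
      using R depR[of "\<sigma>(k + 2 := c, k + 3 := d)" \<sigma>] by simp
    ultimately show ?thesis using v6 by simp
  qed
  have body_complete: "\<exists>\<tau> q. ((\<sigma>, p), (\<tau>, q)) \<in> exec (crel w cap) ?B \<and> \<tau> k = c \<and> \<tau> (k + 1) = d"
    if v: "valid w cap (\<sigma>, p)" and R: "R w \<sigma> (\<sigma> k) (\<sigma> (k + 1)) c d" for w cap \<sigma> p c d
  proof -
    have "c \<le> length w" "d \<le> length w" using boundR[OF R] by auto
    then have cd: "c < cap" "d < cap" using v by auto
    note v1 = valid_upd[OF v cd(1), of "k + 2"]
    note v2 = valid_upd[OF v1 cd(2), of "k + 3"]
    have "R w (\<sigma>(k + 2 := c, k + 3 := d)) (\<sigma> k) (\<sigma> (k + 1)) c d"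
      using R depR[of "\<sigma>(k + 2 := c, k + 3 := d)" \<sigma>] by simp
    then obtain \<rho> r where r: "((\<sigma>(k + 2 := c, k + 3 := d), p), (\<rho>, r)) \<in> exec (crel w cap) PR"
      "agree (k + 4) (\<sigma>(k + 2 := c, k + 3 := d)) \<rho>" and v3: "valid w cap (\<rho>, r)"
      using testsD2[OF PR v2] by auto
    note v4 = valid_upd[OF v3 cd(1), of k]
    note v5 = valid_upd[OF v4 cd(2), of "k + 1"]
    have "\<rho> i = (\<sigma>(k + 2 := c, k + 3 := d)) i" if "i < k + 4" for i
      using r(2) that by (simp add: agree_def)
    from this[of "k + 2"] this[of "k + 3"] have "\<rho> (k + 2) = c" "\<rho> (k + 3) = d" by simp_all
    then have C: "C w (\<rho>(k := c, k + 1 := d))" by (simp add: C_def)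
    obtain \<tau> q
      where t: "((\<rho>(k := c, k + 1 := d), r), (\<tau>, q)) \<in> exec (crel w cap) PC"
      "agree (k + 4) (\<rho>(k := c, k + 1 := d)) \<tau>" "valid w cap (\<tau>, q)"
      by (rule testsD2[OF PC, OF v5, OF C])
    have "((\<sigma>, p), (\<tau>, q)) \<in> exec (crel w cap) ?B"
      unfolding exec.simps(2)
      by (rule relcompI[OF guess_in[OF v cd(1)]], rule relcompI[OF guess_in[OF v1 cd(2)]],
        rule relcompI[OF r(1)], rule relcompI[OF guess_in[OF v3 cd(1)]],
        rule relcompI[OF guess_in[OF v4 cd(2)]], rule t(1))
    moreover have "\<tau> i = (\<rho>(k := c, k + 1 := d)) i" if "i < k + 4" for i
      using t(2) that by (simp add: agree_def)
    from this[of k] this[of "k + 1"] have "\<tau> k = c" "\<tau> (k + 1) = d" by simp_all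
    ultimately show ?thesis by blast
  qed
  have star_sound: "agree k \<sigma> (fst s) \<and> path (R w \<sigma>) (\<sigma> k) (\<sigma> (k + 1)) (fst s k) (fst s (k + 1)) \<and> valid w cap s"
    if v: "valid w cap (\<sigma>, p)" and "((\<sigma>, p), s) \<in> (exec (crel w cap) ?B)\<^sup>*" for w cap \<sigma> p s
    using that(2)
  proof (induction rule: rtrancl_induct)
    case base
    then show ?case using v by simp
  next
    case (step y z)
    obtain \<tau> q \<rho> r where yz: "y = (\<tau>, q)" "z = (\<rho>, r)" by (cases y, cases z)
    from step.IH have IH: "agree k \<sigma> \<tau>" "path (R w \<sigma>) (\<sigma> k) (\<sigma> (k + 1)) (\<tau> k) (\<tau> (k + 1))"
      "valid w cap (\<tau>, q)" unfolding yz by simp_all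
    from body_sound[OF IH(3) step(2)[unfolded yz]] have
      1: "agree k \<tau> \<rho>" "R w \<tau> (\<tau> k) (\<tau> (k + 1)) (\<rho> k) (\<rho> (k + 1))" "valid w cap (\<rho>, r)" by simp_all
    have "R w \<sigma> (\<tau> k) (\<tau> (k + 1)) (\<rho> k) (\<rho> (k + 1))" using 1(2) depR[OF IH(1)] by simp
    then have "path (R w \<sigma>) (\<sigma> k) (\<sigma> (k + 1)) (\<rho> k) (\<rho> (k + 1))"
      by (intro rtranclp.rtrancl_into_rtrancl[OF IH(2)]) simp
    then show ?case using 1 agree_trans[OF IH(1) 1(1)] unfolding yz by simp
  qed
  have star_complete: "\<exists>\<tau> q. ((\<sigma>, p), (\<tau>, q)) \<in> (exec (crel w cap) ?B)\<^sup>* \<and> \<tau> k = fst y \<and> \<tau> (k + 1) = snd y"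
    if v: "valid w cap (\<sigma>, p)" and "(\<lambda>(a, b) (c, d). R w \<sigma> a b c d)\<^sup>*\<^sup>* (\<sigma> k, \<sigma> (k + 1)) y" for w cap \<sigma> p y
    using that(2)
  proof (induction rule: rtranclp_induct)
    case base
    then show ?case by (intro exI[of _ \<sigma>] exI[of _ p]) simp
  next
    case (step y z)
    then obtain \<tau> q where t: "((\<sigma>, p), (\<tau>, q)) \<in> (exec (crel w cap) ?B)\<^sup>*" "\<tau> k = fst y" "\<tau> (k + 1) = snd y"
      by blast
    from star_sound[OF v t(1)] have s: "agree k \<sigma> \<tau>" "valid w cap (\<tau>, q)" by simp_all
    have "R w \<tau> (\<tau> k) (\<tau> (k + 1)) (fst z) (snd z)"
      using step(2) t(2,3) depR[OF s(1)] by (simp add: case_prod_beta)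
    from body_complete[OF s(2) this] obtain \<rho> r where
      "((\<tau>, q), (\<rho>, r)) \<in> exec (crel w cap) ?B" "\<rho> k = fst z" "\<rho> (k + 1) = snd z" by blast
    with rtrancl_into_rtrancl[OF t(1) this(1)] show ?case by blast
  qed
  let ?P = "Seq (guess k) (Seq (guess (k + 1)) (Seq PS (Seq (Star ?B) PE)))"
  have "tests k ?P (\<lambda>w \<sigma>. \<exists>a b c d. S w \<sigma> a b \<and> path (R w \<sigma>) a b c d \<and> E w \<sigma> c d)"
  proof (rule testsI)
    fix w :: "'a list" and cap \<sigma> p \<tau> q
    assume v: "valid w cap (\<sigma>, p)" and "((\<sigma>, p), (\<tau>, q)) \<in> exec (crel w cap) ?P"
    then obtain a where a: "a < cap" "((\<sigma>(k := a), p), (\<tau>, q)) \<in>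
        exec (crel w cap) (Seq (guess (k + 1)) (Seq PS (Seq (Star ?B) PE)))"
      by (subst (asm) exec.simps(2)) (auto simp only: exec_guess_comp[OF v])
    note v1 = valid_upd[OF v a(1), of k]
    from a(2) obtain b where b: "b < cap" "((\<sigma>(k := a, k + 1 := b), p), (\<tau>, q)) \<in>
        exec (crel w cap) (Seq PS (Seq (Star ?B) PE))"
      by (subst (asm) exec.simps(2)) (auto simp only: exec_guess_comp[OF v1])
    note v2 = valid_upd[OF v1 b(1), of "k + 1"]
    from b(2) obtain s0 s where s0: "((\<sigma>(k := a, k + 1 := b), p), s0) \<in> exec (crel w cap) PS"
      "(s0, s) \<in> (exec (crel w cap) ?B)\<^sup>*" "(s, (\<tau>, q)) \<in> exec (crel w cap) PE"
      unfolding exec.simps(2)[of _ PS] exec.simps(2)[of _ "Star _"] exec.simps(4)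
      by (elim relcompEpair)
    obtain \<rho> r where "s0 = (\<rho>, r)" by (cases s0)
    note 1 = s0[unfolded this]
    from testsD1[OF PS v2 1(1)] have S: "S w (\<sigma>(k := a, k + 1 := b)) a b"
      and \<rho>: "agree (k + 2) (\<sigma>(k := a, k + 1 := b)) \<rho>" "valid w cap (\<rho>, r)" by simp_all
    have \<rho>_eq: "\<rho> i = (\<sigma>(k := a, k + 1 := b)) i" if "i < k + 2" for i
      using \<rho>(1) that by (simp add: agree_def)
    have \<sigma>\<rho>: "agree k \<sigma> \<rho>" using \<rho>_eq by (simp add: agree_def)
    obtain \<upsilon> u where s: "s = (\<upsilon>, u)" by (cases s)
    from star_sound[OF \<rho>(2) 1(2)] have \<upsilon>: "agree k \<rho> \<upsilon>" "valid w cap (\<upsilon>, u)"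
      "path (R w \<rho>) (\<rho> k) (\<rho> (k + 1)) (\<upsilon> k) (\<upsilon> (k + 1))" unfolding s by simp_all
    from testsD1[OF PE \<upsilon>(2) 1(3)[unfolded s]] have E: "E w \<upsilon> (\<upsilon> k) (\<upsilon> (k + 1))" "agree (k + 2) \<upsilon> \<tau>"
      by simp_all
    have \<sigma>\<upsilon>: "agree k \<sigma> \<upsilon>" by (rule agree_trans[OF \<sigma>\<rho> \<upsilon>(1)])
    have "R w \<rho> = R w \<sigma>" using depR[OF \<sigma>\<rho>] by (intro ext) simp
    moreover have "\<rho> k = a" "\<rho> (k + 1) = b" using \<rho>_eq[of k] \<rho>_eq[of "k + 1"] by simp_all
    ultimately have "path (R w \<sigma>) a b (\<upsilon> k) (\<upsilon> (k + 1))" using \<upsilon>(3) by simp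
    moreover have "S w \<sigma> a b" using S depS[of "\<sigma>(k := a, k + 1 := b)" \<sigma>] by simp
    moreover have "E w \<sigma> (\<upsilon> k) (\<upsilon> (k + 1))" using E(1) depE[OF \<sigma>\<upsilon>] by simp
    moreover have "agree k \<sigma> \<tau>" using agree_trans[OF \<sigma>\<upsilon> agree_mono[OF E(2)]] by simp
    ultimately show "(\<exists>a b c d. S w \<sigma> a b \<and> path (R w \<sigma>) a b c d \<and> E w \<sigma> c d) \<and> agree k \<sigma> \<tau>"
      by blast
  next
    fix w :: "'a list" and cap \<sigma> p
    assume v: "valid w cap (\<sigma>, p)"
      and "\<exists>a b c d. S w \<sigma> a b \<and> path (R w \<sigma>) a b c d \<and> E w \<sigma> c d"
    then obtain a b c d where *: "S w \<sigma> a b" "path (R w \<sigma>) a b c d" "E w \<sigma> c d" by blast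
    have "a \<le> length w" "b \<le> length w" using boundS[OF *(1)] by auto
    then have ab: "a < cap" "b < cap" using v by auto
    note v1 = valid_upd[OF v ab(1), of k]
    note v2 = valid_upd[OF v1 ab(2), of "k + 1"]
    have "S w (\<sigma>(k := a, k + 1 := b)) a b"
      using *(1) depS[of "\<sigma>(k := a, k + 1 := b)" \<sigma>] by simp
    then obtain \<rho> r where 1: "((\<sigma>(k := a, k + 1 := b), p), (\<rho>, r)) \<in> exec (crel w cap) PS"
      "agree (k + 2) (\<sigma>(k := a, k + 1 := b)) \<rho>" and v3: "valid w cap (\<rho>, r)"
      using testsD2[OF PS v2] by auto
    have \<rho>_eq: "\<rho> i = (\<sigma>(k := a, k + 1 := b)) i" if "i < k + 2" for i
      using 1(2) that by (simp add: agree_def)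
    have \<sigma>\<rho>: "agree k \<sigma> \<rho>" using \<rho>_eq by (simp add: agree_def)
    have "R w \<sigma> = R w \<rho>" using depR[OF \<sigma>\<rho>] by (intro ext) simp
    moreover have "\<rho> k = a" "\<rho> (k + 1) = b" using \<rho>_eq[of k] \<rho>_eq[of "k + 1"] by simp_all
    ultimately have "path (R w \<rho>) (\<rho> k) (\<rho> (k + 1)) c d" using *(2) by simp
    from star_complete[OF v3 this] obtain \<upsilon> u where
      2: "((\<rho>, r), (\<upsilon>, u)) \<in> (exec (crel w cap) ?B)\<^sup>*" "\<upsilon> k = c" "\<upsilon> (k + 1) = d" by auto
    from star_sound[OF v3 2(1)] have \<upsilon>: "agree k \<rho> \<upsilon>" "valid w cap (\<upsilon>, u)" by simp_all
    have "E w \<upsilon> (\<upsilon> k) (\<upsilon> (k + 1))" using *(3) depE[OF agree_trans[OF \<sigma>\<rho> \<upsilon>(1)]] 2(2,3) by simp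
    then obtain \<tau> q where 3: "((\<upsilon>, u), (\<tau>, q)) \<in> exec (crel w cap) PE"
      using testsD2[OF PE \<upsilon>(2)] by blast
    have "((\<sigma>, p), (\<tau>, q)) \<in> exec (crel w cap) ?P"
      unfolding exec.simps(2)[of _ "guess k" "Seq (guess (k + 1)) (Seq PS (Seq (Star ?B) PE))"]
        exec.simps(2)[of _ "guess (k + 1)" "Seq PS (Seq (Star ?B) PE)"]
        exec.simps(2)[of _ PS] exec.simps(2)[of _ "Star _"] exec.simps(4)
      by (rule relcompI[OF guess_in[OF v ab(1)]], rule relcompI[OF guess_in[OF v1 ab(2)]],
        rule relcompI[OF 1(1)], rule relcompI[OF 2(1)], rule 3)
    then show "\<exists>\<tau> q. ((\<sigma>, p), (\<tau>, q)) \<in> exec (crel w cap) ?P" by blast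
  qed
  moreover have "(\<exists>a b c d. S w \<sigma> a b \<and> path (R w \<sigma>) a b c d \<and> E w \<sigma> c d) =
      (\<exists>a b c d. S w \<tau> a b \<and> path (R w \<tau>) a b c d \<and> E w \<tau> c d)" if "agree k \<sigma> \<tau>" for w \<sigma> \<tau>
  proof -
    have "R w \<sigma> = R w \<tau>" "S w \<sigma> = S w \<tau>" "E w \<sigma> = E w \<tau>"
      using depR[OF that] depS[OF that] depE[OF that] by (intro ext; simp)+
    then show ?thesis by simp
  qed
  ultimately show ?thesis unfolding ntest_def by blast
qed

text \<open>Tests as such are not closed under negation by any construction on programs. Carrying a
  second test for the negation makes Boolean connectives and both quantifiers available by
  duality.\<close>

definition chk :: "nat \<Rightarrow> ('a list \<Rightarrow> (nat \<Rightarrow> nat) \<Rightarrow> bool) \<Rightarrow> bool" where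
  "chk k T \<longleftrightarrow> ntest k T \<and> ntest k (\<lambda>w \<sigma>. \<not> T w \<sigma>)"

lemma chk_ntest: "chk k T \<Longrightarrow> ntest k T"
  by (simp add: chk_def)

lemma chk_cong: "chk k T \<Longrightarrow> (\<And>w \<sigma>. T w \<sigma> = T' w \<sigma>) \<Longrightarrow> chk k T'"
  unfolding chk_def by (auto intro: ntest_cong)

lemma chk_not: "chk k T \<Longrightarrow> chk k (\<lambda>w \<sigma>. \<not> T w \<sigma>)"
  by (simp add: chk_def)

lemma chk_conj: "chk k T \<Longrightarrow> chk k U \<Longrightarrow> chk k (\<lambda>w \<sigma>. T w \<sigma> \<and> U w \<sigma>)"
  unfolding chk_def de_Morgan_conj by (intro conjI ntest_conj ntest_disj) simp_all

lemma chk_disj: "chk k T \<Longrightarrow> chk k U \<Longrightarrow> chk k (\<lambda>w \<sigma>. T w \<sigma> \<or> U w \<sigma>)"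
  unfolding chk_def de_Morgan_disj by (intro conjI ntest_conj ntest_disj) simp_all

lemma chk_imp: "chk k T \<Longrightarrow> chk k U \<Longrightarrow> chk k (\<lambda>w \<sigma>. T w \<sigma> \<longrightarrow> U w \<sigma>)"
  unfolding imp_conv_disj by (intro chk_disj chk_not)

lemma chk_less: "i < k \<Longrightarrow> j < k \<Longrightarrow> chk k (\<lambda>w \<sigma>. \<sigma> i < \<sigma> j)"
  by (simp add: chk_def ntest_less ntest_le not_less)

lemma chk_le: "i < k \<Longrightarrow> j < k \<Longrightarrow> chk k (\<lambda>w \<sigma>. \<sigma> i \<le> \<sigma> j)"
  by (simp add: chk_def ntest_less ntest_le not_le)

lemma chk_eq: "i < k \<Longrightarrow> j < k \<Longrightarrow> chk k (\<lambda>w \<sigma>. \<sigma> i = \<sigma> j)"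
  using chk_conj[OF chk_le[of i k j] chk_le[of j k i]] by (simp add: eq_iff)

lemma chk_zero: "i < k \<Longrightarrow> chk k (\<lambda>w \<sigma>. \<sigma> i = 0)"
  using ntest_zero[of i k] ntest_pred[OF ntest_True, of i k] by (simp add: chk_def)

text \<open>The numbers are compared after decreasing \<open>i\<close>. The case
  \<open>i = j\<close> is separate, as the decrease would then change both sides.\<close>

lemma chk_Suc: "i < k \<Longrightarrow> j < k \<Longrightarrow> chk k (\<lambda>(w :: 'a list) \<sigma>. \<sigma> i = Suc (\<sigma> j))"
proof (cases "i = j")
  case True
  then show ?thesis by (simp add: chk_def ntest_True ntest_False)
next
  case False
  assume "i < k" "j < k"
  then have eq: "ntest k (\<lambda>(w :: 'a list) \<sigma>. \<sigma> i = \<sigma> j)"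
      "ntest k (\<lambda>(w :: 'a list) \<sigma>. \<sigma> i \<noteq> \<sigma> j)"
    by (auto intro!: chk_ntest chk_not chk_eq)
  have "ntest k (\<lambda>(w :: 'a list) \<sigma>. \<sigma> i = Suc (\<sigma> j))"
    by (rule ntest_cong[OF ntest_pred[OF eq(1) \<open>i < k\<close>]]) (use False in auto)
  moreover have "ntest k (\<lambda>(w :: 'a list) \<sigma>. \<sigma> i \<noteq> Suc (\<sigma> j))"
    by (rule ntest_cong[OF ntest_disj[OF ntest_zero[OF \<open>i < k\<close>] ntest_pred[OF eq(2) \<open>i < k\<close>]]])
      (use False in auto)
  ultimately show ?thesis by (simp add: chk_def)
qed

text \<open>Being different from \<open>a\<close> means being equal to one of finitely many other
  cells.\<close>

lemma ntest_not_cell: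
  fixes a :: "'a::finite cell"
  assumes "\<And>b. ntest k (\<lambda>w \<sigma>. f w \<sigma> = (b :: 'a cell))"
  shows "ntest k (\<lambda>w \<sigma>. f w \<sigma> \<noteq> a)"
proof (rule ntest_cong)
  show "ntest k (\<lambda>w \<sigma>. \<exists>b\<in>UNIV - {a}. f w \<sigma> = b)"
    using finite_cell assms by (intro ntest_Bex) auto
qed auto

lemma chk_cell:
  "i < k \<Longrightarrow> chk k (\<lambda>w \<sigma>. input_cell w (\<sigma> i) = (a :: 'a::finite cell))"
  unfolding chk_def by (intro conjI ntest_not_cell ntest_cell)

lemma chk_cell_Suc:
  "i < k \<Longrightarrow> chk k (\<lambda>w \<sigma>. input_cell w (Suc (\<sigma> i)) = (a :: 'a::finite cell))"
  unfolding chk_def by (intro conjI ntest_not_cell ntest_cell_Suc)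

text \<open>Unlike input cells, positions in the word count from 0.\<close>

definition letter_at :: "'a \<Rightarrow> 'a list \<Rightarrow> nat \<Rightarrow> bool" where
  "letter_at a w p \<longleftrightarrow> p < length w \<and> w ! p = a"

lemma chk_letter_at: "i < k \<Longrightarrow> chk k (\<lambda>w \<sigma>. letter_at (a :: 'a::finite) w (\<sigma> i))"
  by (rule chk_cong[OF chk_cell_Suc[of i k "Letter a"]]) (auto simp: letter_at_def input_cell_def)

lemma chk_le_length: "i < k \<Longrightarrow> chk k (\<lambda>(w :: 'a::finite list) \<sigma>. \<sigma> i \<le> length w)"
  by (rule chk_cong[OF chk_not[OF chk_cell[of i k RightEnd]]]) (auto simp: input_cell_RightEnd)

lemma chk_less_length: "i < k \<Longrightarrow> chk k (\<lambda>(w :: 'a::finite list) \<sigma>. \<sigma> i < length w)"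
  by (rule chk_cong[OF chk_not[OF chk_cell_Suc[of i k RightEnd]]]) (auto simp: input_cell_RightEnd)

lemma ntest_ex:
  fixes Q :: "'a::finite list \<Rightarrow> (nat \<Rightarrow> nat) \<Rightarrow> nat \<Rightarrow> bool"
  assumes "ntest (Suc k) (\<lambda>w \<sigma>. Q w \<sigma> (\<sigma> k))"
    and dep: "\<And>w \<sigma> \<tau> v. agree k \<sigma> \<tau> \<Longrightarrow> Q w \<sigma> v = Q w \<tau> v"
  shows "ntest k (\<lambda>w \<sigma>. \<exists>v\<le>length w. Q w \<sigma> v)"
  by (rule ntest_project) (use assms in \<open>auto intro!: ntest_conj chk_ntest[OF chk_le_length]\<close>)

lemma chk_ex:
  fixes Q :: "'a::finite list \<Rightarrow> (nat \<Rightarrow> nat) \<Rightarrow> nat \<Rightarrow> bool"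
  assumes "chk (Suc k) (\<lambda>w \<sigma>. Q w \<sigma> (\<sigma> k))"
    and dep: "\<And>w \<sigma> \<tau> v. agree k \<sigma> \<tau> \<Longrightarrow> Q w \<sigma> v = Q w \<tau> v"
  shows "chk k (\<lambda>w \<sigma>. \<exists>v\<le>length w. Q w \<sigma> v)"
  using ntest_ex[of k Q] ntest_all[of k "\<lambda>w \<sigma> v. \<not> Q w \<sigma> v"] assms by (simp add: chk_def)

lemma chk_all:
  fixes Q :: "'a::finite list \<Rightarrow> (nat \<Rightarrow> nat) \<Rightarrow> nat \<Rightarrow> bool"
  assumes "chk (Suc k) (\<lambda>w \<sigma>. Q w \<sigma> (\<sigma> k))"
    and dep: "\<And>w \<sigma> \<tau> v. agree k \<sigma> \<tau> \<Longrightarrow> Q w \<sigma> v = Q w \<tau> v"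
  shows "chk k (\<lambda>w \<sigma>. \<forall>v\<le>length w. Q w \<sigma> v)"
  using ntest_ex[of k "\<lambda>w \<sigma> v. \<not> Q w \<sigma> v"] ntest_all[of k Q] assms by (simp add: chk_def)

text \<open>A loop over the positions of the word is a path whose first component is the position.\<close>

lemma ntest_fold:
  fixes f :: "'a::finite list \<Rightarrow> (nat \<Rightarrow> nat) \<Rightarrow> nat \<Rightarrow> nat \<Rightarrow> nat"
  assumes f: "ntest (k + 4) (\<lambda>w \<sigma>. \<sigma> (k + 3) = f w \<sigma> (\<sigma> k) (\<sigma> (k + 1)))"
    and G: "ntest (k + 2) (\<lambda>w \<sigma>. G w \<sigma> (\<sigma> (k + 1)))"
    and depf: "\<And>w \<sigma> \<tau> x z. agree k \<sigma> \<tau> \<Longrightarrow> f w \<sigma> x z = f w \<tau> x z"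
    and depG: "\<And>w \<sigma> \<tau> z. agree k \<sigma> \<tau> \<Longrightarrow> G w \<sigma> z = G w \<tau> z"
    and bound: "\<And>w \<sigma> x. x \<le> length w \<Longrightarrow> fold (f w \<sigma>) [0..<x] 0 \<le> length w"
  shows "ntest k (\<lambda>w \<sigma>. G w \<sigma> (fold (f w \<sigma>) [0..<length w] 0))"
proof -
  define R where "R w \<sigma> x z x' z' \<longleftrightarrow> x < length w \<and> x' = Suc x \<and> z' \<le> length w \<and> z' = f w \<sigma> x z"
    for w :: "'a list" and \<sigma> and x z x' z' :: nat
  have "ntest k (\<lambda>w \<sigma>. \<exists>a b c d. (a = 0 \<and> b = 0) \<and> path (R w \<sigma>) a b c d \<and>
      (length w \<le> c \<and> G w \<sigma> d))"
  proof (rule ntest_path)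
    show "ntest (k + 2) (\<lambda>(w :: 'a list) \<sigma>. \<sigma> k = 0 \<and> \<sigma> (k + 1) = 0)"
      by (intro chk_ntest chk_conj chk_zero) simp_all
    show "ntest (k + 4) (\<lambda>w \<sigma>. R w \<sigma> (\<sigma> k) (\<sigma> (k + 1)) (\<sigma> (k + 2)) (\<sigma> (k + 3)))"
      unfolding R_def
      by (intro ntest_conj f chk_ntest[OF chk_less_length] chk_ntest[OF chk_Suc]
        chk_ntest[OF chk_le_length]) simp_all
    have "ntest (k + 2) (\<lambda>(w :: 'a list) \<sigma>. \<not> \<sigma> k < length w)"
      by (intro chk_ntest chk_not chk_less_length) simp
    then show "ntest (k + 2) (\<lambda>w \<sigma>. length w \<le> \<sigma> k \<and> G w \<sigma> (\<sigma> (k + 1)))"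
      by (intro ntest_conj G) (simp add: not_less)
  qed (auto simp: R_def depf depG)
  then show ?thesis
  proof (rule ntest_cong)
    fix w \<sigma>
    let ?F = "\<lambda>x. fold (f w \<sigma>) [0..<x] 0"
    have "snd y = ?F (fst y) \<and> fst y \<le> length w"
      if "(\<lambda>(a, b) (c, d). R w \<sigma> a b c d)\<^sup>*\<^sup>* (0, 0) y" for y
      using that by (induction rule: rtranclp_induct) (auto simp: R_def)
    then have sound: "d = ?F c \<and> c \<le> length w" if "path (R w \<sigma>) 0 0 c d" for c d
      using that by fastforce
    have complete: "path (R w \<sigma>) 0 0 x (?F x)" if "x \<le> length w" for x
      using that
    proof (induction x)
      case (Suc x)
      have step: "R w \<sigma> x (?F x) (Suc x) (?F (Suc x))"
        using bound[of "Suc x" w \<sigma>] Suc.prems by (simp add: R_def)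
      have "path (R w \<sigma>) 0 0 x (?F x)" using Suc by simp
      then show ?case by (rule rtranclp.rtrancl_into_rtrancl) (simp only: prod.case step)
    qed simp
    show "(\<exists>a b c d. (a = 0 \<and> b = 0) \<and> path (R w \<sigma>) a b c d \<and> (length w \<le> c \<and> G w \<sigma> d)) =
        G w \<sigma> (?F (length w))" (is "?L = ?R")
    proof
      assume ?L
      then obtain c d where "path (R w \<sigma>) 0 0 c d" "length w \<le> c" "G w \<sigma> d" by blast
      with sound[of c d] show ?R by simp
    next
      assume ?R
      with complete[OF order_refl] show ?L by blast
    qed
  qed
qed

text \<open>A fold is a deterministic path with a unique final value, so the negation is tested
  along the same path with the opposite condition at its end. In \<open>f\<close>, counters
  \<open>k\<close>, \<open>k + 1\<close> and \<open>k + 3\<close> are the position, the accumulator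
  and its next value, as laid out by \<open>ntest_path\<close>.\<close>

lemma chk_fold:
  fixes f :: "'a::finite list \<Rightarrow> (nat \<Rightarrow> nat) \<Rightarrow> nat \<Rightarrow> nat \<Rightarrow> nat"
  assumes f: "chk (k + 4) (\<lambda>w \<sigma>. \<sigma> (k + 3) = f w \<sigma> (\<sigma> k) (\<sigma> (k + 1)))"
    and dep: "\<And>w \<sigma> \<tau> x z. agree k \<sigma> \<tau> \<Longrightarrow> f w \<sigma> x z = f w \<tau> x z"
    and bound: "\<And>w \<sigma> x. x \<le> length w \<Longrightarrow> fold (f w \<sigma>) [0..<x] 0 \<le> length w"
    and i: "i < k"
  shows "chk k (\<lambda>w \<sigma>. fold (f w \<sigma>) [0..<length w] 0 = \<sigma> i)"
proof -
  have 1: "chk (k + 2) (\<lambda>(w :: 'a list) \<sigma>. \<sigma> (k + 1) = \<sigma> i)" using i by (intro chk_eq) simp_all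
  then have 2: "chk (k + 2) (\<lambda>(w :: 'a list) \<sigma>. \<sigma> (k + 1) \<noteq> \<sigma> i)" by (rule chk_not)
  have "ntest k (\<lambda>w \<sigma>. fold (f w \<sigma>) [0..<length w] 0 = \<sigma> i)"
    by (rule ntest_fold[where G = "\<lambda>w \<sigma> z. z = \<sigma> i"])
      (use chk_ntest[OF f] chk_ntest[OF 1] dep bound i in \<open>simp_all add: agree_def\<close>)
  moreover have "ntest k (\<lambda>w \<sigma>. fold (f w \<sigma>) [0..<length w] 0 \<noteq> \<sigma> i)"
    by (rule ntest_fold[where G = "\<lambda>w \<sigma> z. z \<noteq> \<sigma> i"])
      (use chk_ntest[OF f] chk_ntest[OF 2] dep bound i in \<open>simp_all add: agree_def\<close>)
  ultimately show ?thesis by (simp add: chk_def)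
qed

section \<open>Counting, doubling and scanning\<close>

lemma fold_count:
  "fold (\<lambda>x z. if P x then Suc z else z) [0..<n] 0 = card {x. x < n \<and> P x}"
proof (induction n)
  case (Suc n)
  have "{x. x < Suc n \<and> P x} = (if P n then insert n {x. x < n \<and> P x} else {x. x < n \<and> P x})"
    by (auto simp: less_Suc_eq)
  then show ?case using Suc by simp
qed simp

lemma chk_card:
  fixes Q :: "'a::finite list \<Rightarrow> (nat \<Rightarrow> nat) \<Rightarrow> nat \<Rightarrow> bool"
  assumes Q: "chk (k + 4) (\<lambda>w \<sigma>. Q w \<sigma> (\<sigma> k))"
    and dep: "\<And>w \<sigma> \<tau> v. agree k \<sigma> \<tau> \<Longrightarrow> Q w \<sigma> v = Q w \<tau> v"
    and i: "i < k"
  shows "chk k (\<lambda>w \<sigma>. card {v. v < length w \<and> Q w \<sigma> v} = \<sigma> i)"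
proof -
  have "chk (k + 4) (\<lambda>(w :: 'a list) \<sigma>. (Q w \<sigma> (\<sigma> k) \<and> \<sigma> (k + 3) = Suc (\<sigma> (k + 1))) \<or>
      (\<not> Q w \<sigma> (\<sigma> k) \<and> \<sigma> (k + 3) = \<sigma> (k + 1)))"
    by (intro chk_disj chk_conj Q chk_not chk_Suc chk_eq) simp_all
  then have "chk (k + 4) (\<lambda>w \<sigma>. \<sigma> (k + 3) = (if Q w \<sigma> (\<sigma> k) then Suc (\<sigma> (k + 1)) else \<sigma> (k + 1)))"
    by (rule chk_cong) auto
  moreover have "card {v. v < x \<and> Q w \<sigma> v} \<le> length w" if "x \<le> length w" for x w \<sigma>
  proof -
    have "card {v. v < x \<and> Q w \<sigma> v} \<le> card {..<x}" by (intro card_mono) auto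
    then show ?thesis using that by simp
  qed
  ultimately show ?thesis
    using chk_fold[of k "\<lambda>w \<sigma> x z. if Q w \<sigma> x then Suc z else z" i] dep i
    by (simp add: fold_count)
qed

lemma NL_by_ntest:
  fixes L :: "'a::finite list set"
  assumes "ntest 0 (\<lambda>w \<sigma>. w \<in> L)"
  shows "L \<in> NL"
proof -
  obtain P :: "'a catom prog" where P: "tests 0 P (\<lambda>w \<sigma>. w \<in> L)"
    using assms unfolding ntest_def by blast
  show ?thesis
  proof (rule NL_by_counters)
    fix w :: "'a list" and cap p :: nat and \<sigma> :: "nat \<Rightarrow> nat"
    assume "length w + 2 \<le> cap" "\<And>i. \<sigma> i < cap" "p \<le> Suc (length w)"
    then have v: "valid w cap (\<sigma>, p)" by simp
    show "(\<exists>s. ((\<sigma>, p), s) \<in> exec (crel w cap) P) = (w \<in> L)"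
      using testsD1[OF P v] testsD2[OF P v] by (metis surj_pair)
  qed
qed

lemma chk_False: "chk k (\<lambda>w \<sigma>. False)"
  by (simp add: chk_def ntest_True ntest_False)

lemma chk_bex:
  "finite A \<Longrightarrow> (\<And>a. a \<in> A \<Longrightarrow> chk k (T a)) \<Longrightarrow> chk k (\<lambda>w \<sigma>. \<exists>a\<in>A. T a w \<sigma>)"
  by (induction A rule: finite_induct) (auto simp: chk_False intro: chk_disj)

lemma chk_length: "i < k \<Longrightarrow> chk k (\<lambda>(w :: 'a::finite list) \<sigma>. \<sigma> i = length w)"
  by (rule chk_cong[OF chk_conj[OF chk_le_length[of i k] chk_not[OF chk_less_length[of i k]]]]) auto

lemma chk_min_length:
  "i < k \<Longrightarrow> j < k \<Longrightarrow> chk k (\<lambda>(w :: 'a::finite list) \<sigma>. \<sigma> j = min (length w) (\<sigma> i))"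
  by (rule chk_cong[OF chk_disj[OF chk_conj[OF chk_le_length[of i k] chk_eq[of j k i]]
        chk_conj[OF chk_not[OF chk_le_length[of i k]] chk_length[of j k]]]]) auto

lemma chk_min_Suc:
  "i < k \<Longrightarrow> j < k \<Longrightarrow> chk k (\<lambda>(w :: 'a::finite list) \<sigma>. \<sigma> j = min (length w) (Suc (\<sigma> i)))"
  by (rule chk_cong[OF chk_disj[OF chk_conj[OF chk_less_length[of i k] chk_Suc[of j k i]]
        chk_conj[OF chk_not[OF chk_less_length[of i k]] chk_length[of j k]]]]) auto

text \<open>Doubling is expressed by counting: \<open>\<sigma> j\<close> is twice
  \<open>\<sigma> i\<close> iff the interval from \<open>\<sigma> i\<close> up to
  \<open>\<sigma> j\<close> has \<open>\<sigma> i\<close> elements. The bound on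
  \<open>\<sigma> j\<close> places this interval inside the word, where positions are
  counted.\<close>

lemma chk_double:
  assumes "i < k" "j < k"
  shows "chk k (\<lambda>(w :: 'a::finite list) \<sigma>. \<sigma> j \<le> length w \<and> \<sigma> j = 2 * \<sigma> i)"
proof (rule chk_cong)
  show "chk k (\<lambda>(w :: 'a list) \<sigma>. \<sigma> i \<le> \<sigma> j \<and> \<sigma> j \<le> length w \<and>
      card {v. v < length w \<and> \<sigma> i \<le> v \<and> v < \<sigma> j} = \<sigma> i)"
    using assms by (intro chk_conj chk_le chk_le_length chk_card chk_less) (auto simp: agree_def)
  show "(\<sigma> i \<le> \<sigma> j \<and> \<sigma> j \<le> length w \<and>
      card {v. v < length w \<and> \<sigma> i \<le> v \<and> v < \<sigma> j} = \<sigma> i) = (\<sigma> j \<le> length w \<and> \<sigma> j = 2 * \<sigma> i)"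
    for w :: "'a list" and \<sigma>
  proof (cases "\<sigma> j \<le> length w")
    case True
    then have "{v. v < length w \<and> \<sigma> i \<le> v \<and> v < \<sigma> j} = {\<sigma> i..<\<sigma> j}" by auto
    then have "card {v. v < length w \<and> \<sigma> i \<le> v \<and> v < \<sigma> j} = \<sigma> j - \<sigma> i"
      by (simp only: card_atLeastLessThan)
    then show ?thesis by linarith
  qed simp
qed

lemma chk_min_double:
  assumes "i < k" "j < k"
  shows "chk k (\<lambda>(w :: 'a::finite list) \<sigma>. \<sigma> j = min (length w) (2 * \<sigma> i))"
    and "chk k (\<lambda>(w :: 'a::finite list) \<sigma>. \<sigma> j = min (length w) (Suc (2 * \<sigma> i)))"
proof -
  have 1: "chk k (\<lambda>(w :: 'a list) \<sigma>. \<exists>t\<le>length w. (t \<le> length w \<and> t = 2 * \<sigma> i) \<and> \<sigma> j = t)"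
    using assms by (intro chk_ex chk_conj[OF chk_double] chk_eq) (auto simp: agree_def)
  \<comment> \<open>This tells whether the double still fits; if it does not, the truncated value is
    the length.\<close>
  have 2: "chk k (\<lambda>(w :: 'a list) \<sigma>. \<exists>t\<le>length w. t \<le> length w \<and> t = 2 * \<sigma> i)"
    using assms by (intro chk_ex chk_double) (auto simp: agree_def)
  have 3: "chk k (\<lambda>(w :: 'a list) \<sigma>.
      \<exists>t\<le>length w. (t \<le> length w \<and> t = 2 * \<sigma> i) \<and> \<sigma> j = min (length w) (Suc t))"
    using assms by (intro chk_ex chk_conj[OF chk_double] chk_min_Suc) (auto simp: agree_def)
  show "chk k (\<lambda>(w :: 'a list) \<sigma>. \<sigma> j = min (length w) (2 * \<sigma> i))"
    by (rule chk_cong[OF chk_disj[OF 1 chk_conj[OF chk_not[OF 2] chk_length[OF assms(2)]]]]) auto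
  show "chk k (\<lambda>(w :: 'a list) \<sigma>. \<sigma> j = min (length w) (Suc (2 * \<sigma> i)))"
    by (rule chk_cong[OF chk_disj[OF 3 chk_conj[OF chk_not[OF 2] chk_length[OF assms(2)]]]]) auto
qed

text \<open>Scanning a prefix of the word from left to right; numbers beyond the length of the word are
  cut off.\<close>

lemma chk_scan:
  fixes g :: "'a::finite \<Rightarrow> nat \<Rightarrow> nat"
  assumes step: "\<And>a. chk (k + 4) (\<lambda>(w :: 'a list) \<sigma>. \<sigma> (k + 3) = min (length w) (g a (\<sigma> (k + 1))))"
    and cut: "\<And>n a z. min n (g a (min n z)) = min n (g a z)"
    and "i < k" "j < k"
  shows "chk k (\<lambda>(w :: 'a list) \<sigma>. min (length w) (fold g (take (\<sigma> i) w) 0) = \<sigma> j)"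
proof -
  define f where "f w \<sigma> x z =
    (if x < length w \<and> x < \<sigma> i then min (length w) (g (w ! x) z) else z)"
    for w :: "'a list" and \<sigma> :: "nat \<Rightarrow> nat" and x z
  have f_iff: "z' = f w \<sigma> x z \<longleftrightarrow>
      (\<exists>a\<in>UNIV. letter_at a w x \<and> x < \<sigma> i \<and> z' = min (length w) (g a z)) \<or>
      \<not> (x < length w \<and> x < \<sigma> i) \<and> z' = z" for w \<sigma> x z z'
    by (auto simp: f_def letter_at_def)
  have "chk (k + 4) (\<lambda>w \<sigma>. \<sigma> (k + 3) = f w \<sigma> (\<sigma> k) (\<sigma> (k + 1)))"
    unfolding f_iff using \<open>i < k\<close>
    by (intro chk_disj chk_bex chk_conj chk_not chk_less chk_less_length chk_letter_at chk_eq step) auto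
  moreover have fold_f: "fold (f w \<sigma>) [0..<m] 0 = min (length w) (fold g (take (min m (\<sigma> i)) w) 0)"
    if "m \<le> length w" for w \<sigma> m
    using that
  proof (induction m)
    case (Suc m)
    show ?case
    proof (cases "m < \<sigma> i")
      case True
      then have "take (min (Suc m) (\<sigma> i)) w = take (min m (\<sigma> i)) w @ [w ! m]"
        using Suc.prems by (simp add: take_Suc_conv_app_nth min_absorb1)
      then show ?thesis using Suc True by (simp add: f_def cut)
    next
      case False
      then show ?thesis using Suc by (simp add: f_def min_absorb2)
    qed
  qed simp
  ultimately have "chk k (\<lambda>w \<sigma>. fold (f w \<sigma>) [0..<length w] 0 = \<sigma> j)"
    using assms(3,4) by (intro chk_fold) (auto simp: f_def agree_def)
  then show ?thesis
  proof (rule chk_cong)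
    show "(fold (f w \<sigma>) [0..<length w] 0 = \<sigma> j) = (min (length w) (fold g (take (\<sigma> i) w) 0) = \<sigma> j)"
      for w \<sigma>
      using fold_f[of "length w" w \<sigma>] by (simp add: min_def)
  qed
qed

section \<open>Reading Cayley tables\<close>

text \<open>The row, the column, and the value of the digits since the last separator, after a prefix of
  the input has been read.\<close>

definition row :: "letter list \<Rightarrow> nat" where
  "row u = fold (\<lambda>a z. case a of Semicolon \<Rightarrow> Suc z | _ \<Rightarrow> z) u 0"

definition column :: "letter list \<Rightarrow> nat" where
  "column u = fold (\<lambda>a z. case a of Semicolon \<Rightarrow> 0 | Comma \<Rightarrow> Suc z | _ \<Rightarrow> z) u 0"

definition pending :: "letter list \<Rightarrow> nat" where
  "pending u = fold (\<lambda>a z. case a of Zero \<Rightarrow> 2 * z | One \<Rightarrow> Suc (2 * z) | _ \<Rightarrow> 0) u 0"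

lemma scan_Nil [simp]: "row [] = 0" "column [] = 0" "pending [] = 0"
  by (simp_all add: row_def column_def pending_def)

lemma scan_snoc [simp]:
  "row (u @ [a]) = (case a of Semicolon \<Rightarrow> Suc (row u) | _ \<Rightarrow> row u)"
  "column (u @ [a]) = (case a of Semicolon \<Rightarrow> 0 | Comma \<Rightarrow> Suc (column u) | _ \<Rightarrow> column u)"
  "pending (u @ [a]) = (case a of Zero \<Rightarrow> 2 * pending u | One \<Rightarrow> Suc (2 * pending u) | _ \<Rightarrow> 0)"
  by (cases a; simp add: row_def column_def pending_def)+

lemma row_le_length: "row u \<le> length u"
  by (induction u rule: rev_induct) (auto split: letter.split)

lemma column_le_length: "column u \<le> length u"
  by (induction u rule: rev_induct) (auto split: letter.split)

lemma chk_row: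
  assumes "i < k" "j < k"
  shows "chk k (\<lambda>w \<sigma>. row (take (\<sigma> i) w) = \<sigma> j)"
proof (rule chk_cong)
  show "chk k (\<lambda>w \<sigma>. min (length w) (row (take (\<sigma> i) w)) = \<sigma> j)"
    unfolding row_def
  proof (rule chk_scan)
    show "chk (k + 4) (\<lambda>(w :: letter list) \<sigma>. \<sigma> (k + 3) =
      min (length w) (case a of Semicolon \<Rightarrow> Suc (\<sigma> (k + 1)) | _ \<Rightarrow> \<sigma> (k + 1)))" for a
      by (cases a) (simp_all add: chk_min_length chk_min_Suc)
    show "min n (case a of Semicolon \<Rightarrow> Suc (min n z) | _ \<Rightarrow> min n z) = min n (case a of Semicolon \<Rightarrow> Suc (z) | _ \<Rightarrow> z)" for n a z
      by (cases a) (simp_all add: min_def)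
  qed (use assms in simp_all)
  show "(min (length w) (row (take (\<sigma> i) w)) = \<sigma> j) = (row (take (\<sigma> i) w) = \<sigma> j)" for w \<sigma>
    by (metis row_le_length length_take min.absorb2 min.bounded_iff)
qed

lemma chk_column:
  assumes "i < k" "j < k"
  shows "chk k (\<lambda>w \<sigma>. column (take (\<sigma> i) w) = \<sigma> j)"
proof (rule chk_cong)
  show "chk k (\<lambda>w \<sigma>. min (length w) (column (take (\<sigma> i) w)) = \<sigma> j)"
    unfolding column_def
  proof (rule chk_scan)
    show "chk (k + 4) (\<lambda>(w :: letter list) \<sigma>. \<sigma> (k + 3) =
      min (length w) (case a of Semicolon \<Rightarrow> 0 | Comma \<Rightarrow> Suc (\<sigma> (k + 1)) | _ \<Rightarrow> \<sigma> (k + 1)))" for a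
      by (cases a) (simp_all add: chk_min_length chk_min_Suc chk_zero)
    show "min n (case a of Semicolon \<Rightarrow> 0 | Comma \<Rightarrow> Suc (min n z) | _ \<Rightarrow> min n z) = min n (case a of Semicolon \<Rightarrow> 0 | Comma \<Rightarrow> Suc (z) | _ \<Rightarrow> z)" for n a z
      by (cases a) (simp_all add: min_def)
  qed (use assms in simp_all)
  show "(min (length w) (column (take (\<sigma> i) w)) = \<sigma> j) = (column (take (\<sigma> i) w) = \<sigma> j)" for w \<sigma>
    by (metis column_le_length length_take min.absorb2 min.bounded_iff)
qed

text \<open>Row and column never exceed the length, so their truncation disappears. The value of a
  numeral can be exponential in its length, so here it stays; \<open>legal\<close> and
  \<open>entry\<close> compare the value only with numbers below the length.\<close>

lemma chk_pending:
  assumes "i < k" "j < k"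
  shows "chk k (\<lambda>w \<sigma>. min (length w) (pending (take (\<sigma> i) w)) = \<sigma> j)"
  unfolding pending_def
proof (rule chk_scan)
  show "chk (k + 4) (\<lambda>(w :: letter list) \<sigma>. \<sigma> (k + 3) =
    min (length w) (case a of Zero \<Rightarrow> 2 * \<sigma> (k + 1) | One \<Rightarrow> Suc (2 * \<sigma> (k + 1)) | _ \<Rightarrow> 0))" for a
    by (cases a) (simp_all add: chk_min_double chk_zero)
  show "min n (case a of Zero \<Rightarrow> 2 * min n z | One \<Rightarrow> Suc (2 * min n z) | _ \<Rightarrow> 0) =
    min n (case a of Zero \<Rightarrow> 2 * z | One \<Rightarrow> Suc (2 * z) | _ \<Rightarrow> 0)" for n a z
    by (cases a) (simp_all add: min_def)
qed (use assms in simp_all)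

text \<open>The condition on a letter \<open>a\<close> that follows the prefix \<open>u\<close>.
  Well-formedness thereby becomes a condition on each position in terms of the scanned values. A
  numeral starts with \<open>One\<close>, so \<open>pending u = 0\<close> says that no digit has
  been read since the last separator.\<close>

definition legal :: "nat \<Rightarrow> letter \<Rightarrow> letter list \<Rightarrow> bool" where
  "legal N a u = (case a of Zero \<Rightarrow> 0 < pending u | One \<Rightarrow> True
     | Comma \<Rightarrow> 0 < pending u \<and> pending u \<le> N | Semicolon \<Rightarrow> pending u = 0 \<and> column u = N)"

text \<open>The word read so far consists of the complete rows \<open>R\<close>, the complete entries \<open>C\<close> of the next
  row, and the digits of \<open>x\<close>, with 0 standing for no digits.\<close>

inductive parsed :: "nat \<Rightarrow> letter list \<Rightarrow> nat list list \<Rightarrow> nat list \<Rightarrow> nat \<Rightarrow> bool" for N where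
  Nil: "parsed N [] [] [] 0"
| Zero: "parsed N u R C x \<Longrightarrow> 0 < x \<Longrightarrow> parsed N (u @ [Zero]) R C (2 * x)"
| One: "parsed N u R C x \<Longrightarrow> parsed N (u @ [One]) R C (Suc (2 * x))"
| Comma: "parsed N u R C x \<Longrightarrow> 0 < x \<Longrightarrow> x \<le> N \<Longrightarrow> parsed N (u @ [Comma]) R (C @ [x]) 0"
| Semicolon: "parsed N u R C 0 \<Longrightarrow> length C = N \<Longrightarrow> parsed N (u @ [Semicolon]) (R @ [C]) [] 0"

section \<open>Legal words and the encodings they spell\<close>

lemma parsed_scan:
  "parsed N u R C x \<Longrightarrow> row u = length R \<and> column u = length C \<and> pending u = x"
  by (induction rule: parsed.induct) simp_all

lemma parsed_range:
  "parsed N u R C x \<Longrightarrow> set C \<subseteq> {1..N} \<and> (\<forall>r\<in>set R. length r = N \<and> set r \<subseteq> {1..N})"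
  by (induction rule: parsed.induct) auto

lemma binary_0: "binary 0 = []"
  by (simp add: binary.simps)

lemma binary_double: "0 < x \<Longrightarrow> binary (2 * x) = binary x @ [Zero]"
  by (subst binary.simps) simp

lemma binary_Suc_double: "binary (Suc (2 * x)) = binary x @ [One]"
  by (subst binary.simps) simp

definition encode_rows :: "nat list list \<Rightarrow> letter list" where
  "encode_rows R = concat (map (\<lambda>row. encode_list row @ [Semicolon]) R)"

lemma encode_snoc:
  "encode_list (C @ [x]) = encode_list C @ binary x @ [Comma]"
  "encode_rows (R @ [C]) = encode_rows R @ encode_list C @ [Semicolon]"
  by (simp_all add: encode_list_def encode_rows_def)

lemma parsed_encode: "parsed N u R C x \<Longrightarrow> u = encode_rows R @ encode_list C @ binary x"
proof (induction rule: parsed.induct)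
  case Nil
  then show ?case by (simp add: binary_0 encode_list_def encode_rows_def)
qed (simp_all add: binary_0 binary_double binary_Suc_double encode_snoc, simp add: encode_list_def)

lemma parsed_binary: "parsed N u R C 0 \<Longrightarrow> parsed N (u @ binary x) R C x"
proof (induction x rule: less_induct)
  case (less x)
  show ?case
  proof (cases "x = 0")
    case True
    then show ?thesis using less.prems by (simp add: binary_0)
  next
    case False
    then have IH: "parsed N (u @ binary (x div 2)) R C (x div 2)" using less by simp
    show ?thesis
    proof (cases "even x")
      case True
      then have "x = 2 * (x div 2)" "0 < x div 2" using False by auto
      then show ?thesis using parsed.Zero[OF IH] binary_double[of "x div 2"] by simp
    next
      case odd: False
      then have "x = Suc (2 * (x div 2))" by simp
      then show ?thesis using parsed.One[OF IH] binary_Suc_double[of "x div 2"] by simp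
    qed
  qed
qed

lemma parsed_encode_list:
  "parsed N u R C 0 \<Longrightarrow> set xs \<subseteq> {1..N} \<Longrightarrow> parsed N (u @ encode_list xs) R (C @ xs) 0"
proof (induction xs rule: rev_induct)
  case (snoc x xs)
  then have "parsed N (u @ encode_list xs) R (C @ xs) 0" by simp
  from parsed.Comma[OF parsed_binary[OF this, of x]] snoc.prems show ?case
    by (simp add: encode_snoc)
qed (simp add: encode_list_def)

lemma parsed_encode_rows:
  "\<forall>r\<in>set R. length r = N \<and> set r \<subseteq> {1..N} \<Longrightarrow> parsed N (encode_rows R) R [] 0"
proof (induction R rule: rev_induct)
  case (snoc r R)
  then have "parsed N (encode_rows R @ encode_list r) R ([] @ r) 0"
    by (intro parsed_encode_list) simp_all
  from parsed.Semicolon[OF this] snoc.prems show ?case by (simp add: encode_snoc)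
qed (simp add: encode_rows_def parsed.Nil)

lemma parsed_instance:
  "\<forall>r\<in>set R. length r = N \<and> set r \<subseteq> {1..N} \<Longrightarrow> set C \<subseteq> {1..N} \<Longrightarrow>
   parsed N (encode_rows R @ encode_list C) R C 0"
  using parsed_encode_list[OF parsed_encode_rows, of R N C] by simp

definition reads :: "('a \<Rightarrow> 'a list \<Rightarrow> bool) \<Rightarrow> 'a list \<Rightarrow> bool" where
  "reads Q w \<longleftrightarrow> (\<forall>p<length w. Q (w ! p) (take p w))"

lemma reads_Nil [simp]: "reads Q []"
  by (simp add: reads_def)

lemma reads_snoc [simp]: "reads Q (u @ [a]) \<longleftrightarrow> reads Q u \<and> Q a u"
  by (auto simp: reads_def less_Suc_eq nth_append)

lemma parsed_legal: "parsed N u R C x \<Longrightarrow> reads (legal N) u"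
  by (induction rule: parsed.induct) (use parsed_scan in \<open>auto simp: legal_def\<close>)

text \<open>With \<open>parsed_encode\<close> this shows that a legal word without pending digits is
  the encoding of some rows and a list. The scanned values agree with the parse of the prefix, so
  each legal letter permits the matching rule of \<open>parsed\<close>.\<close>

lemma legal_parsed: "reads (legal N) u \<Longrightarrow> \<exists>R C. parsed N u R C (pending u)"
proof (induction u rule: rev_induct)
  case Nil
  show ?case using parsed.Nil by auto
next
  case (snoc a u)
  then obtain R C where *: "parsed N u R C (pending u)" by auto
  have "legal N a u" using snoc.prems by simp
  moreover have "column u = length C" using parsed_scan[OF *] by simp
  ultimately show ?case
    using * parsed.Zero[OF *] parsed.One[OF *] parsed.Comma[OF *] parsed.Semicolon[of N u R C]
    by (cases a) (auto simp: legal_def)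
qed

text \<open>An existential statement about positions, phrased as a negated \<open>reads\<close> so
  that \<open>reads_snoc\<close> evaluates it along a parse.\<close>

definition comma_at :: "letter list \<Rightarrow> nat \<Rightarrow> nat \<Rightarrow> nat \<Rightarrow> bool" where
  "comma_at w g h v \<longleftrightarrow>
     \<not> reads (\<lambda>a u. \<not> (a = Comma \<and> row u = g \<and> column u = h \<and> pending u = v)) w"

text \<open>An entry is identified by the comma that closes it: the prefix before it has
  \<open>g\<close> complete rows, \<open>h\<close> complete entries in the next row, and the pending
  value \<open>v\<close>. The last disjunct treats the unfinished row as one more row; in this way
  the list of an instance is read like a row of the table.\<close>

lemma parsed_comma_at:
  "parsed N u R C x \<Longrightarrow> comma_at u g h v \<longleftrightarrow>
     g < length R \<and> h < length (R ! g) \<and> v = R ! g ! h \<or> g = length R \<and> h < length C \<and> v = C ! h"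
proof (induction rule: parsed.induct)
  case (Comma u R C x)
  then show ?case using parsed_scan[OF Comma(1)]
    by (auto simp: comma_at_def nth_append less_Suc_eq)
next
  case (Semicolon u R C)
  then show ?case by (auto simp: comma_at_def nth_append less_Suc_eq)
qed (auto simp: comma_at_def)

text \<open>Rows and columns are numbered from 1.\<close>

definition entry :: "letter list \<Rightarrow> nat \<Rightarrow> nat \<Rightarrow> nat \<Rightarrow> bool" where
  "entry w g h v \<longleftrightarrow> v < length w \<and> (\<exists>g' h'. g = Suc g' \<and> h = Suc h' \<and> comma_at w g' h' v)"

lemma letter_atD: "letter_at a w p \<Longrightarrow> p < length w"
  by (simp add: letter_at_def)

text \<open>The form that the closure lemmas accept: bounded quantifiers, and the truncated value of
  the numeral. As \<open>v\<close> is below the length, truncation cannot produce it from a larger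
  value.\<close>

lemma entry_iff:
  "entry w g h v \<longleftrightarrow> v < length w \<and>
     (\<exists>p\<le>length w. \<exists>g'\<le>length w. \<exists>h'\<le>length w. letter_at Comma w p \<and> row (take p w) = g' \<and>
       column (take p w) = h' \<and> min (length w) (pending (take p w)) = v \<and> g = Suc g' \<and> h = Suc h')"
    (is "?L \<longleftrightarrow> ?R")
proof
  assume ?L
  then obtain p where p: "v < length w" "letter_at Comma w p" "g = Suc (row (take p w))"
      "h = Suc (column (take p w))" "pending (take p w) = v"
    by (auto simp: entry_def comma_at_def reads_def letter_at_def)
  moreover have "row (take p w) \<le> length w" "column (take p w) \<le> length w"
    using row_le_length[of "take p w"] column_le_length[of "take p w"] by simp_all
  ultimately show ?R using letter_atD[OF p(2)]
    by (intro conjI exI[of _ p] exI[of _ "row (take p w)"] exI[of _ "column (take p w)"]) auto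
next
  assume ?R
  then show ?L
    by (fastforce simp: entry_def comma_at_def reads_def letter_at_def min_def split: if_splits)
qed

lemma chk_entry:
  assumes "a < k" "b < k" "c < k"
  shows "chk k (\<lambda>w \<sigma>. entry w (\<sigma> a) (\<sigma> b) (\<sigma> c))"
  unfolding entry_iff using assms
  by (intro chk_conj chk_less_length chk_ex chk_letter_at chk_row chk_column chk_pending chk_Suc)
    (auto simp: agree_def)

text \<open>Because \<open>N\<close> lies below the length, a truncated numeral is at most
  \<open>N\<close> iff the numeral itself is.\<close>

lemma legal_iff:
  assumes "N < length w"
  shows "reads (legal N) w \<longleftrightarrow> (\<forall>p\<le>length w. \<forall>x\<le>length w. \<forall>c\<le>length w.
     min (length w) (pending (take p w)) = x \<longrightarrow> column (take p w) = c \<longrightarrow>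
     (letter_at Zero w p \<longrightarrow> x \<noteq> 0) \<and> (letter_at Comma w p \<longrightarrow> x \<noteq> 0 \<and> x \<le> N) \<and>
     (letter_at Semicolon w p \<longrightarrow> x = 0 \<and> c = N))" (is "_ \<longleftrightarrow> ?R")
proof -
  have len: "column (take p w) \<le> length w" for p
    using column_le_length[of "take p w"] by simp
  have "legal N (w ! p) (take p w) \<longleftrightarrow>
     (let x = min (length w) (pending (take p w)); c = column (take p w) in
     (letter_at Zero w p \<longrightarrow> x \<noteq> 0) \<and> (letter_at Comma w p \<longrightarrow> x \<noteq> 0 \<and> x \<le> N) \<and>
     (letter_at Semicolon w p \<longrightarrow> x = 0 \<and> c = N))" if "p < length w" for p
    using that assms by (cases "w ! p") (auto simp: legal_def letter_at_def Let_def min_def)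
  then have "reads (legal N) w \<longleftrightarrow> (\<forall>p<length w.
     let x = min (length w) (pending (take p w)); c = column (take p w) in
     (letter_at Zero w p \<longrightarrow> x \<noteq> 0) \<and> (letter_at Comma w p \<longrightarrow> x \<noteq> 0 \<and> x \<le> N) \<and>
     (letter_at Semicolon w p \<longrightarrow> x = 0 \<and> c = N))" by (simp add: reads_def)
  also have "\<dots> \<longleftrightarrow> ?R"
    by (auto simp: Let_def len dest: letter_atD)
  finally show ?thesis .
qed

text \<open>The hypotheses of \<open>groupI\<close> for a left neutral element and left inverses, in
  terms of the relation \<open>T\<close> and with all quantifiers bounded by the word length
  \<open>n\<close>. Closure comes from \<open>legal\<close>, which confines entries to
  \<open>{1..N}\<close>. The guards \<open>\<le> N\<close> keep out row \<open>N + 1\<close>, which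
  is the list.\<close>

definition group_axioms_at :: "nat \<Rightarrow> (nat \<Rightarrow> nat \<Rightarrow> nat \<Rightarrow> bool) \<Rightarrow> nat \<Rightarrow> nat \<Rightarrow> bool" where
  "group_axioms_at n T N e \<longleftrightarrow>
     (\<forall>x\<le>n. x \<noteq> 0 \<longrightarrow> x \<le> N \<longrightarrow> T e x x) \<and>
     (\<forall>x\<le>n. x \<noteq> 0 \<longrightarrow> x \<le> N \<longrightarrow> (\<exists>y\<le>n. y \<le> N \<and> T y x e)) \<and>
     (\<forall>x\<le>n. \<forall>y\<le>n. \<forall>z\<le>n. \<forall>a\<le>n. \<forall>b\<le>n. \<forall>c\<le>n. x \<le> N \<longrightarrow> y \<le> N \<longrightarrow>
        T x y a \<longrightarrow> T a z c \<longrightarrow> T y z b \<longrightarrow> T x b c)"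

text \<open>A step strips the conjugate by \<open>z\<close> of entry \<open>j'\<close> of the list from the left of the product
  \<open>q\<close> and leaves \<open>p\<close>; \<open>y\<close> is the inverse of \<open>z\<close>, and the list is row \<open>N + 1\<close>.\<close>

definition peel :: "nat \<Rightarrow> (nat \<Rightarrow> nat \<Rightarrow> nat \<Rightarrow> bool) \<Rightarrow> nat \<Rightarrow> nat \<Rightarrow> nat \<Rightarrow> nat \<Rightarrow> nat \<Rightarrow> nat \<Rightarrow> bool"
where
  "peel n T N e j q j' p \<longleftrightarrow> (j' \<le> n \<and> p \<le> n) \<and> j' = Suc j \<and>
     (\<exists>m\<le>n. \<exists>z\<le>n. \<exists>y\<le>n. \<exists>c\<le>n. \<exists>a\<le>n. \<exists>b\<le>n. m = Suc N \<and> z \<le> N \<and> y \<le> N \<and> b \<le> N \<and>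
        T m j' c \<and> T y z e \<and> T y c a \<and> a \<le> N \<and> T a z b \<and> T b p q)"

text \<open>The number of semicolons gives \<open>N\<close>, and the path ends in
  \<open>column w\<close>, the number of list elements after the last semicolon. Only the conjunct
  with the path lacks a test for its negation.\<close>

definition accepted :: "letter list \<Rightarrow> bool" where
  "accepted w \<longleftrightarrow> (\<exists>N\<le>length w. \<exists>e\<le>length w.
     ((N < length w \<and> reads (legal N) w) \<and> row w = N \<and> pending w = 0 \<and> e \<noteq> 0 \<and> e \<le> N \<and>
       group_axioms_at (length w) (entry w) N e) \<and>
     (\<exists>a b c d. (b \<le> length w \<and> a = 0 \<and> b = e) \<and> path (peel (length w) (entry w) N e) a b c d \<and>
       (column w = c \<and> d = e)))"

section \<open>Testing the acceptance condition\<close>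

lemma chk_legal:
  assumes "a < k"
  shows "chk k (\<lambda>w \<sigma>. \<sigma> a < length w \<and> reads (legal (\<sigma> a)) w)"
proof (rule chk_cong)
  show "chk k (\<lambda>w \<sigma>. \<sigma> a < length w \<and> (\<forall>p\<le>length w. \<forall>x\<le>length w. \<forall>c\<le>length w.
     min (length w) (pending (take p w)) = x \<longrightarrow> column (take p w) = c \<longrightarrow>
     (letter_at Zero w p \<longrightarrow> x \<noteq> 0) \<and> (letter_at Comma w p \<longrightarrow> x \<noteq> 0 \<and> x \<le> \<sigma> a) \<and>
     (letter_at Semicolon w p \<longrightarrow> x = 0 \<and> c = \<sigma> a)))"
    using assms
    by (intro chk_conj chk_less_length chk_all chk_imp chk_not chk_zero chk_letter_at chk_column
      chk_pending chk_le chk_eq) (auto simp: agree_def)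
qed (auto simp: legal_iff)

lemma chk_group_axioms_at:
  assumes "a < k" "b < k"
  shows "chk k (\<lambda>w \<sigma>. group_axioms_at (length w) (entry w) (\<sigma> a) (\<sigma> b))"
  unfolding group_axioms_at_def using assms
  by (intro chk_conj chk_all chk_ex chk_imp chk_not chk_zero chk_le chk_entry) (auto simp: agree_def)

lemma chk_peel:
  assumes "a < k" "b < k" "c1 < k" "c2 < k" "c3 < k" "c4 < k"
  shows "chk k (\<lambda>w \<sigma>. peel (length w) (entry w) (\<sigma> a) (\<sigma> b) (\<sigma> c1) (\<sigma> c2) (\<sigma> c3) (\<sigma> c4))"
  unfolding peel_def using assms
  by (intro chk_conj chk_all chk_ex chk_Suc chk_le chk_le_length chk_entry) (auto simp: agree_def)

text \<open>Scans are available for prefixes that end at a counter; the whole word is the prefix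
  that ends at its length.\<close>

lemma chk_whole:
  fixes Q :: "'a::finite list \<Rightarrow> 'a list \<Rightarrow> (nat \<Rightarrow> nat) \<Rightarrow> bool"
  assumes "chk (Suc k) (\<lambda>w \<sigma>. Q w (take (\<sigma> k) w) \<sigma>)"
    and dep: "\<And>w u \<sigma> \<tau>. agree k \<sigma> \<tau> \<Longrightarrow> Q w u \<sigma> = Q w u \<tau>"
  shows "chk k (\<lambda>w \<sigma>. Q w w \<sigma>)"
proof (rule chk_cong)
  show "chk k (\<lambda>w \<sigma>. \<exists>l\<le>length w. l = length w \<and> Q w (take l w) \<sigma>)"
    using assms by (intro chk_ex chk_conj chk_length) auto
qed simp

lemma chk_row_whole: "i < k \<Longrightarrow> chk k (\<lambda>w \<sigma>. row w = \<sigma> i)"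
  by (rule chk_whole[of k "\<lambda>w u \<sigma>. row u = \<sigma> i"]) (auto simp: agree_def intro: chk_row)

lemma chk_column_whole: "i < k \<Longrightarrow> chk k (\<lambda>w \<sigma>. column w = \<sigma> i)"
  by (rule chk_whole[of k "\<lambda>w u \<sigma>. column u = \<sigma> i"]) (auto simp: agree_def intro: chk_column)

lemma chk_pending_whole: "chk k (\<lambda>w \<sigma>. pending w = 0)"
proof (rule chk_cong)
  have "chk (Suc k) (\<lambda>w \<sigma>. \<exists>x\<le>length w. x = 0 \<and> min (length w) (pending (take (\<sigma> k) w)) = x)"
    by (intro chk_ex chk_conj chk_zero chk_pending) (auto simp: agree_def)
  then show "chk k (\<lambda>w \<sigma>. \<exists>x\<le>length w. x = 0 \<and> min (length w) (pending w) = x)"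
    by (intro chk_whole[of k "\<lambda>w u \<sigma>. \<exists>x\<le>length w. x = 0 \<and> min (length w) (pending u) = x"]) auto
\<comment> \<open>Truncation yields 0 for a nonzero value only at length 0, but the empty word has
  nothing pending.\<close>
qed (auto simp: min_def)

lemma ntest_accepted: "ntest 0 (\<lambda>w \<sigma>. accepted w)"
proof -
  have 1: "ntest (Suc (Suc 0)) (\<lambda>w \<sigma>. (\<sigma> 0 < length w \<and> reads (legal (\<sigma> 0)) w) \<and> row w = \<sigma> 0 \<and>
      pending w = 0 \<and> \<sigma> (Suc 0) \<noteq> 0 \<and> \<sigma> (Suc 0) \<le> \<sigma> 0 \<and>
      group_axioms_at (length w) (entry w) (\<sigma> 0) (\<sigma> (Suc 0)))"
    by (intro chk_ntest chk_conj[OF chk_legal] chk_conj chk_not chk_zero chk_le chk_row_whole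
      chk_pending_whole chk_group_axioms_at) simp_all
  have 2: "ntest (Suc (Suc 0)) (\<lambda>w \<sigma>. \<exists>a b c d. (b \<le> length w \<and> a = 0 \<and> b = \<sigma> (Suc 0)) \<and>
      path (peel (length w) (entry w) (\<sigma> 0) (\<sigma> (Suc 0))) a b c d \<and>
      (column w = c \<and> d = \<sigma> (Suc 0)))"
    by (intro ntest_path chk_ntest chk_peel chk_conj chk_zero chk_eq chk_le_length chk_column_whole)
      (auto simp: agree_def peel_def)
  show ?thesis
    unfolding accepted_def by (intro ntest_ex ntest_conj[OF 1 2]) (auto simp: agree_def)
qed

section \<open>Solvability as reachability\<close>

definition conjugated :: "('a, 'b) monoid_scheme \<Rightarrow> 'a list \<Rightarrow> 'a list \<Rightarrow> 'a list" where
  "conjugated G = map2 (\<lambda>z c. inv\<^bsub>G\<^esub> z \<otimes>\<^bsub>G\<^esub> c \<otimes>\<^bsub>G\<^esub> z)"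

lemma list_product_Cons: "list_product G (x # xs) = x \<otimes>\<^bsub>G\<^esub> list_product G xs"
  by (simp add: list_product_def)

lemma (in group) conjugated_closed:
  assumes "length zs = length cs" "set zs \<subseteq> carrier G" "set cs \<subseteq> carrier G"
  shows "list_product G (conjugated G zs cs) \<in> carrier G"
  using assms
proof (induction zs cs rule: list_induct2)
  case Nil
  then show ?case by (simp add: conjugated_def list_product_def)
next
  case (Cons z zs c cs)
  then show ?case by (simp add: conjugated_def list_product_Cons)
qed

context group
begin

text \<open>At vertex \<open>(j, q)\<close>, \<open>q\<close> is the product still owed by the
  elements from index \<open>j\<close> on. A path yields the list of conjugators by induction from
  its last vertex; conversely, the conjugators label the edges, and each \<open>p\<close> is the
  product for the remaining list, which lies in the group.\<close>

lemma path_solves: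
  assumes cs: "set cs \<subseteq> carrier G"
    and R: "\<And>j q j' p. R j q j' p \<longleftrightarrow> j < length cs \<and> j' = Suc j \<and> p \<in> carrier G \<and>
      (\<exists>z\<in>carrier G. q = inv z \<otimes> cs ! j \<otimes> z \<otimes> p)"
    and "j \<le> length cs"
  shows "path R j q (length cs) \<one> \<longleftrightarrow> (\<exists>zs. length zs = length cs - j \<and> set zs \<subseteq> carrier G \<and>
    q = list_product G (conjugated G zs (drop j cs)))" (is "?L \<longleftrightarrow> ?R")
proof
  have "fst x \<le> length cs \<Longrightarrow> \<exists>zs. length zs = length cs - fst x \<and> set zs \<subseteq> carrier G \<and>
      snd x = list_product G (conjugated G zs (drop (fst x) cs))"
    if "(\<lambda>(a, b) (c, d). R a b c d)\<^sup>*\<^sup>* x (length cs, \<one>)" for x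
    using that
  proof (induction rule: converse_rtranclp_induct)
    case base
    show ?case by (simp add: conjugated_def list_product_def)
  next
    case (step x y)
    obtain j q j' p where xy: "x = (j, q)" "y = (j', p)" by (metis surj_pair)
    with step.hyps(1) obtain z where z: "j < length cs" "j' = Suc j" "z \<in> carrier G"
        "q = inv z \<otimes> cs ! j \<otimes> z \<otimes> p" by (auto simp: R)
    obtain zs where zs: "length zs = length cs - j'" "set zs \<subseteq> carrier G"
        "p = list_product G (conjugated G zs (drop j' cs))"
      using step.IH z xy by auto
    have "drop j cs = cs ! j # drop j' cs" using z by (simp add: Cons_nth_drop_Suc)
    then show ?case using z zs xy
      by (intro exI[of _ "z # zs"]) (auto simp: conjugated_def list_product_Cons)
  qed
  then show ?R if ?L using that assms(3) by fastforce
  show ?L if ?R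
  proof -
    from that obtain zs where "length zs = length cs - j" "set zs \<subseteq> carrier G"
      "q = list_product G (conjugated G zs (drop j cs))" by blast
    then show ?L using assms(3)
    proof (induction zs arbitrary: j q)
      case Nil
      then show ?case by (simp add: conjugated_def list_product_def)
    next
      case (Cons z zs)
      let ?p = "list_product G (conjugated G zs (drop (Suc j) cs))"
      from Cons.prems have j: "j < length cs" by auto
      then have d: "drop j cs = cs ! j # drop (Suc j) cs" by (simp add: Cons_nth_drop_Suc)
      have "?p \<in> carrier G"
        using Cons.prems cs by (intro conjugated_closed) (auto dest: in_set_dropD)
      moreover have "q = inv z \<otimes> cs ! j \<otimes> z \<otimes> ?p"
        using Cons.prems(3) by (simp add: d conjugated_def list_product_Cons)
      ultimately have "R j q (Suc j) ?p" using j Cons.prems(2) by (auto simp: R)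
      moreover have "path R (Suc j) ?p (length cs) \<one>"
        using Cons.prems j by (intro Cons.IH) auto
      ultimately show ?case by (auto intro: converse_rtranclp_into_rtranclp)
    qed
  qed
qed

lemma solvable_path:
  assumes "set cs \<subseteq> carrier G"
    and "\<And>j q j' p. R j q j' p \<longleftrightarrow> j < length cs \<and> j' = Suc j \<and> p \<in> carrier G \<and>
      (\<exists>z\<in>carrier G. q = inv z \<otimes> cs ! j \<otimes> z \<otimes> p)"
  shows "solvable_instance G cs \<longleftrightarrow> path R 0 \<one> (length cs) \<one>"
  using path_solves[OF assms, of 0 \<one>] by (auto simp: solvable_instance_def conjugated_def)

end

text \<open>Semicolons and a comma occupy different positions. One comma therefore makes the number
  of rows strictly smaller than the length, as \<open>accepted\<close> demands.\<close>

lemma row_less_length: "row u + (if Comma \<in> set u then 1 else 0) \<le> length u"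
  by (induction u rule: rev_induct) (auto split: letter.split)

section \<open>The acceptance condition characterises the problem\<close>

lemma cayley_table_nth:
  assumes "x \<in> {1..order G}" "y \<in> {1..order G}"
  shows "cayley_table G ! (x - 1) ! (y - 1) = x \<otimes>\<^bsub>G\<^esub> y"
proof -
  have "[1..<Suc (order G)] ! (x - 1) = x" "[1..<Suc (order G)] ! (y - 1) = y"
    using assms by (subst nth_upt; simp)+
  then show ?thesis using assms by (subst cayley_table_def) (auto simp del: upt_Suc)
qed

text \<open>Entries are at most \<open>N\<close> and \<open>N\<close> is below the length, so the
  bound inside \<open>entry\<close> holds for all of them. Indices of \<open>entry\<close> start at
  1, those of lists at 0.\<close>

lemma entry_parsed:
  assumes "parsed N w R C 0" "length R = N" "N < length w"
  shows "x \<le> N \<Longrightarrow> entry w x y v \<longleftrightarrow> x \<in> {1..N} \<and> y \<in> {1..N} \<and> v = R ! (x - 1) ! (y - 1)"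
    and "entry w (Suc N) y v \<longleftrightarrow> 0 < y \<and> y - 1 < length C \<and> v = C ! (y - 1)"
proof -
  have range: "length r = N" "set r \<subseteq> {1..N}" if "r \<in> set R" for r
    using parsed_range[OF assms(1)] that by auto
  have C: "set C \<subseteq> {1..N}" using parsed_range[OF assms(1)] by simp
  show "entry w x y v \<longleftrightarrow> x \<in> {1..N} \<and> y \<in> {1..N} \<and> v = R ! (x - 1) ! (y - 1)" if "x \<le> N"
  proof (cases "x = 0 \<or> y = 0")
    case True
    then show ?thesis by (auto simp: entry_def)
  next
    case False
    then obtain g h where gh: "x = Suc g" "y = Suc h" by (metis not0_implies_Suc)
    with that assms(2) have R: "R ! g \<in> set R" by simp
    have "h < N \<Longrightarrow> R ! g ! h \<le> N" using range[OF R] nth_mem[of h "R ! g"] by fastforce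
    then show ?thesis
      using gh that range[OF R] assms(2,3) parsed_comma_at[OF assms(1), of g h v]
      by (auto simp: entry_def)
  qed
  have "h < length C \<Longrightarrow> C ! h \<le> N" for h using C nth_mem[of h C] by fastforce
  then show "entry w (Suc N) y v \<longleftrightarrow> 0 < y \<and> y - 1 < length C \<and> v = C ! (y - 1)"
    using assms(2,3) parsed_comma_at[OF assms(1), of N "y - 1" v]
    by (cases y) (fastforce simp: entry_def)+
qed


text \<open>The equation \<open>T y z \<one>\<close> identifies \<open>y\<close> as the inverse of
  \<open>z\<close>. In the converse direction every intermediate product lies in the group, hence
  within the quantifier bound, and \<open>N < n\<close> leaves room for the row number
  \<open>N + 1\<close>.\<close>

lemma peel_iff:
  fixes G :: "(nat, 'b) monoid_scheme" (structure) and cs :: "nat list"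
  assumes "group G"
    and T: "\<And>x y v. x \<le> N \<Longrightarrow> T x y v \<longleftrightarrow> x \<in> {1..N} \<and> y \<in> {1..N} \<and> v = x \<otimes> y"
    and cs: "\<And>y v. T (Suc N) y v \<longleftrightarrow> 0 < y \<and> y - 1 < length cs \<and> v = cs ! (y - 1)"
    and G: "carrier G = {1..N}" "set cs \<subseteq> carrier G" "N < n" "length cs \<le> n"
  shows "peel n T N \<one> j q j' p \<longleftrightarrow> j < length cs \<and> j' = Suc j \<and> p \<in> carrier G \<and>
    (\<exists>z\<in>carrier G. q = inv z \<otimes> cs ! j \<otimes> z \<otimes> p)" (is "?L \<longleftrightarrow> ?R")
proof -
  interpret group G by fact
  show ?thesis
  proof
    assume ?L
    then obtain z y c a b where *: "j' = Suc j" "z \<le> N" "y \<le> N" "b \<le> N" "a \<le> N"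
        "T (Suc N) j' c" "T y z \<one>" "T y c a" "T a z b" "T b p q"
      unfolding peel_def by blast
    then have "inv z = y" "z \<in> carrier G" "p \<in> carrier G" "j < length cs"
      using G T cs by (auto intro: inv_equality)
    then show ?R using * T cs by auto
  next
    assume ?R
    then obtain z where *: "j < length cs" "j' = Suc j" "p \<in> carrier G" "z \<in> carrier G"
        "q = inv z \<otimes> cs ! j \<otimes> z \<otimes> p" by blast
    moreover from this have "cs ! j \<in> carrier G" using G(2) by auto
    ultimately have mem: "cs ! j \<in> carrier G" "inv z \<in> carrier G" "inv z \<otimes> cs ! j \<in> carrier G"
      "inv z \<otimes> cs ! j \<otimes> z \<in> carrier G" by simp_all
    have le: "x \<le> N" "x \<le> n" if "x \<in> carrier G" for x using that G by auto
    have mult: "T x y (x \<otimes> y)" if "x \<in> carrier G" "y \<in> carrier G" for x y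
      using T[OF le(1)[OF that(1)]] that G(1) by simp
    have 1: "T (Suc N) j' (cs ! j)" using cs *(1,2) by simp
    have 2: "T (inv z) z \<one>" using mult[OF mem(2) *(4)] *(4) by simp
    have 3: "T (inv z \<otimes> cs ! j \<otimes> z) p q" using mult[OF mem(4) *(3)] *(5) by simp
    have 4: "Suc N \<le> n" "j' \<le> n" using G *(1,2) by simp_all
    show ?L
      unfolding peel_def
      using 1 2 mult[OF mem(2,1)] mult[OF mem(3) *(4)] 3 4 *(2) le[OF *(3)] le[OF *(4)]
        le[OF mem(1)] le[OF mem(2)] le[OF mem(3)] le[OF mem(4)]
      by blast
  qed
qed

lemma group_axioms_at_group:
  fixes G :: "(nat, 'b) monoid_scheme" (structure)
  assumes "group G"
    and T: "\<And>x y v. x \<le> N \<Longrightarrow> T x y v \<longleftrightarrow> x \<in> {1..N} \<and> y \<in> {1..N} \<and> v = x \<otimes> y"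
    and G: "carrier G = {1..N}" "N < n"
  shows "group_axioms_at n T N \<one>"
proof -
  interpret group G by fact
  have mem: "x \<noteq> 0 \<Longrightarrow> x \<le> N \<Longrightarrow> x \<in> carrier G" and le: "x \<in> carrier G \<Longrightarrow> x \<le> N" for x
    using G(1) by auto
  have T': "T x y v \<longleftrightarrow> x \<in> carrier G \<and> y \<in> carrier G \<and> v = x \<otimes> y" if "x \<le> N" for x y v
    using T[OF that] unfolding G(1) .
  have 1: "T \<one> x x" if "x \<noteq> 0" "x \<le> N" for x
    using mem[OF that] T'[OF le[OF one_closed]] by simp
  have 2: "\<exists>y\<le>n. y \<le> N \<and> T y x \<one>" if "x \<noteq> 0" "x \<le> N" for x
    using mem[OF that] le[of "inv x"] T'[of "inv x"] G(2) by (intro exI[of _ "inv x"]) simp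
  have 3: "T x b c" if "x \<le> N" "y \<le> N" "T x y a" "T a z c" "T y z b" for x y z a b c
  proof -
    have xy: "x \<in> carrier G" "y \<in> carrier G" "a = x \<otimes> y" and z: "z \<in> carrier G" "b = y \<otimes> z"
      using that(3,5) T'[OF that(1)] T'[OF that(2)] by blast+
    have "a \<le> N" using le xy by simp
    then have "c = a \<otimes> z" using that(4) T' by simp
    then show ?thesis using xy z T'[OF that(1)] by (simp add: m_assoc)
  qed
  show ?thesis unfolding group_axioms_at_def using 1 2 3 by blast
qed

lemma group_by_axioms_at:
  assumes T: "\<And>x y v. x \<le> N \<Longrightarrow> T x y v \<longleftrightarrow> x \<in> {1..N} \<and> y \<in> {1..N} \<and> v = f x y"
    and closed: "\<And>x y. x \<in> {1..N} \<Longrightarrow> y \<in> {1..N} \<Longrightarrow> f x y \<in> {1..N}"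
    and e: "e \<noteq> 0" "e \<le> N" "N < n" and ax: "group_axioms_at n T N e"
  shows "group \<lparr>carrier = {1..N}, mult = f, one = e\<rparr>"
proof (rule groupI)
  let ?G = "\<lparr>carrier = {1..N}, mult = f, one = e\<rparr>"
  have T': "T x y (f x y)" if "x \<in> {1..N}" "y \<in> {1..N}" for x y using that T by simp
  have le: "x \<le> n" if "x \<in> {1..N}" for x using that e by simp
  show "x \<otimes>\<^bsub>?G\<^esub> y \<in> carrier ?G" if "x \<in> carrier ?G" "y \<in> carrier ?G" for x y
    using that closed by simp
  show "\<one>\<^bsub>?G\<^esub> \<in> carrier ?G" using e by simp
  show "x \<otimes>\<^bsub>?G\<^esub> y \<otimes>\<^bsub>?G\<^esub> z = x \<otimes>\<^bsub>?G\<^esub> (y \<otimes>\<^bsub>?G\<^esub> z)"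
    if "x \<in> carrier ?G" "y \<in> carrier ?G" "z \<in> carrier ?G" for x y z
  proof -
    have m: "x \<in> {1..N}" "y \<in> {1..N}" "z \<in> {1..N}" using that by simp_all
    note c = closed[OF m(1,2)] closed[OF m(2,3)]
    have "T x (f y z) (f (f x y) z)"
      using ax m c T'[OF m(1,2)] T'[OF c(1) m(3)] T'[OF m(2,3)]
        le[OF m(1)] le[OF m(2)] le[OF m(3)] le[OF c(1)] le[OF c(2)] le[OF closed[OF c(1) m(3)]]
      unfolding group_axioms_at_def by (meson atLeastAtMost_iff)
    then show ?thesis using T m by simp
  qed
  show "\<one>\<^bsub>?G\<^esub> \<otimes>\<^bsub>?G\<^esub> x = x" if "x \<in> carrier ?G" for x
  proof -
    have "T e x x" using ax that e unfolding group_axioms_at_def by simp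
    then show ?thesis using T e by simp
  qed
  show "\<exists>y\<in>carrier ?G. y \<otimes>\<^bsub>?G\<^esub> x = \<one>\<^bsub>?G\<^esub>" if "x \<in> carrier ?G" for x
  proof -
    have "\<exists>y\<le>n. y \<le> N \<and> T y x e" using ax that e unfolding group_axioms_at_def by simp
    then show ?thesis using T by auto
  qed
qed

lemma solvable_iff_path:
  fixes G :: "(nat, 'b) monoid_scheme" (structure)
  assumes "group G"
    and w: "parsed N w R cs 0" "length R = N" "N < length w"
    and G: "carrier G = {1..N}"
    and R: "\<And>x y. x \<in> {1..N} \<Longrightarrow> y \<in> {1..N} \<Longrightarrow> R ! (x - 1) ! (y - 1) = x \<otimes> y"
  shows "solvable_instance G cs \<longleftrightarrow>
      path (peel (length w) (entry w) N \<one>) 0 \<one> (column w) \<one>"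
    and "group_axioms_at (length w) (entry w) N \<one>"
proof -
  interpret group G by fact
  have T: "entry w x y v \<longleftrightarrow> x \<in> {1..N} \<and> y \<in> {1..N} \<and> v = x \<otimes> y" if "x \<le> N" for x y v
    using entry_parsed(1)[OF w that] R by auto
  have col: "length cs = column w" using parsed_scan[OF w(1)] by simp
  have cs: "set cs \<subseteq> carrier G" using parsed_range[OF w(1)] G by simp
  show "solvable_instance G cs \<longleftrightarrow> path (peel (length w) (entry w) N \<one>) 0 \<one> (column w) \<one>"
    unfolding col[symmetric]
  proof (rule solvable_path[OF cs])
    show "peel (length w) (entry w) N \<one> j q j' p \<longleftrightarrow> j < length cs \<and> j' = Suc j \<and> p \<in> carrier G \<and>
      (\<exists>z\<in>carrier G. q = inv z \<otimes> cs ! j \<otimes> z \<otimes> p)" for j q j' p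
      by (rule peel_iff[OF \<open>group G\<close> T entry_parsed(2)[OF w] G cs w(3)])
        (use col column_le_length[of w] in simp_all)
  qed
  show "group_axioms_at (length w) (entry w) N \<one>"
    by (rule group_axioms_at_group[OF \<open>group G\<close> T G w(3)])
qed

lemma accepted_iff: "accepted w \<longleftrightarrow> w \<in> conjugate_product_problem"
proof
  assume "accepted w"
  then obtain N e where N: "N < length w" "reads (legal N) w" "row w = N" "pending w = 0"
      and e: "e \<noteq> 0" "e \<le> N" "group_axioms_at (length w) (entry w) N e"
      and path: "path (peel (length w) (entry w) N e) 0 e (column w) e"
    unfolding accepted_def by blast
  obtain R C where w: "parsed N w R C 0" using legal_parsed[OF N(2)] N(4) by auto
  have R: "length R = N" using parsed_scan[OF w] N(3) by simp
  have rows: "length r = N" "set r \<subseteq> {1..N}" if "r \<in> set R" for r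
    using parsed_range[OF w] that by auto
  \<comment> \<open>The group is rebuilt from the parsed rows, with the guessed \<open>e\<close> as
    neutral element. Below, its Cayley table is shown to be \<open>R\<close> again, which makes the
    word an encoding of it.\<close>
  define G where "G = \<lparr>carrier = {1..N}, mult = (\<lambda>x y. R ! (x - 1) ! (y - 1)), one = e\<rparr>"
  interpret group G
    unfolding G_def
  proof (rule group_by_axioms_at[OF entry_parsed(1)[OF w R N(1)] _ e(1,2) N(1) e(3)])
    fix x y assume *: "x \<in> {1..N}" "y \<in> {1..N}"
    then have "R ! (x - 1) \<in> set R" using R by (intro nth_mem) auto
    from rows[OF this] * show "R ! (x - 1) ! (y - 1) \<in> {1..N}"
      by (metis One_nat_def Suc_pred' atLeastAtMost_iff less_eq_Suc_le nth_mem subsetD)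
  qed simp
  have order: "order G = N" by (simp add: order_def G_def)
  have "cayley_table G = R"
  proof (rule nth_equalityI)
    fix i assume i: "i < length (cayley_table G)"
    then have iN: "i < N" by (simp add: cayley_table_def order del: upt_Suc)
    show "cayley_table G ! i = R ! i"
    proof (rule nth_equalityI)
      show "length (cayley_table G ! i) = length (R ! i)"
        using iN rows(1)[of "R ! i"] R by (simp add: cayley_table_def order del: upt_Suc)
      fix h assume "h < length (cayley_table G ! i)"
      then have "h < N" using iN by (simp add: cayley_table_def order del: upt_Suc)
      then show "cayley_table G ! i ! h = R ! i ! h"
        using cayley_table_nth[of "Suc i" G "Suc h"] iN by (simp add: order) (simp add: G_def)
    qed
  qed (simp add: cayley_table_def order R del: upt_Suc)
  then have "w = encode_instance G C"
    using parsed_encode[OF w] by (simp add: encode_instance_def encode_rows_def binary_0)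
  moreover have "solvable_instance G C"
    by (subst solvable_iff_path(1)[OF is_group w R N(1)]) (use path in \<open>simp_all add: G_def\<close>)
  moreover have "carrier G = {1..order G}" unfolding order by (simp add: G_def)
  moreover have "set C \<subseteq> carrier G" using parsed_range[OF w] by (simp add: G_def)
  ultimately show "w \<in> conjugate_product_problem"
    unfolding conjugate_product_problem_def using is_group by blast
next
  assume "w \<in> conjugate_product_problem"
  then obtain G C where *: "w = encode_instance G C" "group G" "carrier G = {1..order G}"
      "set C \<subseteq> carrier G" "solvable_instance G C"
    unfolding conjugate_product_problem_def by blast
  interpret group G by fact
  define N where "N = order G"
  have G: "carrier G = {1..N}" using *(3) N_def by simp
  have one: "\<one>\<^bsub>G\<^esub> \<in> {1..N}" using one_closed unfolding G .
  have mult: "cayley_table G ! (x - 1) ! (y - 1) = x \<otimes>\<^bsub>G\<^esub> y" if "x \<in> {1..N}" "y \<in> {1..N}" for x y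
    using cayley_table_nth that unfolding N_def by blast
  have "length r = N \<and> set r \<subseteq> {1..N}" if r: "r \<in> set (cayley_table G)" for r
  proof -
    obtain g where "g \<in> {1..N}" "r = map (\<lambda>h. g \<otimes>\<^bsub>G\<^esub> h) [1..<Suc N]"
      using r by (force simp: cayley_table_def N_def simp del: upt_Suc)
    then show ?thesis using m_closed unfolding G by (auto simp del: upt_Suc)
  qed
  then have w: "parsed N w (cayley_table G) C 0"
    unfolding *(1) encode_instance_def using parsed_instance[of "cayley_table G" N C] *(4)
    by (simp add: G encode_rows_def)
  have R: "length (cayley_table G) = N" by (simp add: cayley_table_def N_def del: upt_Suc)
  have scan: "row w = N" "pending w = 0" using parsed_scan[OF w] R by simp_all
  \<comment> \<open>A group has an element, so the table has an entry in its first row and column;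
    the comma behind it yields \<open>N < length w\<close>.\<close>
  have "cayley_table G ! 0 \<in> set (cayley_table G)" using R one by (intro nth_mem) simp
  then have "length (cayley_table G ! 0) = N" using parsed_range[OF w] by blast
  then have "comma_at w 0 0 (cayley_table G ! 0 ! 0)"
    using parsed_comma_at[OF w] R one by simp
  then have "Comma \<in> set w" by (force simp: comma_at_def reads_def in_set_conv_nth)
  then have n: "N < length w" using row_less_length[of w] scan by simp
  have "path (peel (length w) (entry w) N \<one>\<^bsub>G\<^esub>) 0 \<one>\<^bsub>G\<^esub> (column w) \<one>\<^bsub>G\<^esub>"
    using *(5) solvable_iff_path(1)[OF is_group w R n G mult] by simp
  moreover have "group_axioms_at (length w) (entry w) N \<one>\<^bsub>G\<^esub>"
    by (rule solvable_iff_path(2)[OF is_group w R n G mult])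
  moreover note n scan parsed_legal[OF w] one
  ultimately show "accepted w"
    unfolding accepted_def
    by (intro exI[of _ N] exI[of _ "\<one>\<^bsub>G\<^esub>"] conjI exI[of _ 0] exI[of _ "column w"]) simp_all
qed

theorem proposition12: "conjugate_product_problem \<in> NL"
  using NL_by_ntest ntest_accepted unfolding accepted_iff .

end
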